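(* Let $\alpha \in (1,\infty)$ and let $\mathcal{G}_\alpha$ be the diagonal comb metric graph with parameter $\alpha$, of (finite) volume $|\mathcal{G}_\alpha|$. Let $\lambda_k(\mathcal{G}_\alpha)$ denote the $k$-th eigenvalue of the Neumann Laplacian on $\mathcal{G}_\alpha$. Then, for all $k \geq 1$, \[ \frac{\pi^2 k^2}{4|\mathcal{G}_\alpha|^2} \leq \lambda_k(\mathcal{G}_\alpha) \leq \frac{\pi^2 k^2}{4}. \]
   Context: A metric graph $\mathcal{G}$ is a countable collection of intervals (edges) $(\mathsf{e})_{\mathsf{e}\in\mathsf{E}}$ of finite lengths $\ell_{\mathsf{e}}\in(0,\infty)$, glued at their endpoints to form a graph-like space, endowed with the shortest-path metric and the measure inherited from the Lebesgue measure on the edges. Its volume is $|\mathcal{G}|:=\sum_{\mathsf{e}\in\mathsf{E}}\ell_{\mathsf{e}}$. For $\alpha>0$ the diagonal comb $\mathcal{G}_\alpha$ is obtained by taking the interval $(0,1]$ as a "backbone" and attaching, for every $n=1,2,\dots$, an edge ("tooth") of length $n^{-\alpha}$ by one of its endpoints to the point $n^{-\alpha}\in(0,1]$. Thus the edges are the teeth, of lengths $n^{-\alpha}$ ($n\ge 1$), and the backbone edges of lengths $n^{-\alpha}-(n+1)^{-\alpha}$ ($n\geq 1$) joining the foot points of the $n$-th and $(n+1)$-st teeth. The point $0$ does not belong to $\mathcal{G}_\alpha$. The volume $|\mathcal{G}_\alpha|$ is finite if and only if $\alpha>1$. $H^1(\mathcal{G})$ is the space of continuous functions $\phi:\mathcal{G}\to\mathbb{C}$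 whose restriction to each edge $\mathsf{e}$ lies in $H^1(\mathsf{e})$ and for which $\sum_{\mathsf{e}\in\mathsf{E}}\|\phi|_{\mathsf{e}}\|_{H^1(\mathsf{e})}^2<\infty$. The Neumann Laplacian on $\mathcal{G}$ is the nonnegative self-adjoint operator in $L^2(\mathcal{G})$ associated with the quadratic form $\phi\mapsto\sum_{\mathsf{e}\in\mathsf{E}}\int_{\mathsf{e}}|\phi'(x)|^2\,\mathrm{d}x$ with domain $H^1(\mathcal{G})$. It is known that the Neumann Laplacian on $\mathcal{G}_\alpha$ has purely discrete spectrum if and only if $\alpha>\frac12$; in that case $\{\lambda_k(\mathcal{G}_\alpha)\}_{k\ge1}$ denotes its eigenvalues enumerated increasingly and counted with multiplicity, starting at $k=1$.
   Formalization: The lower bound is stated only for k ≥ 2 (the upper bound for all k ≥ 1), because at k = 1 it fails: the volume is finite, so constants are eigenfunctions and the first eigenvalue is 0, while π²/(4|G_α|²) > 0. *)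

theory Defs
  imports "HOL-Analysis.Analysis"
begin

section \<open>Metric graphs\<close>

record ('v, 'e) mgraph =
  gedges :: "'e set"
  glen :: "'e \<Rightarrow> real"
  gtail :: "'e \<Rightarrow> 'v"
  ghead :: "'e \<Rightarrow> 'v"

definition metric_graph :: "('v, 'e) mgraph \<Rightarrow> bool" where
  "metric_graph G \<longleftrightarrow> countable (gedges G) \<and> (\<forall>e\<in>gedges G. 0 < glen G e)"

text \<open>Gluing: the edge \<open>e\<close> is the interval \<open>[0, glen G e]\<close>, whose end points are identified
  with the vertices \<open>gtail G e\<close> and \<open>ghead G e\<close>; \<open>gchart G e x\<close> is the point of the
  graph at position \<open>x\<close> on \<open>e\<close>.\<close>

datatype ('v, 'e) gpoint = Vertex 'v | Inner 'e real

definition gchart :: "('v, 'e) mgraph \<Rightarrow> 'e \<Rightarrow> real \<Rightarrow> ('v, 'e) gpoint" where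
  "gchart G e x =
    (if x = 0 then Vertex (gtail G e)
     else if x = glen G e then Vertex (ghead G e)
     else Inner e x)"

definition gpoints :: "('v, 'e) mgraph \<Rightarrow> ('v, 'e) gpoint set" where
  "gpoints G = (\<Union>e\<in>gedges G. gchart G e ` {0..glen G e})"

definition gvolume :: "('v, 'e) mgraph \<Rightarrow> real" where
  "gvolume G = (\<Sum>\<^sub>\<infinity>e\<in>gedges G. glen G e)"

text \<open>\<open>gpath G p q l\<close>: there is a path of length \<open>l\<close> from \<open>p\<close> to \<open>q\<close> made of finitely many
  segments, each contained in one edge.\<close>

inductive gpath :: "('v, 'e) mgraph \<Rightarrow> ('v, 'e) gpoint \<Rightarrow> ('v, 'e) gpoint \<Rightarrow> real \<Rightarrow> bool"
  for G p where
  start: "p \<in> gpoints G \<Longrightarrow> gpath G p p 0"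
| segment: "gpath G p (gchart G e s) l \<Longrightarrow> e \<in> gedges G \<Longrightarrow>
    s \<in> {0..glen G e} \<Longrightarrow> t \<in> {0..glen G e} \<Longrightarrow> gpath G p (gchart G e t) (l + \<bar>s - t\<bar>)"

text \<open>Shortest-path metric; points that no path connects are at distance \<open>\<infinity>\<close>.\<close>

definition gdist :: "('v, 'e) mgraph \<Rightarrow> ('v, 'e) gpoint \<Rightarrow> ('v, 'e) gpoint \<Rightarrow> ennreal" where
  "gdist G p q = Inf {ennreal l |l. gpath G p q l}"

definition gcontinuous :: "('v, 'e) mgraph \<Rightarrow> (('v, 'e) gpoint \<Rightarrow> complex) \<Rightarrow> bool" where
  "gcontinuous G \<phi> \<longleftrightarrow>
    (\<forall>p\<in>gpoints G. \<forall>\<epsilon>>0. \<exists>\<delta>>0. \<forall>q\<in>gpoints G.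
       gdist G p q < ennreal \<delta> \<longrightarrow> dist (\<phi> q) (\<phi> p) < \<epsilon>)"

definition grestr ::
  "('v, 'e) mgraph \<Rightarrow> (('v, 'e) gpoint \<Rightarrow> complex) \<Rightarrow> 'e \<Rightarrow> real \<Rightarrow> complex" where
  "grestr G \<phi> e x = \<phi> (gchart G e x)"

section \<open>Function spaces\<close>

definition square_integrable :: "'a measure \<Rightarrow> ('a \<Rightarrow> complex) \<Rightarrow> bool" where
  "square_integrable M f \<longleftrightarrow> f \<in> borel_measurable M \<and> integrable M (\<lambda>x. (norm (f x))\<^sup>2)"

text \<open>The Sobolev space \<open>H\<^sup>1\<close> of an interval \<open>[0, l]\<close> consists of the absolutely continuous
  functions with square-integrable derivative, i.e. the primitives of \<open>L\<^sup>2\<close>-functions. The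
  derivative is unique almost everywhere, so that the choice in \<open>wderiv\<close> is immaterial
  under integrals.\<close>

definition has_wderiv :: "real \<Rightarrow> (real \<Rightarrow> complex) \<Rightarrow> (real \<Rightarrow> complex) \<Rightarrow> bool" where
  "has_wderiv l u g \<longleftrightarrow> square_integrable (lebesgue_on {0..l}) g \<and>
    (\<forall>x\<in>{0..l}. u x = u 0 + integral\<^sup>L (lebesgue_on {0..x}) g)"

definition wderiv :: "real \<Rightarrow> (real \<Rightarrow> complex) \<Rightarrow> real \<Rightarrow> complex" where
  "wderiv l u = (SOME g. has_wderiv l u g)"

definition H1_interval :: "real \<Rightarrow> (real \<Rightarrow> complex) set" where
  "H1_interval l = {u. \<exists>g. has_wderiv l u g}"

definition H1_norm_sq :: "real \<Rightarrow> (real \<Rightarrow> complex) \<Rightarrow> real" where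
  "H1_norm_sq l u = (LINT x|lebesgue_on {0..l}. (norm (u x))\<^sup>2)
    + (LINT x|lebesgue_on {0..l}. (norm (wderiv l u x))\<^sup>2)"

text \<open>Elements of \<open>L\<^sup>2\<close> are represented by functions, without passing to the quotient modulo
  null functions.\<close>

definition L2_graph :: "('v, 'e) mgraph \<Rightarrow> (('v, 'e) gpoint \<Rightarrow> complex) set" where
  "L2_graph G = {f.
    (\<forall>e\<in>gedges G. square_integrable (lebesgue_on {0..glen G e}) (grestr G f e)) \<and>
    (\<lambda>e. LINT x|lebesgue_on {0..glen G e}. (norm (grestr G f e x))\<^sup>2) summable_on gedges G}"

definition L2_inner ::
  "('v, 'e) mgraph \<Rightarrow> (('v, 'e) gpoint \<Rightarrow> complex) \<Rightarrow> (('v, 'e) gpoint \<Rightarrow> complex) \<Rightarrow> complex" where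
  "L2_inner G f h = (\<Sum>\<^sub>\<infinity>e\<in>gedges G.
     LINT x|lebesgue_on {0..glen G e}. grestr G f e x * cnj (grestr G h e x))"

definition H1_graph :: "('v, 'e) mgraph \<Rightarrow> (('v, 'e) gpoint \<Rightarrow> complex) set" where
  "H1_graph G = {\<phi>. gcontinuous G \<phi> \<and>
    (\<forall>e\<in>gedges G. grestr G \<phi> e \<in> H1_interval (glen G e)) \<and>
    (\<lambda>e. H1_norm_sq (glen G e) (grestr G \<phi> e)) summable_on gedges G}"

section \<open>The Neumann Laplacian and its eigenvalues\<close>

text \<open>The sesquilinear form with \<open>energy_form G \<phi> \<phi> = (\<Sum>\<^sub>\<infinity>e\<in>gedges G. \<integral>\<^sub>e \<bar>\<phi>'\<bar>\<^sup>2)\<close>.\<close>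

definition energy_form ::
  "('v, 'e) mgraph \<Rightarrow> (('v, 'e) gpoint \<Rightarrow> complex) \<Rightarrow> (('v, 'e) gpoint \<Rightarrow> complex) \<Rightarrow> complex" where
  "energy_form G \<phi> \<psi> = (\<Sum>\<^sub>\<infinity>e\<in>gedges G.
     LINT x|lebesgue_on {0..glen G e}.
       wderiv (glen G e) (grestr G \<phi> e) x * cnj (wderiv (glen G e) (grestr G \<psi> e) x))"

text \<open>Graph (as a set of pairs) of the operator in \<open>L\<^sup>2\<close> associated with this form on the domain
  \<open>H1_graph G\<close>; the second component is determined up to null functions.\<close>

definition neumann_laplacian ::
  "('v, 'e) mgraph \<Rightarrow> ((('v, 'e) gpoint \<Rightarrow> complex) \<times> (('v, 'e) gpoint \<Rightarrow> complex)) set" where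
  "neumann_laplacian G = {(\<phi>, f). \<phi> \<in> H1_graph G \<and> f \<in> L2_graph G \<and>
     (\<forall>\<psi>\<in>H1_graph G. energy_form G \<phi> \<psi> = L2_inner G f \<psi>)}"

definition lin_indep_on :: "'a set \<Rightarrow> nat \<Rightarrow> (nat \<Rightarrow> 'a \<Rightarrow> complex) \<Rightarrow> bool" where
  "lin_indep_on X k \<phi> \<longleftrightarrow>
    (\<forall>c. (\<forall>p\<in>X. (\<Sum>i<k. c i * \<phi> i p) = 0) \<longrightarrow> (\<forall>i<k. c i = 0))"

text \<open>At least \<open>k\<close> eigenvalues, counted with multiplicity, are \<open>\<le> t\<close>. Eigenfunctions for
  different eigenvalues being independent, this says that the dimensions of the eigenspaces
  for the eigenvalues \<open>\<mu> \<le> t\<close> add up to at least \<open>k\<close>.\<close>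

definition eigenvalue_count_ge :: "('v, 'e) mgraph \<Rightarrow> real \<Rightarrow> nat \<Rightarrow> bool" where
  "eigenvalue_count_ge G t k \<longleftrightarrow>
    (\<exists>\<mu> :: nat \<Rightarrow> real. \<exists>\<phi>. lin_indep_on (gpoints G) k \<phi> \<and>
      (\<forall>i<k. \<mu> i \<le> t \<and> (\<phi> i, \<lambda>p. of_real (\<mu> i) * \<phi> i p) \<in> neumann_laplacian G))"

text \<open>The \<open>k\<close>-th smallest eigenvalue, \<open>k \<ge> 1\<close>, of a Neumann Laplacian with purely discrete
  spectrum, counted with multiplicity. The numbering starts at \<open>k = 1\<close>, so that on a graph of
  finite volume the first eigenvalue is \<open>0\<close>, with constant eigenfunctions.\<close>

definition neumann_eigenvalue :: "('v, 'e) mgraph \<Rightarrow> nat \<Rightarrow> real" where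
  "neumann_eigenvalue G k = Inf {t. eigenvalue_count_ge G t k}"

section \<open>Diagonal combs\<close>

text \<open>\<open>Foot n\<close> is the backbone point \<open>n\<^bsup>-\<alpha>\<^esup>\<close>, where the \<open>n\<close>-th tooth is attached, and
  \<open>Tip n\<close> is the free end of that tooth (\<open>n \<ge> 1\<close>).\<close>

datatype comb_vertex = Foot nat | Tip nat
datatype comb_edge = Tooth nat | Backbone nat

definition diagonal_comb :: "real \<Rightarrow> (comb_vertex, comb_edge) mgraph" where
  "diagonal_comb \<alpha> = \<lparr>
     gedges = Tooth ` {1..} \<union> Backbone ` {1..},
     glen = (\<lambda>e. case e of
         Tooth n \<Rightarrow> real n powr (-\<alpha>)
       | Backbone n \<Rightarrow> real n powr (-\<alpha>) - real (n + 1) powr (-\<alpha>)),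
     gtail = (\<lambda>e. case e of Tooth n \<Rightarrow> Foot n | Backbone n \<Rightarrow> Foot (n + 1)),
     ghead = (\<lambda>e. case e of Tooth n \<Rightarrow> Tip n | Backbone n \<Rightarrow> Foot n)\<rparr>"

lemma metric_graph_diagonal_comb:
  assumes "0 < \<alpha>"
  shows "metric_graph (diagonal_comb \<alpha>)"
  unfolding metric_graph_def diagonal_comb_def
  using assms by (auto intro!: powr_less_mono2_neg)

end

theory Submission
  imports Defs "HOL-Complex_Analysis.Great_Picard"
begin

text \<open>
  The comb is a tree that consists of a backbone of length 1 and of infinitely many teeth. Its total
  length is finite, which makes the following two arguments work.

  \<^emph>\<open>Lower bound.\<close> Put \<open>L = vol / k\<close>. A mass argument finds \<open>k - 1\<close> points that cut the comb into pieces
  of length at most \<open>L\<close>, each of which contains a cut point in its boundary. A function that vanishes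
  at the cut points satisfies \<open>\<integral>|f'|\<^sup>2 \<ge> \<omega>\<^sup>2 \<integral>|f|\<^sup>2\<close> for every \<open>\<omega> < \<pi> / (2 L)\<close>
  (\<open>comb_poincare_with_zeros\<close>). On one piece this is Picone's inequality with the weight
  \<open>\<omega> tan (\<omega> m)\<close>, where \<open>m\<close> is the length of the part of the piece that lies behind the point in
  question, seen from the zero: the weight solves the Riccati equation along an edge, and at a
  branching point superadditivity of the tangent gives the boundary terms the right sign. The span of \<open>k\<close> independent
  eigenfunctions contains a nonzero function that vanishes at the \<open>k - 1\<close> points, and its Rayleigh
  quotient is at most the largest of the eigenvalues (\<open>eigenvalue_count_lower\<close>).

  \<^emph>\<open>Upper bound.\<close> The backbone and the first tooth form a path of length 2, which carries \<open>k\<close> half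
  periods of the sine of frequency \<open>\<pi> k / 2\<close>. Extended by constants to the other teeth,
  these functions span a space of dimension \<open>k\<close> on which the Rayleigh quotient is at most
  \<open>(\<pi> k / 2)\<^sup>2\<close> (\<open>bump_trial\<close>). What remains is the existence of eigenfunctions. On a tree the
  Neumann problem \<open>- u'' = v\<close> is solved by two integrations: first the flux of \<open>v\<close> through each
  point, then the integral of the flux along paths. The resulting operator \<open>green\<close> is symmetric and
  compact for the \<open>L\<^sup>2\<close> inner product on bounded functions, and its eigenfunctions are
  found by maximizing Rayleigh quotients (\<open>green_eigenfunctions\<close>). They are Lipschitz, so that they
  belong to the Sobolev space of the graph.

  All analysis takes place on a subset of the real line that is the disjoint union of the backbone and
  the teeth. Paths and fluxes are integrals against one kernel, \<open>incidence\<close>, in its two variables, and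
  Green's identity for the graph (\<open>green_identity\<close>) is Fubini's theorem for this kernel.
\<close>

section \<open>Linear algebra\<close>

lemma nontrivial_combination_vanishing_set:
  fixes f :: "'i \<Rightarrow> 'a \<Rightarrow> 'b::field"
  assumes "finite Z" "finite I" "card Z < card I"
  shows "\<exists>c. (\<exists>i\<in>I. c i \<noteq> 0) \<and> (\<forall>z\<in>Z. (\<Sum>i\<in>I. c i * f i z) = 0)"
  using assms
proof (induction Z arbitrary: I f rule: finite_induct)
  case empty
  then have "I \<noteq> {}" by auto
  then show ?case by (intro exI[of _ "\<lambda>_. 1"]) auto
next
  case (insert z Z)
  show ?case
  proof (cases "\<forall>i\<in>I. f i z = 0")
    case True
    obtain c where "\<exists>i\<in>I. c i \<noteq> 0" "\<forall>z\<in>Z. (\<Sum>i\<in>I. c i * f i z) = 0"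
      using insert.IH[of I f] insert.prems insert.hyps by auto
    then show ?thesis using True by (intro exI[of _ c]) auto
  next
    case False
    then obtain p where p: "p \<in> I" "f p z \<noteq> 0" by auto
    define J where "J = I - {p}"
    have J: "finite J" "I = insert p J" "p \<notin> J" "card I = Suc (card J)"
      using p insert.prems by (auto simp: J_def card_Suc_Diff1)
    \<comment> \<open>One step of elimination: the pivot \<open>p\<close> is used to satisfy the equation at \<open>z\<close>.\<close>
    define h where "h i y = f i y - f i z / f p z * f p y" for i y
    obtain c where c: "\<exists>i\<in>J. c i \<noteq> 0" "\<forall>y\<in>Z. (\<Sum>i\<in>J. c i * h i y) = 0"
      using insert.IH[of J h] insert.prems insert.hyps J by auto
    define d where "d = c(p := - (\<Sum>i\<in>J. c i * (f i z / f p z)))"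
    have dJ: "(\<Sum>i\<in>J. d i * f i y) = (\<Sum>i\<in>J. c i * f i y)" for y
      using J(3) by (intro sum.cong) (auto simp: d_def)
    have sum_d: "(\<Sum>i\<in>I. d i * f i y) = (\<Sum>i\<in>J. c i * h i y)" for y
      using J by (simp add: dJ) (simp add: d_def h_def right_diff_distrib sum_subtractf
          sum_distrib_right mult.assoc)
    have "(\<Sum>i\<in>I. d i * f i z) = 0"
      using p by (simp add: sum_d h_def)
    moreover have "\<exists>i\<in>I. d i \<noteq> 0"
      using c(1) J by (auto simp: d_def)
    ultimately show ?thesis using c(2) sum_d by (intro exI[of _ d]) auto
  qed
qed

lemma nontrivial_combination_vanishing:
  fixes f :: "nat \<Rightarrow> 'a \<Rightarrow> 'b::field"
  assumes "finite Z" "card Z < k"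
  obtains c where "\<exists>i<k. c i \<noteq> 0" "\<And>z. z \<in> Z \<Longrightarrow> (\<Sum>i<k. c i * f i z) = 0"
  using nontrivial_combination_vanishing_set[of Z "{..<k}" f] assms by auto

section \<open>Compact symmetric operators\<close>

lemma discriminant_le_if_quadratic_nonneg:
  fixes a b d :: real
  assumes "\<And>s. 0 \<le> a + 2 * s * b + s\<^sup>2 * d"
  shows "b\<^sup>2 \<le> a * d"
proof (cases "d = 0")
  case True
  have "b = 0"
  proof (rule ccontr)
    assume "b \<noteq> 0"
    then show False using assms[of "-(a + 1) / (2 * b)"] True by (simp add: field_simps)
  qed
  then show ?thesis using True by simp
next
  case False
  have "0 \<le> d"
  proof (rule ccontr)
    assume "\<not> 0 \<le> d"
    define s where "s = 1 + (\<bar>a\<bar> + 2 * \<bar>b\<bar>) / (- d)"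
    have s: "1 \<le> s" "s * (- d) = - d + \<bar>a\<bar> + 2 * \<bar>b\<bar>"
      using \<open>\<not> 0 \<le> d\<close> by (auto simp: s_def field_simps)
    have nonneg: "0 \<le> a + 2 * s * b + s * (s * d)"
      using assms[of s] by (simp add: power2_eq_square)
    have "s * d = d - \<bar>a\<bar> - 2 * \<bar>b\<bar>" using s(2) by simp
    then have "s * (s * d) = s * (d - \<bar>a\<bar> - 2 * \<bar>b\<bar>)" by simp
    also have "\<dots> = s * d - s * \<bar>a\<bar> - 2 * (s * \<bar>b\<bar>)" by (simp add: algebra_simps)
    finally have sd: "s * (s * d) = s * d - s * \<bar>a\<bar> - 2 * (s * \<bar>b\<bar>)" .
    have "a \<le> s * \<bar>a\<bar>"
      using s(1) mult_right_mono[of 1 s "\<bar>a\<bar>"] by simp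
    moreover have "s * b \<le> s * \<bar>b\<bar>"
      using s(1) by (intro mult_left_mono) auto
    ultimately have "s * (- d) \<le> 0" using nonneg sd by simp
    then show False using \<open>\<not> 0 \<le> d\<close> s(1) by (simp add: zero_le_mult_iff mult_le_0_iff)
  qed
  then have "0 < d" using False by simp
  then show ?thesis using assms[of "- b / d"] by (simp add: field_simps power2_eq_square)
qed

text \<open>The supremum \<open>\<rho>\<close> of the Rayleigh quotient is an eigenvalue. Along a maximizing sequence the
  semidefinite form \<open>\<rho> * B v v - B (K v) v\<close> tends to \<open>0\<close>, and the Cauchy-Schwarz inequality for this form
  gives the eigenvalue equation for every limit point \<open>y\<close> of the images under \<open>K\<close>. The limit is
  supplied by \<open>K\<close> and equations are tested with elements of \<open>X\<close>, so that a semi-inner product on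
  a space of functions suffices.\<close>

lemma compact_symmetric_operator_eigenvector:
  fixes X :: "('a \<Rightarrow> real) set" and B :: "('a \<Rightarrow> real) \<Rightarrow> ('a \<Rightarrow> real) \<Rightarrow> real"
    and K :: "('a \<Rightarrow> real) \<Rightarrow> 'a \<Rightarrow> real"
  assumes X: "\<And>v w a b. v \<in> X \<Longrightarrow> w \<in> X \<Longrightarrow> (\<lambda>q. a * v q + b * w q) \<in> X"
    and B_lin: "\<And>u v w a b. u \<in> X \<Longrightarrow> v \<in> X \<Longrightarrow> w \<in> X \<Longrightarrow>
      B (\<lambda>q. a * u q + b * v q) w = a * B u w + b * B v w"
    and B_sym: "\<And>v w. v \<in> X \<Longrightarrow> w \<in> X \<Longrightarrow> B v w = B w v"
    and B_pos: "\<And>v. v \<in> X \<Longrightarrow> 0 \<le> B v v"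
    and KX: "\<And>v. v \<in> X \<Longrightarrow> K v \<in> X"
    and K_lin: "\<And>u v a b. u \<in> X \<Longrightarrow> v \<in> X \<Longrightarrow>
      K (\<lambda>q. a * u q + b * v q) = (\<lambda>q. a * K u q + b * K v q)"
    and K_sym: "\<And>v w. v \<in> X \<Longrightarrow> w \<in> X \<Longrightarrow> B (K v) w = B v (K w)"
    and K_bound: "\<And>v. v \<in> X \<Longrightarrow> B (K v) v \<le> C * B v v"
    and K_compact: "\<And>v. (\<And>n::nat. v n \<in> X) \<Longrightarrow> (\<And>n. B (v n) (v n) \<le> 1) \<Longrightarrow>
      \<exists>y\<in>X. \<exists>r. strict_mono r \<and>
        (\<lambda>n. B (\<lambda>q. K (v (r n)) q - y q) (\<lambda>q. K (v (r n)) q - y q)) \<longlonglongrightarrow> 0"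
    and w: "w \<in> X" "0 < B w w" "\<kappa> * B w w \<le> B (K w) w" "0 < \<kappa>"
  shows "\<exists>y\<in>X. \<exists>\<rho>\<ge>\<kappa>. 0 < B y y \<and> (\<forall>z\<in>X. B (K y) z = \<rho> * B y z)"
proof -
  have scale: "(\<lambda>q. a * v q) \<in> X" if "v \<in> X" for v a
    using X[OF that that, of a 0] by simp
  have B_scale: "B (\<lambda>q. a * u q) z = a * B u z" if "u \<in> X" "z \<in> X" for a u z
    using B_lin[OF that(1) that(1) that(2), of a 0] by simp
  have B_lin2: "B z (\<lambda>q. a * u q + b * v q) = a * B z u + b * B z v"
    if "u \<in> X" "v \<in> X" "z \<in> X" for a b u v z
    using that B_lin[of u v z a b] by (simp add: X B_sym)
  have B_scale2: "B z (\<lambda>q. a * u q) = a * B z u" if "u \<in> X" "z \<in> X" for a u z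
    using B_lin2[OF that(1) that(1) that(2), of a 0] by simp
  have K_scale: "K (\<lambda>q. a * u q) = (\<lambda>q. a * K u q)" if "u \<in> X" for a u
    using K_lin[OF that that, of a 0] by simp
  have cs: "(B u v)\<^sup>2 \<le> B u u * B v v" if "u \<in> X" "v \<in> X" for u v
  proof (rule discriminant_le_if_quadratic_nonneg)
    fix s
    have "0 \<le> B (\<lambda>q. 1 * u q + s * v q) (\<lambda>q. 1 * u q + s * v q)"
      by (intro B_pos X that)
    also have "\<dots> = B u u + 2 * s * B u v + s\<^sup>2 * B v v"
      unfolding B_lin[OF that X[OF that]] B_lin2[OF that that(1)] B_lin2[OF that that(2)]
      using B_sym[OF that] by (simp add: algebra_simps power2_eq_square)
    finally show "0 \<le> B u u + 2 * s * B u v + s\<^sup>2 * B v v" .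
  qed
  define A where "A = {B (K v) v |v. v \<in> X \<and> B v v \<le> 1}"
  have bdd: "bdd_above A"
  proof (rule bdd_aboveI[of _ "\<bar>C\<bar>"])
    fix a assume "a \<in> A"
    then obtain v where v: "v \<in> X" "B v v \<le> 1" "a = B (K v) v" by (auto simp: A_def)
    have "a \<le> C * B v v" using K_bound v by simp
    also have "\<dots> \<le> \<bar>C\<bar> * 1" using B_pos[OF v(1)] v(2) by (intro mult_mono) auto
    finally show "a \<le> \<bar>C\<bar>" by simp
  qed
  define \<rho> where "\<rho> = Sup A"
  have normalize: "B (K v) v \<le> \<rho> * B v v" if v: "v \<in> X" for v
  proof (cases "B v v = 0")
    case True
    then show ?thesis using K_bound[OF v] by simp
  next
    case False
    then have pos: "0 < B v v" using B_pos[OF v] by simp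
    define a where "a = 1 / sqrt (B v v)"
    have a2: "a * a * B v v = 1" using pos by (simp add: a_def field_simps)
    have "B (\<lambda>q. a * v q) (\<lambda>q. a * v q) \<le> 1"
      using a2 by (simp add: B_scale B_scale2 v scale mult.assoc)
    then have "B (K (\<lambda>q. a * v q)) (\<lambda>q. a * v q) \<in> A"
      using scale[OF v] by (auto simp: A_def)
    then have "B (K (\<lambda>q. a * v q)) (\<lambda>q. a * v q) \<le> \<rho>"
      unfolding \<rho>_def by (rule cSup_upper[OF _ bdd])
    then have "a * a * B (K v) v \<le> \<rho>"
      by (simp add: K_scale B_scale B_scale2 v scale KX mult.assoc)
    then have "a * a * B (K v) v * B v v \<le> \<rho> * B v v"
      using pos by (intro mult_right_mono) auto
    moreover have "a * a * B (K v) v * B v v = B (K v) v * (a * a * B v v)"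
      by (simp only: mult.assoc mult.commute mult.left_commute)
    ultimately show ?thesis using a2 by simp
  qed
  have "\<kappa> \<le> \<rho>" using normalize[OF w(1)] w(2,3) mult_right_le_imp_le[of \<kappa> "B w w" \<rho>] by linarith
  then have \<rho>_pos: "0 < \<rho>" using w(4) by simp
  have "A \<noteq> {}" using scale[OF w(1), of 0] B_scale[OF w(1) scale[OF w(1)], of 0 0] by (force simp: A_def)
  have "\<exists>v. v \<in> X \<and> B v v \<le> 1 \<and> \<rho> - 1 / real (Suc n) < B (K v) v" for n
  proof -
    have "\<rho> - 1 / real (Suc n) < Sup A" by (simp add: \<rho>_def)
    then show ?thesis using less_cSup_iff[OF \<open>A \<noteq> {}\<close> bdd] by (auto simp: A_def)
  qed
  then obtain v where v: "\<And>n. v n \<in> X" "\<And>n. B (v n) (v n) \<le> 1"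
      "\<And>n. \<rho> - 1 / real (Suc n) < B (K (v n)) (v n)" by metis
  obtain y r where y: "y \<in> X" and r: "strict_mono r"
    and lim: "(\<lambda>n. B (\<lambda>q. K (v (r n)) q - y q) (\<lambda>q. K (v (r n)) q - y q)) \<longlonglongrightarrow> 0"
    using K_compact[of v, OF v(1,2)] by auto
  define u where "u n = v (r n)" for n
  have u: "u n \<in> X" "B (u n) (u n) \<le> 1" "\<rho> - 1 / real (Suc n) < B (K (u n)) (u n)" for n
  proof -
    have "1 / real (Suc (r n)) \<le> 1 / real (Suc n)"
      using seq_suble[OF r, of n] by (intro divide_left_mono) auto
    then show "\<rho> - 1 / real (Suc n) < B (K (u n)) (u n)" using v(3)[of "r n"] by (simp add: u_def)
  qed (auto simp: u_def v)
  have inv0: "(\<lambda>n. 1 / real (Suc n)) \<longlonglongrightarrow> 0"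
    using LIMSEQ_inverse_real_of_nat by (simp add: inverse_eq_divide)
  have sqrt0: "f \<longlonglongrightarrow> 0" if "\<And>n. (f n)\<^sup>2 \<le> g n" "g \<longlonglongrightarrow> 0" for f g :: "nat \<Rightarrow> real"
  proof -
    have "(\<lambda>n. (f n)\<^sup>2) \<longlonglongrightarrow> 0"
      by (rule tendsto_sandwich[OF _ _ tendsto_const that(2)]) (use that(1) in auto)
    then have "(\<lambda>n. sqrt ((f n)\<^sup>2)) \<longlonglongrightarrow> sqrt 0" by (rule tendsto_real_sqrt)
    then show ?thesis by (simp add: tendsto_rabs_zero_iff)
  qed
  have weak: "(\<lambda>n. B (K (u n)) z) \<longlonglongrightarrow> B y z" if z: "z \<in> X" for z
  proof -
    define h where "h n = (\<lambda>q. K (u n) q - y q)" for n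
    have h_alt: "h n = (\<lambda>q. 1 * K (u n) q + (-1) * y q)" for n by (simp add: h_def)
    have hX: "h n \<in> X" for n unfolding h_alt by (intro X KX u y)
    have "(\<lambda>n. B (h n) z) \<longlonglongrightarrow> 0"
    proof (rule sqrt0)
      show "(B (h n) z)\<^sup>2 \<le> B (h n) (h n) * B z z" for n by (rule cs[OF hX z])
      show "(\<lambda>n. B (h n) (h n) * B z z) \<longlonglongrightarrow> 0"
        using tendsto_mult_right[OF lim, of "B z z"] by (simp add: h_def u_def)
    qed
    moreover have "B (h n) z = B (K (u n)) z - B y z" for n
      unfolding h_alt using B_lin[OF KX[OF u(1)] y z, of 1 n "-1"] by simp
    ultimately show ?thesis by (simp add: LIM_zero_iff)
  qed
  have eigen: "B (K y) z = \<rho> * B y z" if z: "z \<in> X" for z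
  proof -
    define Q where "Q a b = \<rho> * B a b - B (K a) b" for a b
    have Q_cs: "(Q a b)\<^sup>2 \<le> Q a a * Q b b" if "a \<in> X" "b \<in> X" for a b
    proof (rule discriminant_le_if_quadratic_nonneg)
      fix s
      have sy: "B (K b) a = B (K a) b" using K_sym[OF that] B_sym[OF that(1) KX[OF that(2)]] by simp
      let ?c = "\<lambda>q. 1 * a q + s * b q"
      have "0 \<le> \<rho> * B ?c ?c - B (K ?c) ?c" using normalize[OF X[OF that], of 1 s] by simp
      also have "\<dots> = Q a a + 2 * s * Q a b + s\<^sup>2 * Q b b"
        unfolding K_lin[OF that] B_lin[OF that X[OF that]] B_lin[OF KX[OF that(1)] KX[OF that(2)] X[OF that]]
          B_lin2[OF that that(1)] B_lin2[OF that that(2)] B_lin2[OF that KX[OF that(1)]]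
          B_lin2[OF that KX[OF that(2)]] Q_def
        using B_sym[OF that] sy by (simp add: algebra_simps power2_eq_square)
      finally show "0 \<le> Q a a + 2 * s * Q a b + s\<^sup>2 * Q b b" .
    qed
    have Q_nonneg: "0 \<le> Q a a" if "a \<in> X" for a using normalize[OF that] by (simp add: Q_def)
    have "(\<lambda>n. Q (u n) (K z)) \<longlonglongrightarrow> 0"
    proof (rule sqrt0)
      fix n
      have "\<rho> * B (u n) (u n) \<le> \<rho> * 1" using u(2) \<rho>_pos by (intro mult_left_mono) auto
      then have "Q (u n) (u n) \<le> 1 / real (Suc n)"
        using u(3)[of n] by (simp add: Q_def)
      then have "Q (u n) (u n) * Q (K z) (K z) \<le> 1 / real (Suc n) * Q (K z) (K z)"
        by (intro mult_right_mono Q_nonneg KX z)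
      then show "(Q (u n) (K z))\<^sup>2 \<le> 1 / real (Suc n) * Q (K z) (K z)"
        using Q_cs[OF u(1) KX[OF z], of n] by linarith
      show "(\<lambda>n. 1 / real (Suc n) * Q (K z) (K z)) \<longlonglongrightarrow> 0"
        using tendsto_mult_right[OF inv0, of "Q (K z) (K z)"] by simp
    qed
    moreover have "Q (u n) (K z) = \<rho> * B (K (u n)) z - B (K (u n)) (K z)" for n
      using K_sym[OF u(1) z] by (simp add: Q_def)
    moreover have "(\<lambda>n. \<rho> * B (K (u n)) z - B (K (u n)) (K z)) \<longlonglongrightarrow> \<rho> * B y z - B y (K z)"
      by (intro tendsto_intros weak z KX)
    ultimately have "\<rho> * B y z - B y (K z) = 0" using LIMSEQ_unique by fastforce
    then show ?thesis using K_sym[OF y z] by simp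
  qed
  have "0 < B y y"
  proof (rule ccontr)
    assume "\<not> 0 < B y y"
    then have y0: "B y y = 0" using B_pos[OF y] by simp
    have "(\<lambda>n. B (K (u n)) (K (u n))) \<longlonglongrightarrow> 0"
    proof -
      have "B (\<lambda>q. K (u n) q - y q) (\<lambda>q. K (u n) q - y q)
          = B (K (u n)) (K (u n)) - 2 * B (K (u n)) y + B y y" for n
      proof -
        have alt: "(\<lambda>q. K (u n) q - y q) = (\<lambda>q. 1 * K (u n) q + (-1) * y q)" by simp
        note k = KX[OF u(1)[of n]]
        show ?thesis unfolding alt B_lin[OF k y X[OF k y]] B_lin2[OF k y k] B_lin2[OF k y y]
          using B_sym[OF k y] by simp
      qed
      then have "B (K (u n)) (K (u n))
          = B (\<lambda>q. K (u n) q - y q) (\<lambda>q. K (u n) q - y q) + 2 * B (K (u n)) y" for n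
        using y0 by simp
      then show ?thesis
        using tendsto_add[OF lim tendsto_mult_left[OF weak[OF y], of 2]] y0 by (simp add: u_def)
    qed
    then have "(\<lambda>n. B (K (u n)) (u n)) \<longlonglongrightarrow> 0"
    proof (rule sqrt0[rotated])
      fix n
      have "(B (K (u n)) (u n))\<^sup>2 \<le> B (K (u n)) (K (u n)) * B (u n) (u n)"
        by (rule cs[OF KX[OF u(1)] u(1)])
      also have "\<dots> \<le> B (K (u n)) (K (u n)) * 1"
        by (intro mult_left_mono u B_pos KX)
      finally show "(B (K (u n)) (u n))\<^sup>2 \<le> B (K (u n)) (K (u n))" by simp
    qed
    moreover have "(\<lambda>n. \<rho> - 1 / real (Suc n)) \<longlonglongrightarrow> \<rho>"
      using tendsto_diff[OF tendsto_const[of \<rho>] inv0] by simp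
    ultimately have "\<rho> \<le> 0"
      using u(3) less_imp_le by (intro LIMSEQ_le) blast+
    then show False using \<rho>_pos by simp
  qed
  then show ?thesis using y eigen \<open>\<kappa> \<le> \<rho>\<close> by blast
qed

section \<open>Absolutely continuous functions on an interval\<close>

abbreviation sq_integral :: "real set \<Rightarrow> (real \<Rightarrow> complex) \<Rightarrow> real" where
  "sq_integral A f \<equiv> (LINT x:A|lebesgue. (norm (f x))\<^sup>2)"

text \<open>Fubini's theorem for a bounded kernel, the source of both integration by parts on an interval
  and Green's identity on the comb.\<close>

lemma kernel_integral_swap:
  fixes k :: "'a \<Rightarrow> 'a \<Rightarrow> real" and f g :: "'a \<Rightarrow> 'b::{real_normed_field, banach, second_countable_topology}"
  assumes M: "sigma_finite_measure M" and k[measurable]: "case_prod k \<in> borel_measurable (M \<Otimes>\<^sub>M M)"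
    and bound: "\<And>x y. \<bar>k x y\<bar> \<le> 1" and f: "integrable M f" and g: "integrable M g"
  shows "integrable M (\<lambda>x. g x * (LINT y|M. k x y *\<^sub>R f y))"
    and "(LINT x|M. g x * (LINT y|M. k x y *\<^sub>R f y)) = (LINT y|M. f y * (LINT x|M. k x y *\<^sub>R g x))"
proof -
  interpret P: pair_sigma_finite M M
    using M by (simp add: pair_sigma_finite_def)
  have [measurable]: "f \<in> borel_measurable M" "g \<in> borel_measurable M"
    using f g by auto
  have gf: "integrable (M \<Otimes>\<^sub>M M) (\<lambda>(x, y). g x * f y)"
    by (rule P.Fubini_integrable) (use f g in \<open>auto simp: norm_mult\<close>)
  have int: "integrable (M \<Otimes>\<^sub>M M) (\<lambda>(x, y). k x y *\<^sub>R (g x * f y))"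
    by (rule Bochner_Integration.integrable_bound[OF gf])
       (use bound in \<open>auto simp: norm_mult intro!: AE_I2 mult_left_le_one_le\<close>)
  have "(LINT y|M. k x y *\<^sub>R (g x * f y)) = g x * (LINT y|M. k x y *\<^sub>R f y)" for x
    by (simp flip: mult_scaleR_right)
  moreover have "(LINT x|M. k x y *\<^sub>R (g x * f y)) = f y * (LINT x|M. k x y *\<^sub>R g x)" for y
    by (simp add: mult.commute[of _ "f y"] flip: mult_scaleR_right)
  ultimately show "integrable M (\<lambda>x. g x * (LINT y|M. k x y *\<^sub>R f y))"
      "(LINT x|M. g x * (LINT y|M. k x y *\<^sub>R f y)) = (LINT y|M. f y * (LINT x|M. k x y *\<^sub>R g x))"
    using P.integrable_fst'[OF int] P.Fubini_integral[OF int] by simp_all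
qed

lemma lebesgue_on_eq_set_integral:
  fixes f :: "'a::euclidean_space \<Rightarrow> 'b::{banach, second_countable_topology}"
  assumes "A \<in> sets lebesgue"
  shows "(LINT x|lebesgue_on A. f x) = (LINT x:A|lebesgue. f x)"
    and "integrable (lebesgue_on A) f \<longleftrightarrow> set_integrable lebesgue A f"
  using assms by (simp_all add: integral_restrict_space integrable_restrict_space
      set_lebesgue_integral_def set_integrable_def)

lemma lebesgue_unit_affine:
  fixes c t :: real
  assumes "\<bar>c\<bar> = 1"
  shows "lebesgue = distr lebesgue lebesgue (\<lambda>x. t + c * x)"
proof -
  have "c \<noteq> 0" using assms by auto
  then have "lebesgue = density (distr lebesgue lebesgue (\<lambda>x. t + c * x)) (\<lambda>x. ennreal \<bar>c\<bar>)"
    using lebesgue_affine_euclidean[of "\<lambda>_. c" t] by simp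
  then show ?thesis using assms by (simp add: density_1)
qed

lemma measurable_lebesgue_affine:
  fixes c t :: real
  shows "c \<noteq> 0 \<Longrightarrow> (\<lambda>x. t + c * x) \<in> lebesgue \<rightarrow>\<^sub>M lebesgue"
  using lebesgue_affine_measurable[of "\<lambda>_. c" t] by simp

lemma set_integral_unit_affine:
  fixes g :: "real \<Rightarrow> 'b::{banach, second_countable_topology}"
  assumes c: "\<bar>c\<bar> = 1" and g: "set_integrable lebesgue A g"
    and A': "\<And>x. x \<in> A' \<longleftrightarrow> t + c * x \<in> A"
  shows "set_integrable lebesgue A' (\<lambda>x. g (t + c * x))"
    and "(LINT x:A'|lebesgue. g (t + c * x)) = (LINT x:A|lebesgue. g x)"
proof -
  let ?h = "\<lambda>x. indicator A x *\<^sub>R g x"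
  have ind: "indicator A' x = (indicator A (t + c * x) :: real)" for x
    using A' by (simp add: indicator_def)
  have c0: "c \<noteq> 0" using c by auto
  have h: "?h \<in> borel_measurable lebesgue" "integrable lebesgue ?h"
    using g by (auto simp: set_integrable_def)
  show "set_integrable lebesgue A' (\<lambda>x. g (t + c * x))"
    unfolding set_integrable_def ind
    using integrable_distr_eq[OF measurable_lebesgue_affine[OF c0] h(1), of t]
      lebesgue_unit_affine[OF c, of t] h(2) by simp
  show "(LINT x:A'|lebesgue. g (t + c * x)) = (LINT x:A|lebesgue. g x)"
    unfolding set_lebesgue_integral_def ind
    using integral_distr[OF measurable_lebesgue_affine[OF c0] h(1), of t]
      lebesgue_unit_affine[OF c, of t] by simp
qed

lemma set_integral_Icc_shift:
  fixes g :: "real \<Rightarrow> 'b::{banach, second_countable_topology}"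
  assumes "set_integrable lebesgue {t + a..t + b} g"
  shows "set_integrable lebesgue {a..b} (\<lambda>x. g (t + x))"
    and "(LINT x:{a..b}|lebesgue. g (t + x)) = (LINT x:{t + a..t + b}|lebesgue. g x)"
  using set_integral_unit_affine[of 1 _ g "{a..b}" t, OF _ assms] by auto

lemma set_integral_Icc_reflect:
  fixes g :: "real \<Rightarrow> 'b::{banach, second_countable_topology}"
  assumes "set_integrable lebesgue {a..b} g"
  shows "set_integrable lebesgue {-b..-a} (\<lambda>x. g (- x))"
    and "(LINT x:{-b..-a}|lebesgue. g (- x)) = (LINT x:{a..b}|lebesgue. g x)"
proof -
  have "x \<in> {-b..-a} \<longleftrightarrow> 0 + (-1) * x \<in> {a..b}" for x by auto
  from set_integral_unit_affine[OF _ assms this]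
  show "set_integrable lebesgue {-b..-a} (\<lambda>x. g (- x))"
    and "(LINT x:{-b..-a}|lebesgue. g (- x)) = (LINT x:{a..b}|lebesgue. g x)" by simp_all
qed

lemma set_integral_Icc_combine:
  fixes g :: "real \<Rightarrow> 'b::{banach, second_countable_topology}"
  assumes "a \<le> b" "b \<le> c" "set_integrable lebesgue {a..c} g"
  shows "(LINT x:{a..c}|lebesgue. g x) = (LINT x:{a..b}|lebesgue. g x) + (LINT x:{b..c}|lebesgue. g x)"
proof -
  have "{a..c} = {a..b} \<union> {b..c}" using assms by auto
  moreover have "AE x in lebesgue. \<not> (x \<in> {a..b} \<and> x \<in> {b..c})"
    by (rule AE_I'[of "{b}"]) (auto simp: negligible_sing simp flip: negligible_iff_null_sets)
  moreover have "set_integrable lebesgue {a..b} g" "set_integrable lebesgue {b..c} g"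
    using assms by (auto intro: set_integrable_subset)
  ultimately show ?thesis by (auto intro!: set_integral_Un_AE)
qed

text \<open>Being a primitive of an integrable function expresses absolute continuity.\<close>

definition primitive_on :: "real \<Rightarrow> real \<Rightarrow> (real \<Rightarrow> complex) \<Rightarrow> (real \<Rightarrow> complex) \<Rightarrow> bool" where
  "primitive_on a b f g \<longleftrightarrow> set_integrable lebesgue {a..b} g \<and>
    (\<forall>x\<in>{a..b}. f x = f a + (LINT y:{a..x}|lebesgue. g y))"

lemma primitive_on_integrable: "primitive_on a b f g \<Longrightarrow> set_integrable lebesgue {a..b} g"
  by (simp add: primitive_on_def)

lemma primitive_on_eq:
  "primitive_on a b f g \<Longrightarrow> x \<in> {a..b} \<Longrightarrow> f x = f a + (LINT y:{a..x}|lebesgue. g y)"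
  unfolding primitive_on_def by blast

lemma primitive_onD:
  assumes "primitive_on a b f g" "a \<le> c" "c \<le> d" "d \<le> b"
  shows "f d = f c + (LINT y:{c..d}|lebesgue. g y)"
proof -
  have "set_integrable lebesgue {a..d} g"
    by (rule set_integrable_subset[of _ "{a..b}"]) (use assms in \<open>auto dest: primitive_on_integrable\<close>)
  then have "(LINT y:{a..d}|lebesgue. g y) = (LINT y:{a..c}|lebesgue. g y) + (LINT y:{c..d}|lebesgue. g y)"
    by (rule set_integral_Icc_combine[rotated 2]) (use assms in auto)
  moreover have "f d = f a + (LINT y:{a..d}|lebesgue. g y)" "f c = f a + (LINT y:{a..c}|lebesgue. g y)"
    using primitive_on_eq[OF assms(1), of d] primitive_on_eq[OF assms(1), of c] assms by simp_all
  ultimately show ?thesis by simp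
qed

lemma primitive_on_subinterval:
  assumes "primitive_on a b f g" "a \<le> c" "d \<le> b"
  shows "primitive_on c d f g"
  unfolding primitive_on_def
proof
  show "set_integrable lebesgue {c..d} g"
    by (rule set_integrable_subset[of _ "{a..b}"]) (use assms in \<open>auto dest: primitive_on_integrable\<close>)
  show "\<forall>x\<in>{c..d}. f x = f c + (LINT y:{c..x}|lebesgue. g y)"
    using assms(3) by (auto intro: primitive_onD[OF assms(1,2)])
qed

lemma primitive_on_continuous:
  assumes "primitive_on a b f g"
  shows "continuous_on {a..b} f"
proof -
  have g: "set_integrable lebesgue {a..b} g" using assms(1) by (rule primitive_on_integrable)
  have eq: "f a + integral {a..x} g = f x" if "x \<in> {a..b}" for x
  proof -
    have "set_integrable lebesgue {a..x} g"
      by (rule set_integrable_subset[OF g]) (use that in auto)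
    then show ?thesis
      using primitive_on_eq[OF assms that] by (simp add: set_lebesgue_integral_eq_integral)
  qed
  have "continuous_on {a..b} (\<lambda>x. f a + integral {a..x} g)"
    by (intro continuous_intros indefinite_integral_continuous_1 set_lebesgue_integral_eq_integral(1)[OF g])
  then show ?thesis by (rule continuous_on_eq[OF _ eq])
qed

lemma primitive_on_measurable:
  "primitive_on a b f g \<Longrightarrow> f \<in> borel_measurable (lebesgue_on {a..b})"
  by (intro continuous_imp_measurable_on_sets_lebesgue primitive_on_continuous) auto

lemma primitive_on_bounded:
  assumes "primitive_on a b f g"
  obtains C where "0 \<le> C" "\<And>x. x \<in> {a..b} \<Longrightarrow> norm (f x) \<le> C"
proof -
  have "bounded (f ` {a..b})"
    by (intro compact_imp_bounded compact_continuous_image primitive_on_continuous[OF assms] compact_Icc)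
  then obtain C where "\<forall>x\<in>{a..b}. norm (f x) \<le> C" by (auto simp: bounded_iff)
  then show ?thesis using that[of "max C 0"] by fastforce
qed

lemma set_integrable_primitive_mult:
  assumes f: "primitive_on a b f g" and h: "set_integrable lebesgue {a..b} h"
  shows "set_integrable lebesgue {a..b} (\<lambda>x. h x * f x)"
proof -
  obtain C where C: "\<And>x. x \<in> {a..b} \<Longrightarrow> norm (f x) \<le> C"
    using primitive_on_bounded[OF f] by auto
  have [measurable]: "f \<in> borel_measurable (lebesgue_on {a..b})"
    by (rule primitive_on_measurable[OF f])
  have h': "integrable (lebesgue_on {a..b}) h"
    using h by (simp add: lebesgue_on_eq_set_integral)
  have "integrable (lebesgue_on {a..b}) (\<lambda>x. h x * f x)"
  proof (rule Bochner_Integration.integrable_bound[OF integrable_mult_left[OF h', of "of_real C"]])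
    show "AE x in lebesgue_on {a..b}. norm (h x * f x) \<le> norm (h x * complex_of_real C)"
      using C by (intro AE_I2) (force simp: norm_mult intro!: mult_left_mono)
    show "(\<lambda>x. h x * f x) \<in> borel_measurable (lebesgue_on {a..b})"
      using h' by measurable
  qed
  then show ?thesis by (simp add: lebesgue_on_eq_set_integral)
qed

text \<open>Integration by parts: for primitives, the product rule is Fubini's theorem on the two
  triangles below and above the diagonal of a square.\<close>

lemma primitive_on_mult:
  assumes f: "primitive_on a b f f'" and g: "primitive_on a b g g'"
  shows "primitive_on a b (\<lambda>x. f x * g x) (\<lambda>x. f' x * g x + g' x * f x)"
  unfolding primitive_on_def
proof (intro conjI ballI)
  show "set_integrable lebesgue {a..b} (\<lambda>x. f' x * g x + g' x * f x)"
    using f g by (intro set_integral_add set_integrable_primitive_mult) (auto dest: primitive_on_integrable)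
  fix x assume x: "x \<in> {a..b}"
  have f: "primitive_on a x f f'" and g: "primitive_on a x g g'"
    using f g x by (auto intro: primitive_on_subinterval)
  define M where "M = lebesgue_on {a..x}"
  have int: "integrable M f'" "integrable M g'"
    using f g by (auto dest: primitive_on_integrable simp: M_def lebesgue_on_eq_set_integral)
  have M_fin: "finite_measure M"
    unfolding M_def by (rule finite_measure_lebesgue_on) auto
  then interpret finite_measure M .
  have [measurable]: "(\<lambda>x. x) \<in> borel_measurable M" 
    unfolding M_def using id_borel_measurable_lebesgue_on[of "{a..x}"] by (simp add: id_def)
  let ?k = "\<lambda>s t. if s \<le> t then 1 else 0 :: real"
  have f_eq: "f y = f a + (LINT s|M. ?k s y *\<^sub>R f' s)" and g_eq: "g y = g x - (LINT t|M. ?k y t *\<^sub>R g' t)"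
    if "y \<in> {a..x}" for y
  proof -
    have "(LINT s|M. ?k s y *\<^sub>R f' s) = (LINT s:{a..y}|lebesgue. f' s)"
      unfolding M_def using that
      by (simp add: lebesgue_on_eq_set_integral set_lebesgue_integral_def)
         (intro Bochner_Integration.integral_cong refl, auto simp: indicator_def)
    then show "f y = f a + (LINT s|M. ?k s y *\<^sub>R f' s)"
      using primitive_on_eq[OF f that] by simp
    have "(LINT t|M. ?k y t *\<^sub>R g' t) = (LINT t:{y..x}|lebesgue. g' t)"
      unfolding M_def using that
      by (simp add: lebesgue_on_eq_set_integral set_lebesgue_integral_def)
         (intro Bochner_Integration.integral_cong refl, auto simp: indicator_def)
    then show "g y = g x - (LINT t|M. ?k y t *\<^sub>R g' t)"
      using primitive_onD[OF g, of y x] that by simp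
  qed
  have swap: "(LINT s|M. f' s * (LINT t|M. ?k s t *\<^sub>R g' t)) = (LINT t|M. g' t * (LINT s|M. ?k s t *\<^sub>R f' s))"
    and int_l: "integrable M (\<lambda>s. f' s * (LINT t|M. ?k s t *\<^sub>R g' t))"
    by (rule kernel_integral_swap[OF sigma_finite_measure_axioms _ _ int(2) int(1)]; simp)+
  have int_r: "integrable M (\<lambda>t. g' t * (LINT s|M. ?k s t *\<^sub>R f' s))"
    using kernel_integral_swap(1)[OF sigma_finite_measure_axioms _ _ int, of "\<lambda>t s. ?k s t"] by simp
  have l: "(LINT s|M. f' s * g s) = (LINT s|M. f' s) * g x - (LINT s|M. f' s * (LINT t|M. ?k s t *\<^sub>R g' t))"
  proof -
    have "(LINT s|M. f' s * g s) = (LINT s|M. f' s * g x - f' s * (LINT t|M. ?k s t *\<^sub>R g' t))"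
    proof (rule Bochner_Integration.integral_cong)
      fix s assume "s \<in> space M"
      then have s: "s \<in> {a..x}" by (simp add: M_def)
      show "f' s * g s = f' s * g x - f' s * (LINT t|M. ?k s t *\<^sub>R g' t)"
        by (subst g_eq[OF s]) (simp only: right_diff_distrib)
    qed simp
    then show ?thesis using int int_l by simp
  qed
  have r: "(LINT t|M. g' t * f t) = (LINT t|M. g' t) * f a + (LINT t|M. g' t * (LINT s|M. ?k s t *\<^sub>R f' s))"
  proof -
    have "(LINT t|M. g' t * f t) = (LINT t|M. g' t * f a + g' t * (LINT s|M. ?k s t *\<^sub>R f' s))"
    proof (rule Bochner_Integration.integral_cong)
      fix t assume "t \<in> space M"
      then have t: "t \<in> {a..x}" by (simp add: M_def)
      show "g' t * f t = g' t * f a + g' t * (LINT s|M. ?k s t *\<^sub>R f' s)"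
        by (subst f_eq[OF t]) (simp only: distrib_left)
    qed simp
    then show ?thesis using int int_r by simp
  qed
  have fx: "f x = f a + (LINT s|M. f' s)" and gx: "g x = g a + (LINT s|M. g' s)"
    using primitive_on_eq[OF f, of x] primitive_on_eq[OF g, of x] x
    by (auto simp: M_def lebesgue_on_eq_set_integral)
  have "(LINT y:{a..x}|lebesgue. f' y * g y + g' y * f y) = (LINT y|M. f' y * g y) + (LINT y|M. g' y * f y)"
  proof -
    have "set_integrable lebesgue {a..x} (\<lambda>y. f' y * g y)" "set_integrable lebesgue {a..x} (\<lambda>y. g' y * f y)"
      using f g by (auto intro!: set_integrable_primitive_mult dest: primitive_on_integrable)
    then show ?thesis by (simp add: M_def lebesgue_on_eq_set_integral)
  qed
  also have "\<dots> = (f x - f a) * g x + (g x - g a) * f a"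
    unfolding l r swap by (simp add: fx gx)
  finally show "f x * g x = f a * g a + (LINT y:{a..x}|lebesgue. f' y * g y + g' y * f y)"
    by (simp add: algebra_simps)
qed

lemma primitive_on_cnj:
  assumes "primitive_on a b f g"
  shows "primitive_on a b (\<lambda>x. cnj (f x)) (\<lambda>x. cnj (g x))"
proof -
  have ind: "indicator A x *\<^sub>R cnj z = cnj (indicator A x *\<^sub>R z)" for A and x :: real and z
    by simp
  have int: "(LINT y:{a..x}|lebesgue. cnj (g y)) = cnj (LINT y:{a..x}|lebesgue. g y)" for x
    unfolding set_lebesgue_integral_def ind by (rule Bochner_Integration.integral_cnj)
  have "set_integrable lebesgue {a..b} (\<lambda>x. cnj (g x))"
    using primitive_on_integrable[OF assms] unfolding set_integrable_def ind
    by (simp only: complex_integrable_cnj)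
  moreover have "cnj (f x) = cnj (f a) + cnj (LINT y:{a..x}|lebesgue. g y)" if "x \<in> {a..b}" for x
    by (subst primitive_on_eq[OF assms that]) (rule complex_cnj_add)
  ultimately show ?thesis unfolding primitive_on_def int by blast
qed

lemma primitive_on_reflect:
  assumes "primitive_on a b f g" "a \<le> b"
  shows "primitive_on (-b) (-a) (\<lambda>x. f (- x)) (\<lambda>x. - g (- x))"
  unfolding primitive_on_def
proof (intro conjI ballI)
  have g: "set_integrable lebesgue {a..b} g" using assms(1) by (rule primitive_on_integrable)
  show "set_integrable lebesgue {-b..-a} (\<lambda>x. - g (- x))"
    using set_integral_Icc_reflect(1)[OF g] by (simp add: set_integrable_def)
  fix x assume x: "x \<in> {-b..-a}"
  have "set_integrable lebesgue {-x..b} g"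
    by (rule set_integrable_subset[OF g]) (use x in auto)
  from set_integral_Icc_reflect[OF this]
  have "(LINT y:{-b..x}|lebesgue. - g (- y)) = - (LINT y:{-x..b}|lebesgue. g y)"
    by (simp add: set_integral_uminus)
  then show "f (- x) = f (- (- b)) + (LINT y:{-b..x}|lebesgue. - g (- y))"
    using primitive_onD[OF assms(1), of "-x" b] x by simp
qed

lemma primitive_on_of_real:
  fixes w :: "real \<Rightarrow> real"
  assumes "a \<le> b" "continuous_on {a..b} w'"
    and "\<And>x. x \<in> {a..b} \<Longrightarrow> (w has_real_derivative w' x) (at x within {a..b})"
  shows "primitive_on a b (\<lambda>x. complex_of_real (w x)) (\<lambda>x. complex_of_real (w' x))"
  unfolding primitive_on_def
proof (intro conjI ballI)
  have cont: "continuous_on {a..b} (\<lambda>x. complex_of_real (w' x))"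
    using assms(2) by (intro continuous_intros)
  then show int: "set_integrable lebesgue {a..b} (\<lambda>x. complex_of_real (w' x))"
    by (rule absolutely_integrable_continuous_real)
  fix x assume x: "x \<in> {a..b}"
  have intx: "set_integrable lebesgue {a..x} (\<lambda>x. complex_of_real (w' x))"
    by (rule set_integrable_subset[OF int]) (use x in auto)
  have "((\<lambda>y. complex_of_real (w' y)) has_integral complex_of_real (w x) - complex_of_real (w a)) {a..x}"
  proof (rule fundamental_theorem_of_calculus)
    fix y assume "y \<in> {a..x}"
    then have "(w has_real_derivative w' y) (at y within {a..x})"
      using assms(3)[of y] x by (auto intro: DERIV_subset)
    then show "((\<lambda>x. complex_of_real (w x)) has_vector_derivative complex_of_real (w' y)) (at y within {a..x})"
      by (intro has_vector_derivative_of_real) (simp add: has_real_derivative_iff_has_vector_derivative)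
  qed (use x in auto)
  then have "(LINT y:{a..x}|lebesgue. complex_of_real (w' y)) = complex_of_real (w x) - complex_of_real (w a)"
    using set_lebesgue_integral_eq_integral(2)[OF intx] by (simp add: integral_unique)
  then show "complex_of_real (w x) = complex_of_real (w a) + (LINT y:{a..x}|lebesgue. complex_of_real (w' y))"
    by simp
qed

section \<open>A sharp Poincare inequality on an interval with point masses\<close>

lemma tan_superadditive:
  fixes a b :: real
  assumes "0 \<le> a" "0 \<le> b" "a + b < pi / 2"
  shows "tan a + tan b \<le> tan (a + b)"
proof -
  have ca: "0 < cos a" "0 < cos b" "0 < cos (a + b)"
    using assms by (auto intro!: cos_gt_zero_pi)
  have "tan a + tan b = sin (a + b) / (cos a * cos b)"
    using ca by (simp add: tan_def sin_add field_simps)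
  also have "cos (a + b) \<le> cos a * cos b"
    using assms sin_ge_zero[of a] sin_ge_zero[of b] by (simp add: cos_add)
  then have "sin (a + b) / (cos a * cos b) \<le> sin (a + b) / cos (a + b)"
    using ca assms by (intro divide_left_mono sin_ge_zero) auto
  finally show ?thesis by (simp add: tan_def)
qed

lemma primitive_on_norm_sq_integrable:
  "primitive_on a b f g \<Longrightarrow> set_integrable lebesgue {a..b} (\<lambda>x. (norm (f x))\<^sup>2)"
  by (intro absolutely_integrable_continuous_real continuous_intros primitive_on_continuous)

text \<open>Picone's inequality: integrate \<open>0 \<le> |f' - w f|\<^sup>2\<close> and recognize the derivative of \<open>w |f|\<^sup>2\<close>. The
  Riccati equation for \<open>w\<close> leaves the constant coefficient \<open>\<omega>\<^sup>2\<close> in front of \<open>|f|\<^sup>2\<close>.\<close>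

lemma picone_inequality:
  fixes w :: "real \<Rightarrow> real"
  assumes ab: "a \<le> b" and f: "primitive_on a b f g"
    and g2: "set_integrable lebesgue {a..b} (\<lambda>x. (norm (g x))\<^sup>2)"
    and w: "\<And>x. x \<in> {a..b} \<Longrightarrow> (w has_real_derivative - (\<omega>\<^sup>2 + (w x)\<^sup>2)) (at x within {a..b})"
  shows "w b * (norm (f b))\<^sup>2 - w a * (norm (f a))\<^sup>2 + \<omega>\<^sup>2 * sq_integral {a..b} f
    \<le> sq_integral {a..b} g"
proof -
  define w' where "w' x = - (\<omega>\<^sup>2 + (w x)\<^sup>2)" for x
  have "continuous_on {a..b} w"
    using w by (intro DERIV_continuous_on) auto
  then have "continuous_on {a..b} w'" unfolding w'_def by (intro continuous_intros)
  then have W: "primitive_on a b (\<lambda>x. complex_of_real (w x)) (\<lambda>x. complex_of_real (w' x))"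
    using w by (intro primitive_on_of_real ab) (auto simp: w'_def)
  define d where "d x = w' x * (norm (f x))\<^sup>2 + 2 * w x * Re (g x * cnj (f x))" for x
  have prim: "primitive_on a b (\<lambda>x. complex_of_real (w x) * (f x * cnj (f x)))
      (\<lambda>x. complex_of_real (w' x) * (f x * cnj (f x))
        + (g x * cnj (f x) + cnj (g x) * f x) * complex_of_real (w x))"
    by (intro primitive_on_mult W f primitive_on_cnj)
  have "g x * cnj (f x) + cnj (g x) * f x = complex_of_real (2 * Re (g x * cnj (f x)))" for x
    using complex_add_cnj[of "g x * cnj (f x)"] by simp
  then have d: "complex_of_real (w' x) * (f x * cnj (f x))
        + (g x * cnj (f x) + cnj (g x) * f x) * complex_of_real (w x) = complex_of_real (d x)" for x
    using complex_norm_square[of "f x", symmetric]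
    by (simp only: d_def flip: of_real_mult of_real_add) (simp add: mult.commute mult.left_commute)
  note prim = prim[unfolded d]
  have d_int: "set_integrable lebesgue {a..b} d"
    using primitive_on_integrable[OF prim]
    by (simp add: set_integrable_def complex_of_real_integrable_eq flip: of_real_mult)
       (simp add: scaleR_conv_of_real complex_of_real_integrable_eq flip: of_real_mult)
  have "complex_of_real (w b) * (f b * cnj (f b))
      = complex_of_real (w a) * (f a * cnj (f a)) + (LINT x:{a..b}|lebesgue. complex_of_real (d x))"
    using primitive_onD[OF prim, of a b] ab by simp
  then have "complex_of_real (w b * (norm (f b))\<^sup>2)
      = complex_of_real (w a * (norm (f a))\<^sup>2 + (LINT x:{a..b}|lebesgue. d x))"
    by (simp only: complex_norm_square[symmetric] set_integral_complex_of_real of_real_mult of_real_add)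
  then have d_eq: "w b * (norm (f b))\<^sup>2 = w a * (norm (f a))\<^sup>2 + (LINT x:{a..b}|lebesgue. d x)"
    by (simp only: of_real_eq_iff)
  note f2 = primitive_on_norm_sq_integrable[OF f]
  have "(LINT x:{a..b}|lebesgue. d x)
      \<le> (LINT x:{a..b}|lebesgue. (norm (g x))\<^sup>2 - \<omega>\<^sup>2 * (norm (f x))\<^sup>2)"
  proof (rule set_integral_mono[OF d_int])
    show "set_integrable lebesgue {a..b} (\<lambda>x. (norm (g x))\<^sup>2 - \<omega>\<^sup>2 * (norm (f x))\<^sup>2)"
      using g2 f2 by (intro set_integral_diff) auto
    fix x
    have "0 \<le> (norm (g x - complex_of_real (w x) * f x))\<^sup>2" by simp
    also have "\<dots> = (norm (g x))\<^sup>2 + (w x)\<^sup>2 * (norm (f x))\<^sup>2 - 2 * w x * Re (g x * cnj (f x))"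
      unfolding cmod_power2 by (simp add: power2_eq_square algebra_simps)
    finally show "d x \<le> (norm (g x))\<^sup>2 - \<omega>\<^sup>2 * (norm (f x))\<^sup>2"
      by (simp add: d_def w'_def algebra_simps)
  qed
  also have "\<dots> = sq_integral {a..b} g - \<omega>\<^sup>2 * sq_integral {a..b} f"
    using g2 f2 by simp
  finally show ?thesis using d_eq by simp
qed

text \<open>The tangents solve the Riccati equation; \<open>m\<close> is the mass that has been collected to the left of
  \<open>a\<close>.\<close>

lemma poincare_segment:
  assumes ab: "a \<le> b" and f: "primitive_on a b f g"
    and g2: "set_integrable lebesgue {a..b} (\<lambda>x. (norm (g x))\<^sup>2)"
    and m: "0 < \<omega>" "0 \<le> m" "\<omega> * (m + (b - a)) < pi / 2"
  shows "\<omega> * tan (\<omega> * m) * (norm (f a))\<^sup>2 + \<omega>\<^sup>2 * sq_integral {a..b} f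
    \<le> sq_integral {a..b} g + \<omega> * tan (\<omega> * (m + (b - a))) * (norm (f b))\<^sup>2"
proof -
  define w where "w x = - \<omega> * tan (\<omega> * (m + (x - a)))" for x
  have "(w has_real_derivative - (\<omega>\<^sup>2 + (w x)\<^sup>2)) (at x within {a..b})" if x: "x \<in> {a..b}" for x
  proof -
    have "\<omega> * (m + (x - a)) \<le> \<omega> * (m + (b - a))"
      using x m by (intro mult_left_mono) auto
    then have "\<omega> * (m + (x - a)) < pi / 2" using m(3) by linarith
    moreover have "0 \<le> \<omega> * (m + (x - a))" using x m by simp
    ultimately
    have "0 < cos (\<omega> * (m + (x - a)))" by (intro cos_gt_zero_pi) auto
    then have c: "cos (\<omega> * (m + (x - a))) \<noteq> 0" by simp
    have "(w has_real_derivative - \<omega> * (inverse ((cos (\<omega> * (m + (x - a))))\<^sup>2) * \<omega>)) (at x within {a..b})"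
      unfolding w_def by (rule derivative_eq_intros DERIV_tan refl c | simp)+
    moreover have "- \<omega> * (inverse ((cos (\<omega> * (m + (x - a))))\<^sup>2) * \<omega>) = - (\<omega>\<^sup>2 + (w x)\<^sup>2)"
    proof -
      have sec: "inverse ((cos (\<omega> * (m + (x - a))))\<^sup>2) = 1 + (tan (\<omega> * (m + (x - a))))\<^sup>2"
        using tan_sec[OF c] by (simp add: power_inverse)
      show ?thesis unfolding sec w_def by (simp add: power2_eq_square algebra_simps)
    qed
    ultimately show ?thesis by simp
  qed
  from picone_inequality[OF ab f g2 this]
  show ?thesis by (simp add: w_def algebra_simps)
qed

text \<open>The weight \<open>\<omega> * tan (\<omega> * M)\<close> at \<open>b\<close>, where \<open>M\<close> is the total mass to the left of \<open>b\<close>, is the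
  Dirichlet-to-Neumann value of an interval of length \<open>M\<close>. Collecting the masses
  from left to right, superadditivity of the tangent is what makes a point mass at most as
  costly as an equal length of interval.\<close>

lemma poincare_segment_point_masses:
  assumes "finite T" "T \<subseteq> {a..b}" "a \<le> b" "primitive_on a b f g"
    and "set_integrable lebesgue {a..b} (\<lambda>x. (norm (g x))\<^sup>2)"
    and "0 < \<omega>" "\<And>s. s \<in> T \<Longrightarrow> 0 \<le> r s" "\<omega> * ((b - a) + (\<Sum>s\<in>T. r s)) < pi / 2"
  shows "(\<Sum>s\<in>T. \<omega> * tan (\<omega> * r s) * (norm (f s))\<^sup>2) + \<omega>\<^sup>2 * sq_integral {a..b} f
    \<le> sq_integral {a..b} g
      + \<omega> * tan (\<omega> * ((b - a) + (\<Sum>s\<in>T. r s))) * (norm (f b))\<^sup>2"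
  using assms
proof (induction T arbitrary: b rule: finite_linorder_max_induct)
  case empty
  then show ?case using poincare_segment[of a b f g \<omega> 0] by simp
next
  case (insert s T)
  have s: "a \<le> s" "s \<le> b" and notin: "s \<notin> T" using insert.prems insert.hyps by auto
  have int: "set_integrable lebesgue {c..d} (\<lambda>x. (norm (g x))\<^sup>2)"
      "set_integrable lebesgue {c..d} (\<lambda>x. (norm (f x))\<^sup>2)" if "a \<le> c" "d \<le> b" for c d
    using primitive_on_norm_sq_integrable[OF insert.prems(3)] insert.prems(4) that
    by (auto intro: set_integrable_subset)
  define m where "m = (s - a) + sum r T"
  have r0: "0 \<le> r s" "0 \<le> sum r T" using insert.prems by (auto intro: sum_nonneg)
  have total: "\<omega> * (m + r s + (b - s)) < pi / 2"
    using insert.prems(7) notin insert.hyps(1) by (simp add: m_def algebra_simps)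
  have le: "\<omega> * y \<le> \<omega> * z" if "y \<le> z" for y z
    using that insert.prems(5) by simp
  have "\<omega> * m < pi / 2" "\<omega> * (m + r s) < pi / 2"
    using total le[of m "m + r s + (b - s)"] le[of "m + r s" "m + r s + (b - s)"] r0 s by auto
  have "(\<Sum>s\<in>T. \<omega> * tan (\<omega> * r s) * (norm (f s))\<^sup>2) + \<omega>\<^sup>2 * sq_integral {a..s} f
    \<le> sq_integral {a..s} g + \<omega> * tan (\<omega> * m) * (norm (f s))\<^sup>2"
    unfolding m_def
  proof (rule insert.IH)
    show "T \<subseteq> {a..s}" using insert.prems(1) insert.hyps(2) by (auto simp: less_imp_le)
    show "primitive_on a s f g" using insert.prems(3) s by (auto intro: primitive_on_subinterval)
  qed (use s insert.prems \<open>\<omega> * m < pi / 2\<close> int in \<open>auto simp: m_def\<close>)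
  moreover have "\<omega> * tan (\<omega> * (m + r s)) * (norm (f s))\<^sup>2 + \<omega>\<^sup>2 * sq_integral {s..b} f
    \<le> sq_integral {s..b} g + \<omega> * tan (\<omega> * (m + r s + (b - s))) * (norm (f b))\<^sup>2"
    by (rule poincare_segment)
      (use s r0 total insert.prems int in \<open>auto simp: m_def intro: primitive_on_subinterval\<close>)
  moreover have "\<omega> * tan (\<omega> * m) * (norm (f s))\<^sup>2 + \<omega> * tan (\<omega> * r s) * (norm (f s))\<^sup>2
      \<le> \<omega> * tan (\<omega> * (m + r s)) * (norm (f s))\<^sup>2"
  proof -
    have "tan (\<omega> * m) + tan (\<omega> * r s) \<le> tan (\<omega> * m + \<omega> * r s)"
    proof (rule tan_superadditive)
      have "0 \<le> m" using r0 s by (simp add: m_def)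
      then show "0 \<le> \<omega> * m" using insert.prems(5) by simp
      show "0 \<le> \<omega> * r s" using r0 insert.prems(5) by simp
      show "\<omega> * m + \<omega> * r s < pi / 2"
        using \<open>\<omega> * (m + r s) < pi / 2\<close> by (simp add: distrib_left)
    qed
    then have "(\<omega> * (norm (f s))\<^sup>2) * (tan (\<omega> * m) + tan (\<omega> * r s))
        \<le> (\<omega> * (norm (f s))\<^sup>2) * tan (\<omega> * (m + r s))"
      using insert.prems(5) by (intro mult_left_mono) (auto simp: distrib_left)
    then show ?thesis by (simp add: algebra_simps)
  qed
  moreover have "sq_integral {a..b} f
      = sq_integral {a..s} f + sq_integral {s..b} f"
    "sq_integral {a..b} g
      = sq_integral {a..s} g + sq_integral {s..b} g"
    using s int by (auto intro: set_integral_Icc_combine)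
  ultimately show ?case
    using insert.hyps(1) notin by (simp add: m_def algebra_simps)
qed

lemma poincare_segment_point_masses_zero_right:
  assumes "finite T" "T \<subseteq> {a..b}" "a \<le> b" "primitive_on a b f g" "f b = 0"
    and "set_integrable lebesgue {a..b} (\<lambda>x. (norm (g x))\<^sup>2)"
    and "0 < \<omega>" "\<And>s. s \<in> T \<Longrightarrow> 0 \<le> r s" "\<omega> * ((b - a) + (\<Sum>s\<in>T. r s)) < pi / 2"
  shows "(\<Sum>s\<in>T. \<omega> * tan (\<omega> * r s) * (norm (f s))\<^sup>2) + \<omega>\<^sup>2 * sq_integral {a..b} f
    \<le> sq_integral {a..b} g"
  using poincare_segment_point_masses[of T a b f g \<omega> r] assms by simp

lemma poincare_segment_point_masses_zero_left:
  assumes "finite T" "T \<subseteq> {a..b}" "a \<le> b" "primitive_on a b f g" "f a = 0"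
    and g2: "set_integrable lebesgue {a..b} (\<lambda>x. (norm (g x))\<^sup>2)"
    and "0 < \<omega>" "\<And>s. s \<in> T \<Longrightarrow> 0 \<le> r s" "\<omega> * ((b - a) + (\<Sum>s\<in>T. r s)) < pi / 2"
  shows "(\<Sum>s\<in>T. \<omega> * tan (\<omega> * r s) * (norm (f s))\<^sup>2) + \<omega>\<^sup>2 * sq_integral {a..b} f
    \<le> sq_integral {a..b} g"
proof -
  have sums: "(\<Sum>s\<in>uminus ` T. h s) = (\<Sum>s\<in>T. h (- s))" for h :: "real \<Rightarrow> real"
    by (subst sum.reindex) auto
  note f2 = primitive_on_norm_sq_integrable[OF assms(4)]
  have "(\<Sum>s\<in>uminus ` T. \<omega> * tan (\<omega> * r (- s)) * (norm (f (- s)))\<^sup>2)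
      + \<omega>\<^sup>2 * (LINT x:{-b..-a}|lebesgue. (norm (f (- x)))\<^sup>2)
    \<le> (LINT x:{-b..-a}|lebesgue. (norm (- g (- x)))\<^sup>2)"
    by (rule poincare_segment_point_masses_zero_right)
      (use assms set_integral_Icc_reflect(1)[OF g2] in
        \<open>auto simp: sums intro: primitive_on_reflect[OF assms(4,3)]\<close>)
  then show ?thesis
    by (simp add: sums set_integral_Icc_reflect(2)[OF f2] set_integral_Icc_reflect(2)[OF g2])
qed

section \<open>Integrals over countable disjoint unions\<close>

lemma has_sum_set_integral_disjoint_union:
  fixes f :: "'a \<Rightarrow> 'b::{banach, second_countable_topology}" and A :: "nat \<Rightarrow> 'a set"
  assumes A: "\<And>i. A i \<in> sets M" and disj: "\<And>i j. i \<noteq> j \<Longrightarrow> A i \<inter> A j = {}"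
    and f: "set_integrable M (\<Union>i. A i) f"
  shows "((\<lambda>i. LINT x:A i|M. f x) has_sum (LINT x:(\<Union>i. A i)|M. f x)) UNIV"
    and "(\<lambda>i. LINT x:A i|M. f x) sums (LINT x:(\<Union>i. A i)|M. f x)"
proof -
  have fi: "set_integrable M (A i) f" for i
    by (rule set_integrable_subset[OF f A]) auto
  have nf: "set_integrable M (\<Union>i. A i) (\<lambda>x. norm (f x))"
    using set_integrable_norm[OF f] .
  have int: "set_integrable M (\<Union>i<n. A i) (\<lambda>x. norm (f x))" for n
    by (rule set_integrable_subset[OF nf]) (use A in auto)
  have "summable (\<lambda>i. LINT x:A i|M. norm (f x))"
  proof (rule summableI_nonneg_bounded)
    show "0 \<le> (LINT x:A i|M. norm (f x))" for i
      by (simp add: set_lebesgue_integral_def)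
    fix n
    have "(\<Sum>i<n. LINT x:A i|M. norm (f x)) = (LINT x:(\<Union>i<n. A i)|M. norm (f x))"
      by (rule set_integral_finite_Union[symmetric])
        (use disj A fi in \<open>auto simp: disjoint_family_on_def intro: set_integrable_norm\<close>)
    also have "\<dots> \<le> (LINT x:(\<Union>i. A i)|M. norm (f x))"
      using int[of n] nf unfolding set_lebesgue_integral_def set_integrable_def
      by (intro integral_mono) (auto split: split_indicator)
    finally show "(\<Sum>i<n. LINT x:A i|M. norm (f x)) \<le> (LINT x:(\<Union>i. A i)|M. norm (f x))" .
  qed
  then have summ: "summable (\<lambda>i. norm (LINT x:A i|M. f x))"
  proof (rule summable_comparison_test[rotated], intro exI allI impI)
    fix i
    have "norm (LINT x:A i|M. f x) \<le> (LINT x|M. norm (indicator (A i) x *\<^sub>R f x))"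
      unfolding set_lebesgue_integral_def by (rule integral_norm_bound)
    then show "norm (norm (LINT x:A i|M. f x)) \<le> (LINT x:A i|M. norm (f x))"
      by (simp add: set_lebesgue_integral_def)
  qed
  have eq: "(LINT x:(\<Union>i. A i)|M. f x) = (\<Sum>i. LINT x:A i|M. f x)"
    by (rule lebesgue_integral_countable_add[OF A disj f])
  show sums: "(\<lambda>i. LINT x:A i|M. f x) sums (LINT x:(\<Union>i. A i)|M. f x)"
    unfolding eq by (rule summable_sums[OF summable_norm_cancel[OF summ]])
  show "((\<lambda>i. LINT x:A i|M. f x) has_sum (LINT x:(\<Union>i. A i)|M. f x)) UNIV"
    by (rule norm_summable_imp_has_sum[OF summ sums])
qed

lemma set_integrable_disjoint_union_nonneg:
  fixes f :: "'a \<Rightarrow> real" and A :: "nat \<Rightarrow> 'a set"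
  assumes A[measurable]: "\<And>i. A i \<in> sets M" and disj: "\<And>i j. i \<noteq> j \<Longrightarrow> A i \<inter> A j = {}"
    and f: "\<And>i. set_integrable M (A i) f" "\<And>x. 0 \<le> f x"
    and summ: "summable (\<lambda>i. LINT x:A i|M. f x)"
  shows "set_integrable M (\<Union>i. A i) f"
proof -
  have U: "(\<Union>i. A i) \<in> sets M" using A by auto
  have meas: "(\<lambda>x. indicator (\<Union>i. A i) x *\<^sub>R f x) \<in> borel_measurable M"
  proof -
    have "f \<in> borel_measurable (restrict_space M (\<Union>i. A i))"
    proof (rule measurable_piecewise_restrict[of "range A"])
      fix B assume "B \<in> range A"
      then obtain i where B: "B = A i" by auto
      have "(\<lambda>x. indicator (A i) x *\<^sub>R f x) \<in> borel_measurable M"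
        using f(1) by (auto simp: set_integrable_def)
      then have "f \<in> borel_measurable (restrict_space M (A i))"
        using A by (subst borel_measurable_restrict_space_iff) auto
      then show "f \<in> borel_measurable (restrict_space (restrict_space M (\<Union>i. A i)) B)"
        using U A B by (subst restrict_restrict_space) (auto simp: Int_absorb1 UN_upper)
      show "B \<inter> space (restrict_space M (\<Union>i. A i)) \<in> sets (restrict_space M (\<Union>i. A i))"
        using U A B by (auto simp: sets_restrict_space_iff space_restrict_space2 sets.Int)
    qed (auto simp: space_restrict_space)
    then show ?thesis using U by (subst (asm) borel_measurable_restrict_space_iff) auto
  qed
  have "(\<integral>\<^sup>+x. ennreal (indicator (\<Union>i. A i) x *\<^sub>R f x) \<partial>M) = (\<Sum>i. \<integral>\<^sup>+x. ennreal (indicator (A i) x *\<^sub>R f x) \<partial>M)"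
  proof -
    have "(\<integral>\<^sup>+x. ennreal (indicator (\<Union>i. A i) x *\<^sub>R f x) \<partial>M)
        = (\<integral>\<^sup>+x. (\<Sum>i. ennreal (indicator (A i) x *\<^sub>R f x)) \<partial>M)"
    proof (rule nn_integral_cong)
      fix x
      show "ennreal (indicator (\<Union>i. A i) x *\<^sub>R f x) = (\<Sum>i. ennreal (indicator (A i) x *\<^sub>R f x))"
      proof (cases "x \<in> (\<Union>i. A i)")
        case True
        then obtain j where j: "x \<in> A j" by auto
        have "(\<Sum>i. ennreal (indicator (A i) x *\<^sub>R f x)) = (\<Sum>i\<in>{j}. ennreal (indicator (A i) x *\<^sub>R f x))"
          by (rule suminf_finite) (use j disj in \<open>auto simp: indicator_def\<close>)
        then show ?thesis using j True by simp
      qed simp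
    qed
    also have "\<dots> = (\<Sum>i. \<integral>\<^sup>+x. ennreal (indicator (A i) x *\<^sub>R f x) \<partial>M)"
      using f(1) by (intro nn_integral_suminf) (auto simp: set_integrable_def)
    finally show ?thesis .
  qed
  also have "\<dots> = (\<Sum>i. ennreal (LINT x:A i|M. f x))"
    using f unfolding set_lebesgue_integral_def set_integrable_def
    by (intro suminf_cong nn_integral_eq_integral) auto
  also have "\<dots> = ennreal (\<Sum>i. LINT x:A i|M. f x)"
    using f(2) by (intro suminf_ennreal_eq summable_sums summ) (simp add: set_lebesgue_integral_def)
  finally have "(\<integral>\<^sup>+x. ennreal (indicator (\<Union>i. A i) x *\<^sub>R f x) \<partial>M) < \<infinity>" by simp
  then show ?thesis
    unfolding set_integrable_def using meas f(2)
    by (intro integrableI_nonneg) auto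
qed

section \<open>The comb as a subset of the real line\<close>

locale comb_model =
  fixes \<alpha> :: real
  assumes alpha: "1 < \<alpha>"
begin

definition foot :: "nat \<Rightarrow> real" where "foot n = real n powr (- \<alpha>)"

text \<open>The backbone is \<open>[0, 1]\<close> and the tooth \<open>n\<close> is laid out from \<open>2 n\<close> on. Since teeth have length at most 1,
  they are disjoint and \<open>\<lfloor>q / 2\<rfloor>\<close> is the number of the tooth that contains \<open>q\<close>. The attachment of the
  tooth at \<open>foot n\<close> is encoded in the function \<open>base\<close> below.\<close>

definition tooth :: "nat \<Rightarrow> real set" where "tooth n = {2 * real n..2 * real n + foot n}"

definition comb_set :: "real set" where "comb_set = {0..1} \<union> (\<Union>n. tooth (Suc n))"

abbreviation M :: "real measure" where "M \<equiv> lebesgue_on comb_set"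

lemma foot_bounds: "1 \<le> n \<Longrightarrow> 0 < foot n" "foot n \<le> 1" "0 \<le> foot n"
proof -
  show "1 \<le> n \<Longrightarrow> 0 < foot n" "0 \<le> foot n" by (auto simp: foot_def)
  show "foot n \<le> 1"
  proof (cases "n = 0")
    case False
    then have "real n powr (- \<alpha>) \<le> 1 powr (- \<alpha>)" using alpha by (intro powr_mono2') auto
    then show ?thesis by (simp add: foot_def)
  qed (simp add: foot_def)
qed

lemma foot_1 [simp]: "foot 1 = 1" "foot (Suc 0) = 1"
  by (simp_all add: foot_def)

lemma foot_less: "1 \<le> m \<Longrightarrow> m < n \<Longrightarrow> foot n < foot m"
  using alpha by (auto simp: foot_def intro!: powr_less_mono2_neg)

lemma foot_inj: "1 \<le> m \<Longrightarrow> 1 \<le> n \<Longrightarrow> foot m = foot n \<Longrightarrow> m = n"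
  using foot_less[of m n] foot_less[of n m] by (cases m n rule: linorder_cases) auto

lemma foot_summable: "summable foot"
  using alpha unfolding foot_def by (subst summable_real_powr_iff) auto

lemma foot_tendsto_0: "foot \<longlonglongrightarrow> 0"
  by (rule summable_LIMSEQ_zero[OF foot_summable])

lemma tooth_floor: "q \<in> tooth n \<Longrightarrow> \<lfloor>q / 2\<rfloor> = int n"
  using foot_bounds(2)[of n] by (intro floor_unique) (auto simp: tooth_def)

lemma tooth_gt_1: "q \<in> tooth n \<Longrightarrow> 1 \<le> n \<Longrightarrow> 1 < q"
  by (auto simp: tooth_def)

lemma tooth_disjoint: "m \<noteq> n \<Longrightarrow> tooth m \<inter> tooth n = {}"
proof (rule ccontr)
  assume "m \<noteq> n" "tooth m \<inter> tooth n \<noteq> {}"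
  then obtain q where "q \<in> tooth m" "q \<in> tooth n" by blast
  then have "int m = int n" by (simp only: tooth_floor[symmetric])
  then show False using \<open>m \<noteq> n\<close> by simp
qed

lemma comb_set_cases:
  assumes "q \<in> comb_set"
  obtains (backbone) "q \<in> {0..1}" | (tooth) n where "1 \<le> n" "q \<in> tooth n"
proof -
  from assms consider "q \<in> {0..1}" | n where "q \<in> tooth (Suc n)" unfolding comb_set_def by blast
  then show thesis using that by cases auto
qed

lemma backbone_subset: "{0..1} \<subseteq> comb_set"
  by (auto simp: comb_set_def)

lemma tooth_subset: "1 \<le> n \<Longrightarrow> tooth n \<subseteq> comb_set"
  by (cases n) (auto simp: comb_set_def)

lemma tooth_sets [measurable]: "tooth n \<in> sets lebesgue"
  by (simp add: tooth_def)

lemma comb_set_sets [measurable]: "comb_set \<in> sets lebesgue"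
  unfolding comb_set_def by auto

lemma comb_set_lmeasurable: "comb_set \<in> lmeasurable"
proof (rule fmeasurableI)
  have "emeasure lebesgue (\<Union>n. tooth (Suc n)) \<le> (\<Sum>n. emeasure lebesgue (tooth (Suc n)))"
    by (rule emeasure_subadditive_countably) auto
  also have "\<dots> = (\<Sum>n. ennreal (foot (Suc n)))"
    using foot_bounds by (simp add: tooth_def)
  also have "\<dots> = ennreal (\<Sum>n. foot (Suc n))"
    using foot_bounds foot_summable
    by (intro suminf_ennreal_eq summable_sums) (auto simp: summable_Suc_iff)
  also have "\<dots> < \<infinity>" by simp
  finally have "emeasure lebesgue {0..1::real} + emeasure lebesgue (\<Union>n. tooth (Suc n)) < \<infinity>"
    by (simp only: ennreal_add_less_top infinity_ennreal_def) simp
  moreover have "emeasure lebesgue comb_set \<le> emeasure lebesgue {0..1::real} + emeasure lebesgue (\<Union>n. tooth (Suc n))"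
    unfolding comb_set_def by (rule emeasure_subadditive) auto
  ultimately show "emeasure lebesgue comb_set < \<infinity>" by (rule le_less_trans[rotated])
qed (rule comb_set_sets)

sublocale finite_measure M
  by (rule finite_measure_lebesgue_on[OF comb_set_lmeasurable])

lemma integrable_M_iff:
  fixes h :: "real \<Rightarrow> 'b::{banach, second_countable_topology}"
  shows "integrable M h \<longleftrightarrow> set_integrable lebesgue comb_set h"
  by (rule lebesgue_on_eq_set_integral(2)[OF comb_set_sets])

lemma integral_M_eq:
  fixes h :: "real \<Rightarrow> 'b::{banach, second_countable_topology}"
  shows "(LINT z|M. h z) = (LINT z:comb_set|lebesgue. h z)"
  by (rule lebesgue_on_eq_set_integral(1)[OF comb_set_sets])

lemma integrable_M_subset:
  fixes h :: "real \<Rightarrow> 'b::{banach, second_countable_topology}"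
  shows "integrable M h \<Longrightarrow> A \<subseteq> comb_set \<Longrightarrow> A \<in> sets lebesgue \<Longrightarrow> set_integrable lebesgue A h"
  unfolding integrable_M_iff by (rule set_integrable_subset)

lemma integral_M_sums:
  fixes h :: "real \<Rightarrow> 'b::{banach, second_countable_topology}"
  assumes "integrable M h"
  shows "(\<lambda>n. LINT z:tooth (Suc n)|lebesgue. h z) sums ((LINT z|M. h z) - (LINT z:{0..1}|lebesgue. h z))"
proof -
  let ?U = "\<Union>n. tooth (Suc n)"
  have U: "?U \<subseteq> comb_set" by (auto simp: comb_set_def)
  have disj: "{0..1} \<inter> ?U = {}"
    using tooth_gt_1 by (auto simp: disjoint_iff dest!: tooth_gt_1)
  have "(LINT z|M. h z) = (LINT z:{0..1} \<union> ?U|lebesgue. h z)"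
    unfolding integral_M_eq by (simp only: comb_set_def)
  also have "\<dots> = (LINT z:{0..1}|lebesgue. h z) + (LINT z:?U|lebesgue. h z)"
    by (rule set_integral_Un[OF disj]) (auto intro!: integrable_M_subset[OF assms] simp: comb_set_def)
  finally have "(LINT z:?U|lebesgue. h z) = (LINT z|M. h z) - (LINT z:{0..1}|lebesgue. h z)" by simp
  moreover have "(\<lambda>n. LINT z:tooth (Suc n)|lebesgue. h z) sums (LINT z:?U|lebesgue. h z)"
    by (rule has_sum_set_integral_disjoint_union(2))
       (use tooth_disjoint U in \<open>auto intro!: integrable_M_subset[OF assms]\<close>)
  ultimately show ?thesis by simp
qed

text \<open>The position on the backbone from which a point of the comb is reached.\<close>

definition base :: "real \<Rightarrow> real" where
  "base q = (if q \<le> 1 then q else foot (nat \<lfloor>q / 2\<rfloor>))"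

lemma base_tooth: "q \<in> tooth n \<Longrightarrow> 1 \<le> n \<Longrightarrow> base q = foot n"
  using tooth_floor[of q n] tooth_gt_1[of q n] by (simp add: base_def)

text \<open>The incidence kernel: the coefficient of \<open>z\<close> in the oriented path from the foot at \<open>1\<close> to
  \<open>q\<close>, edges being oriented towards 1 on the backbone and towards the tip on a tooth. As a function
  of \<open>z\<close> it integrates derivatives along that path; as a function of \<open>q\<close> it is, up to the sign, the
  indicator of the branch behind \<open>z\<close>, so that it also computes fluxes.\<close>

definition incidence :: "real \<Rightarrow> real \<Rightarrow> real" where
  "incidence z q =
    (if z \<le> 1 then (if base q < z then -1 else 0)
     else if \<lfloor>z / 2\<rfloor> = \<lfloor>q / 2\<rfloor> \<and> z \<le> q then 1 else 0)"

lemma base_measurable [measurable]: "base \<in> borel_measurable borel"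
  unfolding base_def foot_def by measurable

lemma incidence_bound: "\<bar>incidence z q\<bar> \<le> 1"
  by (simp add: incidence_def)

lemma id_measurable_M [measurable]: "(\<lambda>x. x) \<in> borel_measurable M"
  using id_borel_measurable_lebesgue_on[of comb_set] by (simp add: id_def)

lemma borel_measurable_M: "h \<in> borel_measurable borel \<Longrightarrow> h \<in> borel_measurable M"
  by (rule measurable_compose[OF id_measurable_M])

lemma incidence_measurable [measurable]: "(\<lambda>(z, q). incidence z q) \<in> borel_measurable (M \<Otimes>\<^sub>M M)"
proof -
  have *: "(\<lambda>(z, q). incidence z q) \<in> borel_measurable (borel \<Otimes>\<^sub>M borel)"
    unfolding incidence_def by measurable
  have "(\<lambda>p. (fst p, snd p)) \<in> M \<Otimes>\<^sub>M M \<rightarrow>\<^sub>M borel \<Otimes>\<^sub>M borel"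
    by (intro measurable_Pair measurable_compose[OF measurable_fst id_measurable_M]
        measurable_compose[OF measurable_snd id_measurable_M])
  from measurable_compose[OF this *] show ?thesis by (simp add: case_prod_beta')
qed

lemma incidence_measurable_fst: "(\<lambda>z. incidence z q) \<in> borel_measurable M"
  by (rule borel_measurable_M) (unfold incidence_def, measurable)

lemma incidence_measurable_snd: "(\<lambda>q. incidence z q) \<in> borel_measurable M"
  by (rule borel_measurable_M) (unfold incidence_def, measurable)

definition path_integral :: "(real \<Rightarrow> 'b::{banach, second_countable_topology}) \<Rightarrow> real \<Rightarrow> 'b" where
  "path_integral g q = (LINT z|M. incidence z q *\<^sub>R g z)"

definition flux :: "(real \<Rightarrow> 'b::{banach, second_countable_topology}) \<Rightarrow> real \<Rightarrow> 'b" where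
  "flux v z = (LINT q|M. incidence z q *\<^sub>R v q)"

lemma set_integral_Ioc:
  fixes g :: "real \<Rightarrow> 'b::{banach, second_countable_topology}"
  shows "(LINT z:{a<..b}|lebesgue. g z) = (LINT z:{a..b}|lebesgue. g z)"
    and "set_integrable lebesgue {a<..b} g \<longleftrightarrow> set_integrable lebesgue {a..b} g"
  by (rule set_integral_discrete_difference[of "{a}"] set_integrable_discrete_difference[of "{a}"]; auto)+

lemma set_integral_Icc_degenerate:
  fixes g :: "real \<Rightarrow> 'b::{banach, second_countable_topology}"
  shows "(LINT z:{a..a}|lebesgue. g z) = 0"
  unfolding set_integral_Ioc(1)[symmetric] by (simp add: set_lebesgue_integral_def)

lemma path_integral_backbone:
  assumes q: "q \<in> {0..1}"
  shows "path_integral g q = - (LINT z:{q..1}|lebesgue. g z)"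
proof -
  have inc: "indicator comb_set z * incidence z q = - indicator {q<..1} z" for z
  proof (cases "z \<in> comb_set")
    case True
    then show ?thesis
    proof (cases rule: comb_set_cases)
      case backbone
      then show ?thesis using q True by (auto simp: incidence_def base_def indicator_def)
    next
      case (tooth n)
      have "\<lfloor>q / 2\<rfloor> = 0" using q by (intro floor_unique) auto
      then show ?thesis
        using tooth tooth_floor[of z n] tooth_gt_1[of z n] by (auto simp: incidence_def indicator_def)
    qed
  next
    case False
    moreover have "z \<notin> {q<..1}" using q False backbone_subset by (auto simp: subset_iff)
    ultimately show ?thesis by (simp add: indicator_def)
  qed
  have "path_integral g q = (LINT z|lebesgue. (indicator comb_set z * incidence z q) *\<^sub>R g z)"
    by (simp add: path_integral_def integral_M_eq set_lebesgue_integral_def)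
  also have "\<dots> = - (LINT z:{q<..1}|lebesgue. g z)"
    unfolding inc by (simp add: set_lebesgue_integral_def)
  finally show ?thesis by (simp add: set_integral_Ioc)
qed

lemma path_integral_tooth:
  assumes q: "q \<in> tooth n" "1 \<le> n" and g: "integrable M g"
  shows "path_integral g q = (LINT z:{2 * real n..q}|lebesgue. g z) - (LINT z:{foot n..1}|lebesgue. g z)"
proof -
  have sub: "{2 * real n..q} \<subseteq> tooth n" using q by (auto simp: tooth_def)
  have inc: "indicator comb_set z * incidence z q = indicator {2 * real n..q} z - indicator {foot n<..1} z" for z
  proof (cases "z \<in> comb_set")
    case True
    then show ?thesis
    proof (cases rule: comb_set_cases)
      case backbone
      then show ?thesis using q True sub base_tooth[OF q]
        by (auto simp: incidence_def indicator_def)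
    next
      case (tooth m)
      have "z \<in> {2 * real n..q} \<longleftrightarrow> m = n \<and> z \<le> q"
      proof
        assume z: "z \<in> {2 * real n..q}"
        then have "z \<in> tooth m \<inter> tooth n" using tooth sub by auto
        then show "m = n \<and> z \<le> q" using z tooth_disjoint[of m n] by auto
      next
        assume "m = n \<and> z \<le> q"
        then show "z \<in> {2 * real n..q}" using tooth by (auto simp: tooth_def)
      qed
      then show ?thesis
        using True tooth tooth_floor[of z m] tooth_gt_1[of z m] tooth_floor[of q n] q
        by (auto simp: incidence_def indicator_def)
    qed
  next
    case False
    then have "z \<notin> {2 * real n..q}" "z \<notin> {foot n<..1}"
      using sub tooth_subset[OF q(2)] backbone_subset foot_bounds(3)[of n] by (auto simp: subset_iff)
    then show ?thesis using False by (simp only: indicator_def of_bool_eq mult_zero_left diff_self)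
  qed
  have int: "set_integrable lebesgue {2 * real n..q} g" "set_integrable lebesgue {foot n<..1} g"
    using sub tooth_subset[OF q(2)] backbone_subset foot_bounds(3)[of n]
    by (auto intro!: integrable_M_subset[OF g])
  have "path_integral g q = (LINT z|lebesgue. (indicator comb_set z * incidence z q) *\<^sub>R g z)"
    by (simp add: path_integral_def integral_M_eq set_lebesgue_integral_def)
  also have "\<dots> = (LINT z:{2 * real n..q}|lebesgue. g z) - (LINT z:{foot n<..1}|lebesgue. g z)"
    unfolding inc using int by (simp add: set_lebesgue_integral_def set_integrable_def scaleR_left_diff_distrib)
  finally show ?thesis by (simp add: set_integral_Ioc)
qed

text \<open>The pairs \<open>f\<close>, \<open>g\<close> such that \<open>f\<close> is a Sobolev function on the comb and \<open>g\<close> its derivative;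
  the glueing conditions at the feet are part of the representation by path integrals.\<close>

definition sobolev_pair :: "(real \<Rightarrow> complex) \<Rightarrow> (real \<Rightarrow> complex) \<Rightarrow> bool" where
  "sobolev_pair f g \<longleftrightarrow> g \<in> borel_measurable M \<and> integrable M (\<lambda>z. (norm (g z))\<^sup>2) \<and>
    (\<forall>q\<in>comb_set. f q = f 1 + path_integral g q)"

lemma square_integrable_imp_integrable:
  fixes g :: "real \<Rightarrow> 'b::{banach, second_countable_topology}"
  assumes "g \<in> borel_measurable M" "integrable M (\<lambda>z. (norm (g z))\<^sup>2)"
  shows "integrable M g"
proof (rule Bochner_Integration.integrable_bound)
  show "integrable M (\<lambda>z. 1 + (norm (g z))\<^sup>2)" using assms by auto
  have "y \<le> 1 + y\<^sup>2" for y :: real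
    using sum_power2_ge_zero[of "y - 1/2" 0] by (simp add: power2_eq_square algebra_simps)
  then show "AE z in M. norm (g z) \<le> norm (1 + (norm (g z))\<^sup>2)"
    by (intro AE_I2) simp
qed (rule assms)

lemma sobolev_pair_integrable: "sobolev_pair f g \<Longrightarrow> integrable M g"
  by (rule square_integrable_imp_integrable) (auto simp: sobolev_pair_def)

lemma sobolev_pair_eq: "sobolev_pair f g \<Longrightarrow> q \<in> comb_set \<Longrightarrow> f q = f 1 + path_integral g q"
  unfolding sobolev_pair_def by blast

lemma sobolev_pair_backbone:
  assumes fg: "sobolev_pair f g"
  shows "primitive_on 0 1 f g"
  unfolding primitive_on_def
proof (intro conjI ballI)
  show int: "set_integrable lebesgue {0..1} g"
    by (rule integrable_M_subset[OF sobolev_pair_integrable[OF fg] backbone_subset]) simp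
  fix x :: real assume x: "x \<in> {0..1}"
  have "f x = f 1 - (LINT z:{x..1}|lebesgue. g z)" "f 0 = f 1 - (LINT z:{0..1}|lebesgue. g z)"
    using sobolev_pair_eq[OF fg, of x] sobolev_pair_eq[OF fg, of 0] x backbone_subset
    by (auto simp: path_integral_backbone subset_iff)
  moreover have "(LINT z:{0..1}|lebesgue. g z) = (LINT z:{0..x}|lebesgue. g z) + (LINT z:{x..1}|lebesgue. g z)"
    using x by (intro set_integral_Icc_combine int) auto
  ultimately show "f x = f 0 + (LINT z:{0..x}|lebesgue. g z)" by simp
qed

lemma sobolev_pair_glue:
  assumes fg: "sobolev_pair f g" and n: "1 \<le> n"
  shows "f (2 * real n) = f (foot n)"
proof -
  have 1: "2 * real n \<in> tooth n" "foot n \<in> {0..1}" using foot_bounds[of n] by (auto simp: tooth_def)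
  have "(LINT z:{2 * real n..2 * real n}|lebesgue. g z) = 0"
    by (rule set_integral_Icc_degenerate)
  then show ?thesis
    using sobolev_pair_eq[OF fg, of "2 * real n"] sobolev_pair_eq[OF fg, of "foot n"] 1
      tooth_subset[OF n] backbone_subset
    by (auto simp: path_integral_tooth[OF 1(1) n sobolev_pair_integrable[OF fg]] path_integral_backbone subset_iff)
qed

lemma sobolev_pair_tooth:
  assumes fg: "sobolev_pair f g" and n: "1 \<le> n"
  shows "primitive_on (2 * real n) (2 * real n + foot n) f g"
  unfolding primitive_on_def
proof (intro conjI ballI)
  note int = sobolev_pair_integrable[OF fg]
  show "set_integrable lebesgue {2 * real n..2 * real n + foot n} g"
    using integrable_M_subset[OF int tooth_subset[OF n] tooth_sets] by (simp add: tooth_def)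
  fix x assume "x \<in> {2 * real n..2 * real n + foot n}"
  then have x: "x \<in> tooth n" by (simp add: tooth_def)
  have "foot n \<in> {0..1}" using foot_bounds[of n] by auto
  then have "f (foot n) = f 1 - (LINT z:{foot n..1}|lebesgue. g z)"
    using sobolev_pair_eq[OF fg, of "foot n"] backbone_subset by (auto simp: path_integral_backbone)
  moreover have "f x = f 1 + ((LINT z:{2 * real n..x}|lebesgue. g z) - (LINT z:{foot n..1}|lebesgue. g z))"
    using sobolev_pair_eq[OF fg, of x] x tooth_subset[OF n] path_integral_tooth[OF x n int] by auto
  ultimately show "f x = f (2 * real n) + (LINT z:{2 * real n..x}|lebesgue. g z)"
    by (simp add: sobolev_pair_glue[OF fg n])
qed

lemma sobolev_pairI:
  assumes g: "g \<in> borel_measurable M" "integrable M (\<lambda>z. (norm (g z))\<^sup>2)"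
    and bb: "primitive_on 0 1 f g"
    and tt: "\<And>n. 1 \<le> n \<Longrightarrow> primitive_on (2 * real n) (2 * real n + foot n) f g"
    and glue: "\<And>n. 1 \<le> n \<Longrightarrow> f (2 * real n) = f (foot n)"
  shows "sobolev_pair f g"
  unfolding sobolev_pair_def
proof (intro conjI ballI g)
  note int = square_integrable_imp_integrable[OF g]
  fix q assume "q \<in> comb_set"
  then show "f q = f 1 + path_integral g q"
  proof (cases rule: comb_set_cases)
    case backbone
    then show ?thesis
      using primitive_onD[OF bb, of q 1] by (simp add: path_integral_backbone)
  next
    case (tooth n)
    have "f q = f (foot n) + (LINT z:{2 * real n..q}|lebesgue. g z)"
      using primitive_onD[OF tt[OF tooth(1)], of "2 * real n" q] tooth glue by (simp add: tooth_def)
    moreover have "f 1 = f (foot n) + (LINT z:{foot n..1}|lebesgue. g z)"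
      using foot_bounds[of n] by (intro primitive_onD[OF bb]) auto
    ultimately show ?thesis using path_integral_tooth[OF tooth(2,1) int] by simp
  qed
qed

lemma sobolev_pair_path_integral:
  assumes "g \<in> borel_measurable M" "integrable M (\<lambda>z. (norm (g z))\<^sup>2)"
    and "\<And>q. q \<in> comb_set \<Longrightarrow> f q = c + path_integral g q"
  shows "sobolev_pair f g"
proof -
  have "(LINT z:{1..1}|lebesgue. g z) = 0"
    by (rule set_integral_Icc_degenerate)
  then have "f 1 = c"
    using assms(3)[of 1] subsetD[OF backbone_subset, of 1] path_integral_backbone[of 1 g] by simp
  then show ?thesis using assms by (simp add: sobolev_pair_def)
qed

text \<open>Both sides are the double integral of the incidence kernel against \<open>v\<close> and \<open>g\<close>.\<close>

lemma integral_flux_mult: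
  fixes v g :: "real \<Rightarrow> 'b::{real_normed_field, banach, second_countable_topology}"
  assumes "integrable M v" "integrable M g"
  shows "(LINT z|M. flux v z * g z) = (LINT q|M. v q * path_integral g q)"
    and "integrable M (\<lambda>z. flux v z * g z)" "integrable M (\<lambda>q. v q * path_integral g q)"
proof -
  have sf: "sigma_finite_measure M" by (rule sigma_finite_measure_axioms)
  have m2: "case_prod (\<lambda>q z. incidence z q) \<in> borel_measurable (M \<Otimes>\<^sub>M M)"
    using measurable_compose[OF measurable_pair_swap' incidence_measurable] by (simp add: case_prod_beta')
  show "(LINT z|M. flux v z * g z) = (LINT q|M. v q * path_integral g q)"
    unfolding flux_def path_integral_def
    using kernel_integral_swap(2)[OF sf incidence_measurable incidence_bound assms]
    by (simp add: mult.commute)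
  show "integrable M (\<lambda>z. flux v z * g z)"
    unfolding flux_def
    using kernel_integral_swap(1)[OF sf incidence_measurable incidence_bound assms]
    by (simp add: mult.commute)
  show "integrable M (\<lambda>q. v q * path_integral g q)"
    unfolding path_integral_def
    using kernel_integral_swap(1)[OF sf m2 incidence_bound assms(2,1)]
    by (simp add: mult.commute)
qed

text \<open>The value \<open>f 1\<close> at the root of all paths drops out because \<open>v\<close> has mean zero. Since the flux of \<open>v\<close>
  is the derivative of a solution \<open>u\<close> of \<open>- u'' = v\<close>, this is integration by parts on the whole graph:
  the boundary terms at the feet, at the tips and at \<open>0\<close> are accounted for by the kernel.\<close>

lemma green_identity:
  assumes fg: "sobolev_pair f g" and v: "integrable M v" "(LINT q|M. v q) = 0"
  shows "(LINT z|M. flux v z * g z) = (LINT q|M. v q * f q)"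
proof -
  note int = integral_flux_mult[OF v(1) sobolev_pair_integrable[OF fg]]
  have "(LINT q|M. v q * f q) = (LINT q|M. v q * f 1 + v q * path_integral g q)"
  proof (rule Bochner_Integration.integral_cong)
    fix q assume "q \<in> space M"
    then have "q \<in> comb_set" by simp
    from sobolev_pair_eq[OF fg this]
    show "v q * f q = v q * f 1 + v q * path_integral g q" by (simp only: distrib_left)
  qed simp
  also have "\<dots> = (LINT q|M. v q * path_integral g q)"
    using int(3) v by simp
  finally show ?thesis using int(1) by simp
qed

end

section \<open>The lower bound: a Poincare inequality on the comb\<close>

lemma poincare_segment_mirrored:
  assumes ab: "a \<le> b" and f: "primitive_on a b f g"
    and g2: "set_integrable lebesgue {a..b} (\<lambda>x. (norm (g x))\<^sup>2)"
    and m: "0 < \<omega>" "\<omega> * (b - a) < pi / 2"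
  shows "\<omega>\<^sup>2 * sq_integral {a..b} f
    \<le> sq_integral {a..b} g + \<omega> * tan (\<omega> * (b - a)) * (norm (f a))\<^sup>2"
proof -
  note f2 = primitive_on_norm_sq_integrable[OF f]
  have g2': "set_integrable lebesgue {-b..-a} (\<lambda>x. (norm (- g (- x)))\<^sup>2)"
    using set_integral_Icc_reflect(1)[OF g2] by simp
  have "- b \<le> - a" "\<omega> * (0 + (- a - - b)) < pi / 2" using ab m by auto
  from poincare_segment[OF this(1) primitive_on_reflect[OF f ab] g2' m(1) order_refl this(2)]
  show ?thesis
    by (simp add: set_integral_Icc_reflect(2)[OF f2] set_integral_Icc_reflect(2)[OF g2])
qed

text \<open>Beyond the first zero the edge consists of intervals of length \<open>L\<close> with a zero at their left end,
  which satisfy the inequality on their own. Only the initial piece of length \<open>r\<close> sees the foot.\<close>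

lemma poincare_edge_with_zeros:
  assumes "b = a + r + real j * L" "0 \<le> r" "r \<le> L" "primitive_on a b f g"
    and "set_integrable lebesgue {a..b} (\<lambda>x. (norm (g x))\<^sup>2)"
    and "\<And>i. i < j \<Longrightarrow> f (a + r + real i * L) = 0"
    and "0 < \<omega>" "\<omega> * L < pi / 2"
  shows "\<omega>\<^sup>2 * sq_integral {a..b} f
    \<le> sq_integral {a..b} g + \<omega> * tan (\<omega> * r) * (norm (f a))\<^sup>2"
  using assms
proof (induction j arbitrary: b)
  case 0
  have "\<omega> * r \<le> \<omega> * L" using 0 by (intro mult_left_mono) auto
  then have "\<omega> * r < pi / 2" using 0 by linarith
  then show ?case using poincare_segment_mirrored[of a b f g \<omega>] 0 by simp
next
  case (Suc j)
  define c where "c = a + r + real j * L"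
  have bc: "b = c + L" using Suc.prems(1) by (simp add: c_def algebra_simps)
  have L: "0 \<le> L" using Suc.prems by linarith
  have ac: "a \<le> c" "c \<le> b" using Suc.prems(2) L bc by (auto simp: c_def)
  have int: "set_integrable lebesgue {s..t} (\<lambda>x. (norm (g x))\<^sup>2)"
      "set_integrable lebesgue {s..t} (\<lambda>x. (norm (f x))\<^sup>2)" if "a \<le> s" "t \<le> b" for s t
    using primitive_on_norm_sq_integrable[OF Suc.prems(4)] Suc.prems(5) that
    by (auto intro: set_integrable_subset)
  have prim: "primitive_on a c f g" "primitive_on c b f g"
    using Suc.prems(4) ac by (auto intro: primitive_on_subinterval)
  have "\<omega>\<^sup>2 * sq_integral {a..c} f
    \<le> sq_integral {a..c} g + \<omega> * tan (\<omega> * r) * (norm (f a))\<^sup>2"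
    by (rule Suc.IH[OF c_def Suc.prems(2,3) prim(1) int(1)]) (use Suc.prems ac in auto)
  moreover have "\<omega>\<^sup>2 * sq_integral {c..b} f \<le> sq_integral {c..b} g"
  proof -
    have "f c = 0" using Suc.prems(6)[of j] by (simp add: c_def)
    then show ?thesis
      using poincare_segment_mirrored[OF ac(2) prim(2) int(1) Suc.prems(7)] ac Suc.prems(8) bc by simp
  qed
  moreover have "sq_integral {a..b} f
      = sq_integral {a..c} f + sq_integral {c..b} f"
    "sq_integral {a..b} g
      = sq_integral {a..c} g + sq_integral {c..b} g"
    using ac int by (auto intro: set_integral_Icc_combine)
  ultimately show ?case by (simp add: algebra_simps)
qed

context comb_model
begin

definition vol :: real where "vol = measure lebesgue comb_set"

lemma measure_M: "measure M (space M) = vol"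
  by (simp add: vol_def measure_restrict_space)

lemma set_integral_Icc_const:
  fixes a b c :: real
  assumes "a \<le> b"
  shows "(LINT z:{a..b}|lebesgue. c) = (b - a) * c"
proof -
  have "set_integrable lebesgue {a..b} (\<lambda>_. c)"
    by (intro absolutely_integrable_continuous_real continuous_intros)
  then show ?thesis using assms by (simp add: set_lebesgue_integral_eq_integral(2))
qed

lemma integral_tooth_const: "(LINT z:tooth n|lebesgue. (c::real)) = foot n * c"
  using foot_bounds(3)[of n] by (simp add: tooth_def set_integral_Icc_const)

lemma foot_sums: "(\<lambda>n. foot (Suc n)) sums (vol - 1)"
proof -
  have "(LINT z|M. (1::real)) = vol" using measure_M by simp
  then show ?thesis
    using integral_M_sums[of "\<lambda>_. 1::real"] by (simp add: integral_tooth_const set_integral_Icc_const)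
qed

lemma vol_gt_2: "2 < vol"
proof -
  have "foot 1 + foot 2 \<le> vol - 1"
  proof -
    have "(\<Sum>n<2. foot (Suc n)) \<le> (\<Sum>n. foot (Suc n))"
      using foot_sums foot_bounds by (intro sum_le_suminf) (auto simp: sums_iff)
    then show ?thesis using foot_sums by (simp add: sums_iff numeral_2_eq_2)
  qed
  then show ?thesis using foot_bounds(1)[of 2] by simp
qed

lemma path_integral_measurable:
  fixes g :: "real \<Rightarrow> 'b::{banach, second_countable_topology}"
  assumes [measurable]: "g \<in> borel_measurable M"
  shows "path_integral g \<in> borel_measurable M"
proof -
  have [measurable]: "(\<lambda>(q, z). incidence z q) \<in> borel_measurable (M \<Otimes>\<^sub>M M)"
    using measurable_compose[OF measurable_pair_swap' incidence_measurable] by (simp add: case_prod_beta')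
  show ?thesis unfolding path_integral_def by measurable
qed

lemma flux_measurable:
  fixes v :: "real \<Rightarrow> 'b::{banach, second_countable_topology}"
  assumes [measurable]: "v \<in> borel_measurable M"
  shows "flux v \<in> borel_measurable M"
  unfolding flux_def by measurable

lemma kernel_integral_bound:
  fixes v :: "real \<Rightarrow> 'b::{banach, second_countable_topology}"
  assumes v: "integrable M v" and k: "k \<in> borel_measurable M" "\<And>q. \<bar>k q\<bar> \<le> (1::real)"
  shows "norm (LINT q|M. k q *\<^sub>R v q) \<le> (LINT q|M. norm (v q))"
    and "integrable M (\<lambda>q. k q *\<^sub>R v q)"
proof -
  show int: "integrable M (\<lambda>q. k q *\<^sub>R v q)"
    by (rule Bochner_Integration.integrable_bound[OF v])
      (use v k in \<open>auto intro!: mult_left_le_one_le\<close>)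
  have "norm (LINT q|M. k q *\<^sub>R v q) \<le> (LINT q|M. norm (k q *\<^sub>R v q))"
    by (rule integral_norm_bound)
  also have "\<dots> \<le> (LINT q|M. norm (v q))"
    using k by (intro integral_mono integrable_norm[OF int] integrable_norm[OF v])
      (auto intro: mult_left_le_one_le)
  finally show "norm (LINT q|M. k q *\<^sub>R v q) \<le> (LINT q|M. norm (v q))" .
qed

lemma path_integral_bound:
  fixes g :: "real \<Rightarrow> 'b::{banach, second_countable_topology}"
  shows "integrable M g \<Longrightarrow> norm (path_integral g q) \<le> (LINT z|M. norm (g z))"
  unfolding path_integral_def
  by (rule kernel_integral_bound(1)[OF _ incidence_measurable_fst incidence_bound])

lemma flux_bound:
  fixes v :: "real \<Rightarrow> 'b::{banach, second_countable_topology}"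
  shows "integrable M v \<Longrightarrow> norm (flux v z) \<le> (LINT q|M. norm (v q))"
  unfolding flux_def
  by (rule kernel_integral_bound(1)[OF _ incidence_measurable_snd incidence_bound])

lemma sobolev_pair_measurable:
  assumes "sobolev_pair f g"
  shows "f \<in> borel_measurable M"
proof -
  have "(\<lambda>q. f 1 + path_integral g q) \<in> borel_measurable M"
    using assms by (intro borel_measurable_add path_integral_measurable) (auto simp: sobolev_pair_def)
  moreover have "f q = f 1 + path_integral g q" if "q \<in> space M" for q
    using sobolev_pair_eq[OF assms] that by simp
  ultimately show ?thesis using measurable_cong[of M f "\<lambda>q. f 1 + path_integral g q"] by blast
qed

lemma sobolev_pair_bounded:
  assumes "sobolev_pair f g"
  obtains C where "\<And>q. q \<in> comb_set \<Longrightarrow> norm (f q) \<le> C"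
proof
  fix q assume "q \<in> comb_set"
  from sobolev_pair_eq[OF assms this]
  show "norm (f q) \<le> norm (f 1) + (LINT z|M. norm (g z))"
    using path_integral_bound[OF sobolev_pair_integrable[OF assms], of q] norm_triangle_ineq[of "f 1" "path_integral g q"]
    by simp
qed

lemma sobolev_pair_mult_integrable:
  assumes "sobolev_pair f g" "sobolev_pair f' g'"
  shows "integrable M (\<lambda>z. f z * cnj (f' z))"
proof -
  obtain C C' where C: "\<And>q. q \<in> comb_set \<Longrightarrow> norm (f q) \<le> C" "\<And>q. q \<in> comb_set \<Longrightarrow> norm (f' q) \<le> C'"
    using sobolev_pair_bounded assms by metis
  have [measurable]: "f \<in> borel_measurable M" "f' \<in> borel_measurable M"
    using assms by (auto intro: sobolev_pair_measurable)
  have [measurable]: "cnj \<in> borel_measurable borel"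
    by (intro borel_measurable_continuous_onI continuous_intros)
  have "norm (f q * cnj (f' q)) \<le> C * C'" if "q \<in> comb_set" for q
    unfolding norm_mult complex_mod_cnj using C that norm_ge_zero[of "f q"]
    by (intro mult_mono) (auto intro: order_trans[OF norm_ge_zero])
  then show ?thesis by (intro integrable_const_bound[where B = "C * C'"]) auto
qed

lemma sobolev_pair_norm_sq_integrable:
  assumes "sobolev_pair f g"
  shows "integrable M (\<lambda>z. (norm (f z))\<^sup>2)"
  using sobolev_pair_mult_integrable[OF assms assms]
  by (simp add: complex_norm_square[symmetric] complex_of_real_integrable_eq del: of_real_power)

text \<open>Cutting the comb at \<open>k - 1\<close> points into pieces of length at most \<open>L = vol / k\<close>. Each tooth is
  cut at multiples of \<open>L\<close> from its tip, which leaves a stub shorter than \<open>L\<close>; the backbone is then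
  cut at the quantiles of the mass distribution given by its length and the stubs.\<close>

lemma comb_poincare_with_zeros:
  assumes k: "2 \<le> k" and omega: "0 < \<omega>" "\<omega> * (vol / real k) < pi / 2"
  obtains Z where "finite Z" "card Z < k" "Z \<subseteq> comb_set"
    "\<And>f g. sobolev_pair f g \<Longrightarrow> (\<And>z. z \<in> Z \<Longrightarrow> f z = 0) \<Longrightarrow>
      \<omega>\<^sup>2 * (LINT z|M. (norm (f z))\<^sup>2) \<le> (LINT z|M. (norm (g z))\<^sup>2)"
proof -
  define L where "L = vol / real k"
  have L: "0 < L" "real k * L = vol" using vol_gt_2 k by (auto simp: L_def)
  define \<phi> where "\<phi> n = foot (Suc n)" for n
  have phi: "0 < \<phi> n" "\<phi> n \<le> 1" for n using foot_bounds[of "Suc n"] by (auto simp: \<phi>_def)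
  have inj_phi: "inj \<phi>" using foot_inj by (auto simp: inj_def \<phi>_def)
  define j where "j n = nat \<lfloor>\<phi> n / L\<rfloor>" for n
  define r where "r n = \<phi> n - real (j n) * L" for n
  have rj: "real (j n) \<le> \<phi> n / L \<and> \<phi> n / L < real (j n) + 1" for n
  proof -
    have "0 \<le> \<lfloor>\<phi> n / L\<rfloor>" using phi[of n] L by simp
    then have "real (j n) = of_int \<lfloor>\<phi> n / L\<rfloor>" by (simp add: j_def)
    then show ?thesis by linarith
  qed
  have r: "0 \<le> r n" "r n < L" "r n \<le> \<phi> n" "\<phi> n = r n + real (j n) * L" for n
    using rj[of n] L by (auto simp: r_def field_simps)
  define D where "D = {n. j n \<noteq> 0}"
  have j0: "j n = 0" if "\<phi> n < L" for n
    using that L phi[of n] by (simp add: j_def)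
  have fin: "finite D"
  proof -
    have "\<phi> \<longlonglongrightarrow> 0"
      unfolding \<phi>_def[abs_def] by (rule LIMSEQ_Suc[OF foot_tendsto_0])
    then have "eventually (\<lambda>n. \<phi> n < L) sequentially" using L(1) by (rule order_tendstoD(2))
    then obtain N where "\<And>n. N \<le> n \<Longrightarrow> \<phi> n < L" by (auto simp: eventually_sequentially)
    then have "D \<subseteq> {..<N}" using j0 by (auto simp: D_def intro: ccontr)
    then show ?thesis using finite_subset by blast
  qed
  define J where "J = (\<Sum>n\<in>D. j n)"
  have phi_sums: "\<phi> sums (vol - 1)" using foot_sums by (simp add: \<phi>_def[abs_def])
  have "(\<lambda>n. real (j n) * L) sums (\<Sum>n\<in>D. real (j n) * L)"
    by (rule sums_finite[OF fin]) (auto simp: D_def)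
  then have r_sums: "r sums (vol - 1 - real J * L)"
    using sums_diff[OF phi_sums] by (simp add: r_def[abs_def] J_def sum_distrib_right)
  define F where "F x = x + (\<Sum>n. if \<phi> n \<le> x then r n else 0)" for x
  have summ: "summable (\<lambda>n. if P n then r n else 0)" for P
    using r by (intro summable_comparison_test'[OF sums_summable[OF r_sums], of 0]) auto
  have F_diff: "(y - x) + (\<Sum>n\<in>A. r n) \<le> F y - F x"
    if "finite A" "x \<le> y" "\<And>n. n \<in> A \<Longrightarrow> x < \<phi> n \<and> \<phi> n \<le> y" for x y A
  proof -
    have "F y - F x = (y - x) + ((\<Sum>n. if \<phi> n \<le> y then r n else 0) - (\<Sum>n. if \<phi> n \<le> x then r n else 0))"
      by (simp add: F_def)
    also have "(\<Sum>n. if \<phi> n \<le> y then r n else 0) - (\<Sum>n. if \<phi> n \<le> x then r n else 0)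
        = (\<Sum>n. (if \<phi> n \<le> y then r n else 0) - (if \<phi> n \<le> x then r n else 0))"
      by (rule suminf_diff[OF summ summ])
    also have "\<dots> = (\<Sum>n. if x < \<phi> n \<and> \<phi> n \<le> y then r n else 0)"
      using \<open>x \<le> y\<close> by (intro suminf_cong) auto
    finally have "F y - F x = (y - x) + (\<Sum>n. if x < \<phi> n \<and> \<phi> n \<le> y then r n else 0)" .
    moreover have "(\<Sum>n\<in>A. if x < \<phi> n \<and> \<phi> n \<le> y then r n else 0)
        \<le> (\<Sum>n. if x < \<phi> n \<and> \<phi> n \<le> y then r n else 0)"
      using that(1) r by (intro sum_le_suminf summ) auto
    moreover have "(\<Sum>n\<in>A. if x < \<phi> n \<and> \<phi> n \<le> y then r n else 0) = (\<Sum>n\<in>A. r n)"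
      using that(3) by (intro sum.cong) auto
    ultimately show ?thesis by simp
  qed
  have F_mono: "F x \<le> F y" if "x \<le> y" for x y
    using F_diff[of "{}" x y] that by simp
  have "\<not> \<phi> n \<le> 0" for n using phi(1)[of n] by simp
  then have F_0: "F 0 = 0" by (simp add: F_def)
  have F_1: "F 1 = (real k - real J) * L"
    using phi r_sums L by (simp add: F_def sums_iff algebra_simps)
  \<comment> \<open>The teeth do not use up all the cuts, so that the backbone contains a zero to start from: if
    \<open>L \<le> 1\<close>, the backbone with the second stub is heavier than \<open>L\<close>, and if \<open>1 < L\<close>, no tooth is cut.\<close>
  have "L < F 1"
  proof (cases "L \<le> 1")
    case True
    have "1 + r 1 \<le> F 1"
      using F_diff[of "{1}" 0 1] phi[of 1] F_0 by simp
    moreover have "0 < r 1" if "L = 1"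
    proof -
      have "\<phi> 1 < 1" using foot_less[of 1 2] by (simp add: \<phi>_def numeral_2_eq_2)
      then show ?thesis using j0[of 1] that phi[of 1] by (simp add: r_def)
    qed
    ultimately show ?thesis using True r(1)[of 1] by fastforce
  next
    case False
    then have "\<phi> n < L" for n using phi(2)[of n] by simp
    then have "J = 0" using j0 by (simp add: J_def D_def)
    moreover have "1 * L < real k * L" using L k by (intro mult_strict_right_mono) auto
    ultimately show ?thesis using F_1 by simp
  qed
  then have "1 * L < (real k - real J) * L" by (simp only: F_1 mult_1)
  then have "1 < real k - real J" using L(1) by (simp only: mult_less_cancel_right_pos)
  define K where "K = k - J"
  have K: "2 \<le> K" "K + J = k" "F 1 = real K * L"
    using \<open>1 < real k - real J\<close> F_1 by (auto simp: K_def of_nat_diff)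
  define c where "c i = Inf {x \<in> {0..1}. real i * L \<le> F x}" for i :: nat
  have c_bdd: "bdd_below {x \<in> {0..1}. real i * L \<le> F x}" for i :: nat
    by (rule bdd_belowI[of _ 0]) auto
  have c_ne: "1 \<in> {x \<in> {0..1}. real i * L \<le> F x}" if "i \<le> K" for i
    using that K(3) L by (auto intro!: mult_right_mono)
  have c01: "c i \<in> {0..1}" if "i \<le> K" for i
  proof -
    have "c i \<le> 1" unfolding c_def by (rule cInf_lower[OF c_ne[OF that] c_bdd])
    moreover have "0 \<le> c i"
      unfolding c_def by (rule cInf_greatest) (use c_ne[OF that] in blast, simp)
    ultimately show ?thesis by simp
  qed
  have c_above: "real i * L \<le> F x" if "i \<le> K" "c i < x" for i x
  proof -
    have "{x \<in> {0..1}. real i * L \<le> F x} \<noteq> {}" using c_ne[OF that(1)] by blast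
    from cInf_lessD[OF this that(2)[unfolded c_def]]
    obtain y where y: "y \<in> {x \<in> {0..1}. real i * L \<le> F x}" "y < x" by blast
    then have "real i * L \<le> F y" by blast
    also have "F y \<le> F x" using y(2) by (intro F_mono) simp
    finally show ?thesis .
  qed
  have c_below: "F x < real i * L" if "i \<le> K" "0 \<le> x" "x < c i" for i x
  proof (rule ccontr)
    assume "\<not> ?thesis"
    then have "x \<in> {x \<in> {0..1}. real i * L \<le> F x}" using that c01[OF that(1)] by simp
    from cInf_lower[OF this c_bdd] have "c i \<le> x" unfolding c_def .
    then show False using that(3) by simp
  qed
  have c_mono: "c i \<le> c (Suc i)" if "Suc i \<le> K" for i
  proof (rule ccontr)
    assume "\<not> ?thesis"
    then obtain x where x: "c (Suc i) < x" "x < c i" using dense not_le by blast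
    then have "real (Suc i) * L < real i * L"
      using c_above[OF that, of x] c_below[of i x] c01[OF that] that by auto
    then show False using L by (simp add: algebra_simps)
  qed
  \<comment> \<open>The bounds on \<open>F\<close> at interior points give bounds on the mass between two quantiles; the mass
    of a stub whose foot is a quantile belongs to neither side, as the function vanishes there.\<close>
  have mass_closed: "(q - p) + (\<Sum>n\<in>A. r n) \<le> L"
    if "finite A" "p < q" "\<And>n. n \<in> A \<Longrightarrow> p < \<phi> n \<and> \<phi> n \<le> q"
      "\<And>y. p < y \<Longrightarrow> y < q \<Longrightarrow> F q - F y \<le> L" for p q A
  proof -
    have "\<forall>\<^sub>F y in at_right p. (\<forall>n\<in>A. y < \<phi> n) \<and> y < q \<and> p < y"
      using that(1-3) by (intro eventually_conj eventually_ball_finite)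
        (auto intro!: eventually_at_right_less order_tendstoD(2)[OF tendsto_ident_at])
    then have "\<forall>\<^sub>F y in at_right p. (q - y) + (\<Sum>n\<in>A. r n) \<le> L"
    proof eventually_elim
      case (elim y)
      then show ?case using F_diff[OF that(1), of y q] that(3,4) by fastforce
    qed
    then show ?thesis
      by (intro tendsto_upperbound[of "\<lambda>y. (q - y) + (\<Sum>n\<in>A. r n)" _ "at_right p"])
        (auto intro!: tendsto_intros)
  qed
  have mass_open: "(q - p) + (\<Sum>n\<in>A. r n) \<le> L"
    if "finite A" "p < q" "\<And>n. n \<in> A \<Longrightarrow> p < \<phi> n \<and> \<phi> n < q"
      "\<And>y z. p < y \<Longrightarrow> y < z \<Longrightarrow> z < q \<Longrightarrow> F z - F y \<le> L" for p q A
  proof -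
    have "\<forall>\<^sub>F z in at_left q. z < q" by (simp add: eventually_at_filter)
    then have "\<forall>\<^sub>F z in at_left q. (\<forall>n\<in>A. \<phi> n < z) \<and> p < z \<and> z < q"
      using that(1-3) by (intro eventually_conj eventually_ball_finite)
        (auto intro!: order_tendstoD(1)[OF tendsto_ident_at])
    then have "\<forall>\<^sub>F z in at_left q. (z - p) + (\<Sum>n\<in>A. r n) \<le> L"
    proof eventually_elim
      case (elim z)
      show ?case by (rule mass_closed) (use elim that in \<open>auto simp: less_imp_le\<close>)
    qed
    then show ?thesis
      by (intro tendsto_upperbound[of "\<lambda>z. (z - p) + (\<Sum>n\<in>A. r n)" _ "at_left q"])
        (auto intro!: tendsto_intros)
  qed
  define Z where "Z = (\<lambda>(n, i). 2 * real (Suc n) + r n + real i * L) ` (SIGMA n:D. {..<j n}) \<union> c ` {1..<K}"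
  have finZ: "finite Z" using fin by (auto simp: Z_def)
  have "card Z \<le> card (SIGMA n:D. {..<j n}) + card {1..<K}"
    unfolding Z_def using fin
    by (intro order_trans[OF card_Un_le] add_mono card_image_le) auto
  also have "\<dots> < k" using fin K by (simp add: J_def)
  finally have cardZ: "card Z < k" .
  have Zsub: "Z \<subseteq> comb_set"
  proof
    fix z assume "z \<in> Z"
    then consider n i where "n \<in> D" "i < j n" "z = 2 * real (Suc n) + r n + real i * L"
      | i where "i \<in> {1..<K}" "z = c i" by (auto simp: Z_def)
    then show "z \<in> comb_set"
    proof cases
      case 1
      have "real i * L \<le> real (j n) * L" using 1 L by (intro mult_right_mono) auto
      then have "z \<in> tooth (Suc n)" using 1 r[of n] L by (auto simp: tooth_def \<phi>_def[symmetric])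
      then show ?thesis using tooth_subset[of "Suc n"] by auto
    next
      case 2
      then show ?thesis using c01[of i] backbone_subset by auto
    qed
  qed
  have main: "\<omega>\<^sup>2 * (LINT z|M. (norm (f z))\<^sup>2) \<le> (LINT z|M. (norm (g z))\<^sup>2)"
    if fg: "sobolev_pair f g" and f0: "\<And>z. z \<in> Z \<Longrightarrow> f z = 0" for f g
  proof -
    define \<tau> where "\<tau> n = \<omega> * tan (\<omega> * r n) * (norm (f (\<phi> n)))\<^sup>2" for n
    have omL: "\<omega> * L < pi / 2" using omega by (simp add: L_def)
    have g2M: "integrable M (\<lambda>z. (norm (g z))\<^sup>2)" using fg by (simp add: sobolev_pair_def)
    note f2M = sobolev_pair_norm_sq_integrable[OF fg]
    note bb = sobolev_pair_backbone[OF fg]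
    have int01: "set_integrable lebesgue {p..q} (\<lambda>z. (norm (g z))\<^sup>2)"
        "set_integrable lebesgue {p..q} (\<lambda>z. (norm (f z))\<^sup>2)" if "0 \<le> p" "q \<le> 1" for p q
      using that backbone_subset
      by (auto intro!: integrable_M_subset[OF g2M] integrable_M_subset[OF f2M])
    have tooth_ineq: "\<omega>\<^sup>2 * sq_integral (tooth (Suc n)) f
        \<le> sq_integral (tooth (Suc n)) g + \<tau> n" for n
    proof -
      have "f (2 * real (Suc n) + r n + real i * L) = 0" if "i < j n" for i
      proof (rule f0)
        have "n \<in> D" using that by (auto simp: D_def)
        then show "2 * real (Suc n) + r n + real i * L \<in> Z"
          using that unfolding Z_def by force
      qed
      moreover have "set_integrable lebesgue (tooth (Suc n)) (\<lambda>z. (norm (g z))\<^sup>2)"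
        by (rule integrable_M_subset[OF g2M tooth_subset tooth_sets]) simp
      ultimately have "\<omega>\<^sup>2 * sq_integral (tooth (Suc n)) f
        \<le> sq_integral (tooth (Suc n)) g
          + \<omega> * tan (\<omega> * r n) * (norm (f (2 * real (Suc n))))\<^sup>2"
        unfolding tooth_def using sobolev_pair_tooth[OF fg, of "Suc n"] r[of n] omL omega
        by (intro poincare_edge_with_zeros[where j = "j n" and L = L]) (auto simp: \<phi>_def)
      then show ?thesis using sobolev_pair_glue[OF fg, of "Suc n"] by (simp add: \<tau>_def \<phi>_def)
    qed
    have inv: "inv \<phi> (\<phi> n) = n" for n using inj_phi by (rule inv_f_f)
    have reindex: "(\<Sum>s\<in>\<phi> ` A. h s) = (\<Sum>n\<in>A. h (\<phi> n))" for A and h :: "real \<Rightarrow> real"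
      using inj_phi by (subst sum.reindex) (auto simp: inj_on_def inj_def)
    have seg: "(\<Sum>n\<in>A. \<tau> n) + \<omega>\<^sup>2 * sq_integral {p..q} f
        \<le> sq_integral {p..q} g"
      if "finite A" "0 \<le> p" "p \<le> q" "q \<le> 1" "\<And>n. n \<in> A \<Longrightarrow> p < \<phi> n \<and> \<phi> n \<le> q"
        "(q - p) + (\<Sum>n\<in>A. r n) \<le> L" "f p = 0 \<or> f q = 0" for A p q
    proof -
      have "\<omega> * ((q - p) + (\<Sum>n\<in>A. r n)) \<le> \<omega> * L"
        using that omega by (intro mult_left_mono) auto
      then have small: "\<omega> * ((q - p) + (\<Sum>s\<in>\<phi> ` A. r (inv \<phi> s))) < pi / 2"
        using omL by (simp add: reindex inv)
      have prim: "primitive_on p q f g" by (rule primitive_on_subinterval[OF bb that(2,4)])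
      have T: "finite (\<phi> ` A)" "\<phi> ` A \<subseteq> {p..q}" using that(1,5) by (auto simp: less_imp_le)
      have "(\<Sum>s\<in>\<phi> ` A. \<omega> * tan (\<omega> * r (inv \<phi> s)) * (norm (f s))\<^sup>2)
          + \<omega>\<^sup>2 * sq_integral {p..q} f
        \<le> sq_integral {p..q} g"
        using that(7)
      proof
        assume "f q = 0"
        from poincare_segment_point_masses_zero_right[OF T that(3) prim this int01(1)[OF that(2,4)]
            omega(1) r(1) small]
        show ?thesis .
      next
        assume "f p = 0"
        from poincare_segment_point_masses_zero_left[OF T that(3) prim this int01(1)[OF that(2,4)]
            omega(1) r(1) small]
        show ?thesis .
      qed
      then show ?thesis by (simp add: reindex inv \<tau>_def)
    qed
    have fc: "f (c i) = 0" if "1 \<le> i" "i < K" for i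
      using that by (intro f0) (auto simp: Z_def)
    \<comment> \<open>Up to the last quantile the pieces of the backbone have a zero at their right end; the remaining
      piece has one at its left end.\<close>
    have partial: "(\<Sum>n | n < N \<and> \<phi> n < c i. \<tau> n) + \<omega>\<^sup>2 * sq_integral {0..c i} f
        \<le> sq_integral {0..c i} g" if "1 \<le> i" "i < K" for i N
      using that
    proof (induction i rule: dec_induct)
      case base
      have "(c 1 - 0) + (\<Sum>n | n < N \<and> \<phi> n < c 1. r n) \<le> L"
      proof (cases "c 1 = 0")
        case True
        have none: "{n. n < N \<and> \<phi> n < c 1} = {}" using phi True by (auto simp: not_less less_imp_le)
        show ?thesis unfolding none using True L by simp
      next
        case False
        show ?thesis
        proof (rule mass_open)
          fix y z assume "0 < y" "y < z" "z < c 1"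
          then show "F z - F y \<le> L" using c_below[of 1 z] F_mono[of 0 y] F_0 K by simp
        qed (use phi False c01[of 1] K in auto)
      qed
      then show ?case
        using phi fc[of 1] K c01[of 1] by (intro seg) (auto simp: less_imp_le)
    next
      case (step i)
      have i: "Suc i \<le> K" "i \<le> K" using step by auto
      note c = c01[OF i(1)] c01[OF i(2)] c_mono[OF i(1)]
      define A where "A = {n. n < N \<and> c i < \<phi> n \<and> \<phi> n < c (Suc i)}"
      have "(c (Suc i) - c i) + (\<Sum>n\<in>A. r n) \<le> L"
      proof (cases "c i = c (Suc i)")
        case True
        then have "A = {}" by (auto simp: A_def)
        then show ?thesis using True L by simp
      next
        case False
        show ?thesis
        proof (rule mass_open)
          fix y z assume "c i < y" "y < z" "z < c (Suc i)"
          then show "F z - F y \<le> L"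
            using c_below[OF i(1), of z] c_above[OF i(2), of y] c by (simp add: algebra_simps)
        qed (use False c in \<open>auto simp: A_def\<close>)
      qed
      then have "(\<Sum>n\<in>A. \<tau> n) + \<omega>\<^sup>2 * sq_integral {c i..c (Suc i)} f
          \<le> sq_integral {c i..c (Suc i)} g"
        using fc[of "Suc i"] step c by (intro seg) (auto simp: A_def less_imp_le)
      moreover have "(\<Sum>n | n < N \<and> \<phi> n < c i. \<tau> n) + \<omega>\<^sup>2 * sq_integral {0..c i} f
          \<le> sq_integral {0..c i} g"
        using step by auto
      moreover have "(\<Sum>n | n < N \<and> \<phi> n < c (Suc i). \<tau> n) = (\<Sum>n | n < N \<and> \<phi> n < c i. \<tau> n) + (\<Sum>n\<in>A. \<tau> n)"
      proof -
        have "(\<Sum>n | n < N \<and> \<phi> n < c i. \<tau> n) + (\<Sum>n\<in>A. \<tau> n) = (\<Sum>n\<in>{n. n < N \<and> \<phi> n < c i} \<union> A. \<tau> n)"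
          by (rule sum.union_disjoint[symmetric]) (auto simp: A_def)
        also have "\<dots> = (\<Sum>n | n < N \<and> \<phi> n < c (Suc i). \<tau> n)"
        proof (rule sum.mono_neutral_left)
          show "\<forall>n\<in>{n. n < N \<and> \<phi> n < c (Suc i)} - ({n. n < N \<and> \<phi> n < c i} \<union> A). \<tau> n = 0"
          proof
            fix n assume "n \<in> {n. n < N \<and> \<phi> n < c (Suc i)} - ({n. n < N \<and> \<phi> n < c i} \<union> A)"
            then have "\<phi> n = c i" by (auto simp: A_def)
            then show "\<tau> n = 0" using fc[of i] step by (simp add: \<tau>_def)
          qed
        qed (use c in \<open>auto simp: A_def\<close>)
        finally show ?thesis by simp
      qed
      moreover have "sq_integral {0..c (Suc i)} h
          = sq_integral {0..c i} h + sq_integral {c i..c (Suc i)} h"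
        if "h = f \<or> h = g" for h
        using c int01[of 0 "c (Suc i)"] that by (intro set_integral_Icc_combine) auto
      ultimately show ?case by (simp add: algebra_simps)
    qed
    have backbone_ineq: "(\<Sum>n<N. \<tau> n) + \<omega>\<^sup>2 * sq_integral {0..1} f
        \<le> sq_integral {0..1} g" for N
    proof -
      define i where "i = K - 1"
      have i: "1 \<le> i" "i < K" "Suc i = K" using K by (auto simp: i_def)
      note c = c01[OF less_imp_le[OF i(2)]]
      define A where "A = {n. n < N \<and> c i < \<phi> n}"
      have "(1 - c i) + (\<Sum>n\<in>A. r n) \<le> L"
      proof (cases "c i = 1")
        case True
        then have "A = {}" using phi by (auto simp: A_def not_less)
        then show ?thesis using True L by simp
      next
        case False
        show ?thesis
        proof (rule mass_closed)
          fix y assume y: "c i < y" "y < 1"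
          have "real K = real i + 1" unfolding i(3)[symmetric] by simp
          then have "F 1 = real i * L + L" by (simp add: K(3) distrib_right)
          then show "F 1 - F y \<le> L"
            using c_above[OF less_imp_le[OF i(2)] y(1)] by simp
        qed (use False c phi in \<open>auto simp: A_def\<close>)
      qed
      then have "(\<Sum>n\<in>A. \<tau> n) + \<omega>\<^sup>2 * sq_integral {c i..1} f
          \<le> sq_integral {c i..1} g"
        using fc[OF i(1,2)] c phi by (intro seg) (auto simp: A_def)
      moreover note partial[OF i(1,2), of N]
      moreover have "(\<Sum>n<N. \<tau> n) = (\<Sum>n | n < N \<and> \<phi> n < c i. \<tau> n) + (\<Sum>n\<in>A. \<tau> n)"
      proof -
        have "(\<Sum>n | n < N \<and> \<phi> n < c i. \<tau> n) + (\<Sum>n\<in>A. \<tau> n) = (\<Sum>n\<in>{n. n < N \<and> \<phi> n < c i} \<union> A. \<tau> n)"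
          by (rule sum.union_disjoint[symmetric]) (auto simp: A_def)
        also have "\<dots> = (\<Sum>n<N. \<tau> n)"
        proof (rule sum.mono_neutral_left)
          show "\<forall>n\<in>{..<N} - ({n. n < N \<and> \<phi> n < c i} \<union> A). \<tau> n = 0"
          proof
            fix n assume "n \<in> {..<N} - ({n. n < N \<and> \<phi> n < c i} \<union> A)"
            then have "\<phi> n = c i" by (auto simp: A_def)
            then show "\<tau> n = 0" using fc[OF i(1,2)] by (simp add: \<tau>_def)
          qed
        qed (auto simp: A_def)
        finally show ?thesis by simp
      qed
      moreover have "sq_integral {0..1} h
          = sq_integral {0..c i} h + sq_integral {c i..1} h"
        if "h = f \<or> h = g" for h
        using c int01[of 0 1] that by (intro set_integral_Icc_combine) auto
      ultimately show ?thesis by (simp add: algebra_simps)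
    qed
    let ?I = "\<lambda>h N. sq_integral {0..1} h
        + (\<Sum>n<N. LINT x:tooth (Suc n)|lebesgue. (norm (h x :: complex))\<^sup>2)"
    have lim: "?I h \<longlonglongrightarrow> (LINT z|M. (norm (h z))\<^sup>2)" if "integrable M (\<lambda>z. (norm (h z))\<^sup>2)" for h :: "real \<Rightarrow> complex"
      using tendsto_add[OF tendsto_const integral_M_sums[OF that, unfolded sums_def], of "LINT x:{0..1}|lebesgue. (norm (h x))\<^sup>2"]
      by simp
    \<comment> \<open>The costs \<open>\<tau> n\<close> of the stubs cancel between the teeth and the backbone.\<close>
    have "\<omega>\<^sup>2 * ?I f N \<le> ?I g N" for N
    proof -
      have "\<omega>\<^sup>2 * (\<Sum>n<N. LINT x:tooth (Suc n)|lebesgue. (norm (f x))\<^sup>2)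
          \<le> (\<Sum>n<N. LINT x:tooth (Suc n)|lebesgue. (norm (g x))\<^sup>2) + (\<Sum>n<N. \<tau> n)"
        unfolding sum_distrib_left sum.distrib[symmetric] by (intro sum_mono tooth_ineq)
      then show ?thesis using backbone_ineq[of N] by (simp add: distrib_left)
    qed
    then show ?thesis
      by (intro LIMSEQ_le[OF tendsto_mult_left[OF lim[OF f2M]] lim[OF g2M]]) auto
  qed
  show thesis by (rule that[OF finZ cardZ Zsub main])
qed

end

section \<open>The Green operator\<close>

context comb_model
begin

text \<open>The equation \<open>- u'' = v\<close> with Neumann conditions is solvable if and only if \<open>v\<close> has mean zero, and then
  uniquely up to a constant. Bounded measurable functions are a domain that the solution operator maps
  to itself.\<close>

definition mean_zero_fns :: "(real \<Rightarrow> real) set" where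
  "mean_zero_fns = {v. v \<in> borel_measurable M \<and> (\<exists>C. \<forall>q\<in>comb_set. \<bar>v q\<bar> \<le> C) \<and> (LINT q|M. v q) = 0}"

definition ip :: "(real \<Rightarrow> real) \<Rightarrow> (real \<Rightarrow> real) \<Rightarrow> real" where
  "ip v w = (LINT q|M. v q * w q)"

text \<open>The solution operator, normalized to mean zero.\<close>

definition green :: "(real \<Rightarrow> real) \<Rightarrow> real \<Rightarrow> real" where
  "green v q = path_integral (flux v) q - (LINT p|M. path_integral (flux v) p) / vol"

lemma bounded_integrable:
  fixes v :: "real \<Rightarrow> real"
  assumes "v \<in> borel_measurable M" "\<And>q. q \<in> comb_set \<Longrightarrow> \<bar>v q\<bar> \<le> C"
  shows "integrable M v"
  by (rule integrable_const_bound[where B = C]) (use assms in auto)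

lemma mean_zero_fns_mult_integrable:
  assumes "v \<in> mean_zero_fns" "w \<in> mean_zero_fns"
  shows "integrable M (\<lambda>q. v q * w q)"
proof -
  obtain C D where C: "\<And>q. q \<in> comb_set \<Longrightarrow> \<bar>v q\<bar> \<le> C" "\<And>q. q \<in> comb_set \<Longrightarrow> \<bar>w q\<bar> \<le> D"
    using assms unfolding mean_zero_fns_def by auto
  have "\<bar>v q * w q\<bar> \<le> C * D" if "q \<in> comb_set" for q
    unfolding abs_mult using C that abs_ge_zero[of "v q"] abs_ge_zero[of "w q"]
    by (intro mult_mono) (auto intro: order_trans[OF abs_ge_zero])
  then show ?thesis
    by (intro bounded_integrable) (use assms in \<open>auto simp: mean_zero_fns_def\<close>)
qed

lemma mean_zero_fns_integrable: "v \<in> mean_zero_fns \<Longrightarrow> integrable M v"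
  unfolding mean_zero_fns_def by (auto intro: bounded_integrable)

lemma vol_pos: "0 < vol" using vol_gt_2 by simp

lemma measure_comb [simp]: "measure M comb_set = vol"
  using measure_M by simp

lemma integral_const_M: "(LINT q|M. (c::real)) = vol * c"
  by simp

lemma l1_le_l2:
  assumes v: "v \<in> mean_zero_fns"
  shows "(LINT q|M. \<bar>v q\<bar>)\<^sup>2 \<le> vol * ip v v"
proof -
  define m where "m = (LINT q|M. \<bar>v q\<bar>) / vol"
  have int: "integrable M (\<lambda>q. \<bar>v q\<bar>)" "integrable M (\<lambda>q. v q * v q)"
    using mean_zero_fns_integrable[OF v] mean_zero_fns_mult_integrable[OF v v] by auto
  have "0 \<le> (LINT q|M. (\<bar>v q\<bar> - m)\<^sup>2)" by simp
  also have "(\<lambda>q. (\<bar>v q\<bar> - m)\<^sup>2) = (\<lambda>q. v q * v q - 2 * m * \<bar>v q\<bar> + m\<^sup>2)"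
    by (auto simp: power2_eq_square algebra_simps)
  also have "(LINT q|M. v q * v q - 2 * m * \<bar>v q\<bar> + m\<^sup>2) = ip v v - 2 * m * (LINT q|M. \<bar>v q\<bar>) + vol * m\<^sup>2"
    using int by (simp add: ip_def integral_const_M)
  finally show ?thesis
    using vol_pos by (simp add: m_def power2_eq_square field_simps)
qed

lemma flux_real:
  fixes v :: "real \<Rightarrow> real"
  assumes "integrable M v"
  shows "flux v \<in> borel_measurable M" "\<bar>flux v z\<bar> \<le> (LINT q|M. \<bar>v q\<bar>)" "integrable M (flux v)"
proof -
  show 1: "flux v \<in> borel_measurable M" using assms by (intro flux_measurable) auto
  show 2: "\<bar>flux v z\<bar> \<le> (LINT q|M. \<bar>v q\<bar>)" for z using flux_bound[OF assms, of z] by simp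
  show "integrable M (flux v)" by (rule bounded_integrable[OF 1 2])
qed

lemma kernel_integral_linear:
  fixes u v k :: "real \<Rightarrow> real"
  assumes "integrable M u" "integrable M v" "k \<in> borel_measurable M" "\<And>q. \<bar>k q\<bar> \<le> 1"
  shows "(LINT q|M. k q *\<^sub>R (a * u q + b * v q)) = a * (LINT q|M. k q *\<^sub>R u q) + b * (LINT q|M. k q *\<^sub>R v q)"
proof -
  have "(LINT q|M. k q *\<^sub>R (a * u q + b * v q)) = (LINT q|M. a * (k q *\<^sub>R u q) + b * (k q *\<^sub>R v q))"
    by (intro Bochner_Integration.integral_cong) (auto simp: algebra_simps)
  also have "\<dots> = a * (LINT q|M. k q *\<^sub>R u q) + b * (LINT q|M. k q *\<^sub>R v q)"
    using kernel_integral_bound(2)[OF assms(1,3,4)] kernel_integral_bound(2)[OF assms(2-4)]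
    by (subst Bochner_Integration.integral_add) auto
  finally show ?thesis .
qed

lemma flux_linear:
  fixes u v :: "real \<Rightarrow> real"
  shows "integrable M u \<Longrightarrow> integrable M v \<Longrightarrow> flux (\<lambda>q. a * u q + b * v q) = (\<lambda>z. a * flux u z + b * flux v z)"
  unfolding flux_def by (intro ext kernel_integral_linear incidence_measurable_snd incidence_bound)

lemma path_integral_linear:
  fixes u v :: "real \<Rightarrow> real"
  shows "integrable M u \<Longrightarrow> integrable M v \<Longrightarrow>
    path_integral (\<lambda>q. a * u q + b * v q) = (\<lambda>z. a * path_integral u z + b * path_integral v z)"
  unfolding path_integral_def by (intro ext kernel_integral_linear incidence_measurable_fst incidence_bound)

lemma path_integral_integrable:
  fixes g :: "real \<Rightarrow> real"
  assumes "integrable M g"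
  shows "integrable M (path_integral g)"
  using path_integral_bound[OF assms] assms
  by (intro bounded_integrable[where C = "LINT z|M. norm (g z)"] path_integral_measurable) auto

lemma green_mean_zero:
  assumes "v \<in> mean_zero_fns"
  shows "green v \<in> mean_zero_fns"
proof -
  note F = flux_real[OF mean_zero_fns_integrable[OF assms]]
  have meas: "green v \<in> borel_measurable M"
    unfolding green_def by (intro borel_measurable_diff path_integral_measurable F(1)) auto
  have "\<bar>green v q\<bar> \<le> (LINT z|M. norm (flux v z)) + \<bar>(LINT p|M. path_integral (flux v) p) / vol\<bar>" for q
    unfolding green_def
    by (intro order_trans[OF abs_triangle_ineq4] add_right_mono
        path_integral_bound[OF F(3), of q, unfolded real_norm_def[of "path_integral (flux v) q"]])
  moreover have "(LINT q|M. green v q) = 0"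
    unfolding green_def using path_integral_integrable[OF F(3)] vol_pos
    by (subst Bochner_Integration.integral_diff) (auto simp: integral_const_M)
  ultimately show ?thesis using meas unfolding mean_zero_fns_def by blast
qed

lemma green_linear:
  assumes "u \<in> mean_zero_fns" "v \<in> mean_zero_fns"
  shows "green (\<lambda>q. a * u q + b * v q) = (\<lambda>q. a * green u q + b * green v q)"
proof -
  note F = flux_real(3)[OF mean_zero_fns_integrable[OF assms(1)]] flux_real(3)[OF mean_zero_fns_integrable[OF assms(2)]]
  show ?thesis
    unfolding green_def flux_linear[OF mean_zero_fns_integrable[OF assms(1)] mean_zero_fns_integrable[OF assms(2)]]
      path_integral_linear[OF F]
    using path_integral_integrable[OF F(1)] path_integral_integrable[OF F(2)]
    by (intro ext) (simp add: algebra_simps add_divide_distrib diff_divide_distrib)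
qed

text \<open>The operator is the product of the flux operator with its transpose, hence symmetric and
  nonnegative.\<close>

lemma ip_green:
  assumes "v \<in> mean_zero_fns" "w \<in> mean_zero_fns"
  shows "ip v (green w) = (LINT z|M. flux v z * flux w z)"
proof -
  note F = flux_real(3)[OF mean_zero_fns_integrable[OF assms(2)]]
  note G = integral_flux_mult[OF mean_zero_fns_integrable[OF assms(1)] F]
  define c where "c = (LINT p|M. path_integral (flux w) p) / vol"
  have "ip v (green w) = (LINT q|M. v q * path_integral (flux w) q - v q * c)"
    by (simp add: ip_def green_def c_def right_diff_distrib)
  also have "\<dots> = (LINT q|M. v q * path_integral (flux w) q) - (LINT q|M. v q) * c"
    using G(3) mean_zero_fns_integrable[OF assms(1)] by simp
  finally show ?thesis using G(1) assms(1) by (simp add: mean_zero_fns_def)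
qed

lemma ip_commute: "ip v w = ip w v"
  by (simp add: ip_def mult.commute)

lemma ip_linear:
  assumes "u \<in> mean_zero_fns" "v \<in> mean_zero_fns" "w \<in> mean_zero_fns"
  shows "ip (\<lambda>q. a * u q + b * v q) w = a * ip u w + b * ip v w"
proof -
  have "ip (\<lambda>q. a * u q + b * v q) w = (LINT q|M. a * (u q * w q) + b * (v q * w q))"
    by (simp add: ip_def algebra_simps)
  then show ?thesis
    using assms by (simp add: ip_def mean_zero_fns_mult_integrable)
qed

lemma mean_zero_fns_linear:
  assumes "v \<in> mean_zero_fns" "w \<in> mean_zero_fns"
  shows "(\<lambda>q. a * v q + b * w q) \<in> mean_zero_fns"
proof -
  obtain C D where C: "\<And>q. q \<in> comb_set \<Longrightarrow> \<bar>v q\<bar> \<le> C" "\<And>q. q \<in> comb_set \<Longrightarrow> \<bar>w q\<bar> \<le> D"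
    using assms unfolding mean_zero_fns_def by auto
  have "\<bar>a * v q + b * w q\<bar> \<le> \<bar>a\<bar> * C + \<bar>b\<bar> * D" if "q \<in> comb_set" for q
    using C[OF that] abs_triangle_ineq[of "a * v q" "b * w q"] mult_left_mono[OF C(1)[OF that], of "\<bar>a\<bar>"]
      mult_left_mono[OF C(2)[OF that], of "\<bar>b\<bar>"] by (simp add: abs_mult)
  moreover have "(LINT q|M. a * v q + b * w q) = 0"
    using assms mean_zero_fns_integrable[OF assms(1)] mean_zero_fns_integrable[OF assms(2)]
    by (simp add: mean_zero_fns_def)
  ultimately show ?thesis
    using assms unfolding mean_zero_fns_def by auto
qed

lemma green_form_bound:
  assumes v: "v \<in> mean_zero_fns"
  shows "ip (green v) v \<le> vol\<^sup>2 * ip v v"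
proof -
  note F = flux_real[OF mean_zero_fns_integrable[OF v]]
  have "ip (green v) v = (LINT z|M. flux v z * flux v z)"
    using ip_green[OF v v] by (simp add: ip_commute)
  also have "\<dots> \<le> (LINT z|M. vol * ip v v)"
  proof (rule integral_mono')
    fix z
    have "flux v z * flux v z = \<bar>flux v z\<bar>\<^sup>2" by (simp add: power2_eq_square)
    also have "\<dots> \<le> (LINT q|M. \<bar>v q\<bar>)\<^sup>2" using F(2)[of z] by (intro power_mono) auto
    finally show "flux v z * flux v z \<le> vol * ip v v" using l1_le_l2[OF v] by simp
    show "0 \<le> vol * ip v v" using l1_le_l2[OF v] zero_le_power2 by (rule order_trans[rotated])
  qed auto
  finally show ?thesis by (simp add: integral_const_M power2_eq_square)
qed

text \<open>A bounded flux integrates to a Lipschitz function on every piece of the line. This is what makes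
  the operator compact and its values continuous on the graph.\<close>

lemma path_integral_lipschitz:
  fixes g :: "real \<Rightarrow> 'b::{banach, second_countable_topology}"
  assumes g: "g \<in> borel_measurable M" "\<And>z. z \<in> comb_set \<Longrightarrow> norm (g z) \<le> C"
    and q: "q \<in> {0..1} \<and> q' \<in> {0..1} \<or> (1 \<le> n \<and> q \<in> tooth n \<and> q' \<in> tooth n)"
  shows "norm (path_integral g q - path_integral g q') \<le> C * \<bar>q - q'\<bar>"
proof -
  have int: "integrable M g" by (rule integrable_const_bound[where B = C]) (use g in auto)
  have *: "norm (path_integral g q' - path_integral g q) \<le> C * (q' - q)"
    if q: "q \<in> {0..1} \<and> q' \<in> {0..1} \<or> (1 \<le> n \<and> q \<in> tooth n \<and> q' \<in> tooth n)" and le: "q \<le> q'" for q q'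
  proof -
    have sub: "{q..q'} \<subseteq> comb_set"
    proof (cases "q \<in> {0..1} \<and> q' \<in> {0..1}")
      case True
      then show ?thesis using backbone_subset by auto
    next
      case False
      then have "{q..q'} \<subseteq> tooth n" using q by (auto simp: tooth_def)
      then show ?thesis using False q tooth_subset[of n] by blast
    qed
    have intq: "set_integrable lebesgue {q..q'} g" by (rule integrable_M_subset[OF int sub]) simp
    have "path_integral g q' - path_integral g q = (LINT z:{q..q'}|lebesgue. g z)"
      using q
    proof
      assume "q \<in> {0..1} \<and> q' \<in> {0..1}"
      then have h: "q \<in> {0..1}" "q' \<in> {0..1}" "q' \<le> 1" by auto
      have "set_integrable lebesgue {q..1} g"
        by (rule integrable_M_subset[OF int]) (use h backbone_subset in auto)
      from set_integral_Icc_combine[OF le h(3) this] show ?thesis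
        by (simp add: path_integral_backbone[OF h(1)] path_integral_backbone[OF h(2)])
    next
      assume h: "1 \<le> n \<and> q \<in> tooth n \<and> q' \<in> tooth n"
      then have h': "2 * real n \<le> q" "{2 * real n..q'} \<subseteq> tooth n" by (auto simp: tooth_def)
      have "set_integrable lebesgue {2 * real n..q'} g"
        by (rule integrable_M_subset[OF int]) (use h h' tooth_subset[of n] in auto)
      from set_integral_Icc_combine[OF h'(1) le this] show ?thesis
        using h path_integral_tooth[of q n g] path_integral_tooth[of q' n g] int by simp
    qed
    moreover have "norm (LINT z:{q..q'}|lebesgue. g z) \<le> (LINT z:{q..q'}|lebesgue. C)"
    proof -
      have "norm (LINT z:{q..q'}|lebesgue. g z) \<le> (LINT z|lebesgue. norm (indicator {q..q'} z *\<^sub>R g z))"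
        unfolding set_lebesgue_integral_def by (rule integral_norm_bound)
      also have "\<dots> = (LINT z:{q..q'}|lebesgue. norm (g z))"
        by (simp add: set_lebesgue_integral_def)
      also have "\<dots> \<le> (LINT z:{q..q'}|lebesgue. C)"
      proof (rule set_integral_mono)
        show "set_integrable lebesgue {q..q'} (\<lambda>z. norm (g z))" by (rule set_integrable_norm[OF intq])
        show "set_integrable lebesgue {q..q'} (\<lambda>_. C)"
          by (intro absolutely_integrable_continuous_real continuous_intros)
      qed (use g sub in auto)
      finally show ?thesis .
    qed
    ultimately show ?thesis using le by (simp add: set_integral_Icc_const mult.commute)
  qed
  show ?thesis
  proof (cases "q \<le> q'")
    case True
    then show ?thesis using *[OF q True] by (simp add: norm_minus_commute)
  next
    case False
    then show ?thesis using *[of q' q] q by auto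
  qed
qed

lemma comb_set_close:
  assumes "q \<in> comb_set" "q' \<in> comb_set" "\<bar>q - q'\<bar> < 1 / 2"
  shows "\<exists>n. q \<in> {0..1} \<and> q' \<in> {0..1} \<or> (1 \<le> n \<and> q \<in> tooth n \<and> q' \<in> tooth n)"
proof -
  have far: False if "p \<in> {0..1}" "p' \<in> tooth n" "1 \<le> n" "\<bar>p - p'\<bar> < 1 / 2" for p p' n
    using that by (auto simp: tooth_def)
  from assms(1) show ?thesis
  proof (cases rule: comb_set_cases)
    case backbone
    from assms(2) show ?thesis
      by (cases rule: comb_set_cases) (use backbone far[of q q'] assms(3) in auto)
  next
    case (tooth n)
    from assms(2) show ?thesis
    proof (cases rule: comb_set_cases)
      case backbone
      then show ?thesis using far[of q' q n] tooth assms(3) by (auto simp: abs_minus_commute)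
    next
      case tooth': (tooth m)
      have "m = n"
      proof (rule ccontr)
        assume "m \<noteq> n"
        then have "real m + 1 \<le> real n \<or> real n + 1 \<le> real m" by linarith
        then show False
          using tooth tooth' assms(3) foot_bounds(2)[of m] foot_bounds(2)[of n]
          by (auto simp: tooth_def)
      qed
      then show ?thesis using tooth tooth' by blast
    qed
  qed
qed

text \<open>The images are uniformly bounded and uniformly Lipschitz: a diagonal sequence that converges on a
  countable dense set converges at every point, and dominated convergence does the rest.\<close>

lemma green_compact:
  assumes v: "\<And>n::nat. v n \<in> mean_zero_fns" "\<And>n. ip (v n) (v n) \<le> 1"
  shows "\<exists>y\<in>mean_zero_fns. \<exists>r. strict_mono r \<and>
      (\<lambda>n. ip (\<lambda>q. green (v (r n)) q - y q) (\<lambda>q. green (v (r n)) q - y q)) \<longlonglongrightarrow> 0 \<and>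
      (\<forall>e\<in>mean_zero_fns. (\<lambda>n. ip (green (v (r n))) e) \<longlonglongrightarrow> ip y e)"
proof -
  note F = flux_real[OF mean_zero_fns_integrable[OF v(1)]]
  have l1: "(LINT q|M. \<bar>v n q\<bar>) \<le> vol" for n
  proof -
    have "(LINT q|M. \<bar>v n q\<bar>)\<^sup>2 \<le> vol * ip (v n) (v n)" by (rule l1_le_l2[OF v(1)])
    also have "\<dots> \<le> vol * 1" using v(2) vol_pos by (intro mult_left_mono) auto
    also have "\<dots> \<le> vol\<^sup>2" using vol_gt_2 by (simp add: power2_eq_square)
    finally show ?thesis by (rule power2_le_imp_le) (use vol_pos in simp)
  qed
  have flux_vol: "\<bar>flux (v n) z\<bar> \<le> vol" for n z using F(2)[of n z] l1[of n] by linarith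
  have path_vol: "\<bar>path_integral (flux (v n)) q\<bar> \<le> vol\<^sup>2" for n q
  proof -
    have "\<bar>path_integral (flux (v n)) q\<bar> \<le> (LINT z|M. norm (flux (v n) z))"
      using path_integral_bound[OF F(3), of n q] by simp
    also have "\<dots> \<le> (LINT z|M. vol)"
      using F(3) flux_vol by (intro integral_mono) auto
    finally show ?thesis by (simp add: integral_const_M power2_eq_square)
  qed
  have mean_vol: "\<bar>(LINT p|M. path_integral (flux (v n)) p) / vol\<bar> \<le> vol\<^sup>2" for n
  proof -
    have "\<bar>LINT p|M. path_integral (flux (v n)) p\<bar> \<le> (LINT p|M. \<bar>path_integral (flux (v n)) p\<bar>)"
      using integral_norm_bound[of M "path_integral (flux (v n))"] by simp
    also have "\<dots> \<le> (LINT z|M. vol\<^sup>2)"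
      using path_integral_integrable[OF F(3)] path_vol by (intro integral_mono) auto
    finally show ?thesis using vol_pos by (simp add: integral_const_M field_simps)
  qed
  define C where "C = 2 * vol\<^sup>2"
  have bound: "\<bar>green (v n) q\<bar> \<le> C" for n q
    unfolding green_def C_def using path_vol[of n q] mean_vol[of n] by linarith
  have lip: "\<bar>green (v n) q - green (v n) q'\<bar> \<le> vol * \<bar>q - q'\<bar>"
    if "q \<in> comb_set" "q' \<in> comb_set" "\<bar>q - q'\<bar> < 1 / 2" for n q q'
  proof -
    from comb_set_close[OF that]
    obtain m where m: "q \<in> {0..1} \<and> q' \<in> {0..1} \<or> (1 \<le> m \<and> q \<in> tooth m \<and> q' \<in> tooth m)"
      by blast
    have "norm (flux (v n) z) \<le> vol" for z using flux_vol[of n z] by simp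
    from path_integral_lipschitz[OF F(1) this m] show ?thesis by (simp add: green_def)
  qed
  obtain T :: "real set" where T: "countable T" "T \<subseteq> comb_set" "comb_set \<subseteq> closure T"
    by (rule separable)
  obtain r where r: "strict_mono (r::nat\<Rightarrow>nat)" "\<And>x. x \<in> T \<Longrightarrow> \<exists>l. (\<lambda>n. green (v (r n)) x) \<longlonglongrightarrow> l"
    using function_convergent_subsequence[OF T(1), of "\<lambda>n. green (v n)" C] bound by auto
  have conv: "convergent (\<lambda>n. green (v (r n)) q)" if q: "q \<in> comb_set" for q
  proof (rule Cauchy_convergent, rule CauchyI)
    fix e :: real assume e: "0 < e"
    define d where "d = min (1 / 2) (e / (3 * vol))"
    have d: "0 < d" "d \<le> 1 / 2" "d \<le> e / (3 * vol)" using e vol_pos by (auto simp: d_def)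
    obtain t where t: "t \<in> T" "dist t q < d"
      using q T(3) d(1) closure_approachable by blast
    have near: "\<bar>green (v n) q - green (v n) t\<bar> < e / 3" for n
    proof -
      have "\<bar>green (v n) q - green (v n) t\<bar> \<le> vol * \<bar>q - t\<bar>"
        using lip[of q t n] q t T(2) d by (auto simp: dist_real_def abs_minus_commute)
      also have "\<dots> < vol * (e / (3 * vol))"
        using t(2) d vol_pos by (intro mult_strict_left_mono) (auto simp: dist_real_def abs_minus_commute)
      finally show ?thesis using vol_pos by simp
    qed
    have "Cauchy (\<lambda>n. green (v (r n)) t)"
      using r(2)[OF t(1)] by (intro convergent_Cauchy) (simp add: convergent_def)
    then obtain N where N: "\<And>m n. N \<le> m \<Longrightarrow> N \<le> n \<Longrightarrow> norm (green (v (r m)) t - green (v (r n)) t) < e / 3"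
      using e CauchyD[of "\<lambda>n. green (v (r n)) t" "e / 3"] by auto
    show "\<exists>N. \<forall>m\<ge>N. \<forall>n\<ge>N. norm (green (v (r m)) q - green (v (r n)) q) < e"
    proof (intro exI allI impI)
      fix m n assume "N \<le> m" "N \<le> n"
      then show "norm (green (v (r m)) q - green (v (r n)) q) < e"
        using N[of m n] near[of "r m"] near[of "r n"] unfolding real_norm_def by linarith
    qed
  qed
  define y where "y q = lim (\<lambda>n. green (v (r n)) q)" for q
  have lim: "(\<lambda>n. green (v (r n)) q) \<longlonglongrightarrow> y q" if "q \<in> comb_set" for q
    using conv[OF that] by (simp add: y_def convergent_LIMSEQ_iff)
  note gX = green_mean_zero[OF v(1)]
  have gmeas [measurable]: "green (v n) \<in> borel_measurable M" for n
    using gX[of n] by (simp add: mean_zero_fns_def)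
  have ymeas [measurable]: "y \<in> borel_measurable M"
    by (rule borel_measurable_LIMSEQ_real[of _ "\<lambda>n. green (v (r n))"]) (use lim gmeas in auto)
  have ybound: "\<bar>y q\<bar> \<le> C" if "q \<in> comb_set" for q
    using bound lim[OF that] by (intro LIMSEQ_le_const2[OF tendsto_rabs[OF lim[OF that]]]) auto
  have "(\<lambda>n. LINT q|M. green (v (r n)) q) \<longlonglongrightarrow> (LINT q|M. y q)"
    by (rule integral_dominated_convergence[where w = "\<lambda>_. C"]) (use lim bound in auto)
  moreover have "(LINT q|M. green (v n) q) = 0" for n using gX[of n] by (simp add: mean_zero_fns_def)
  ultimately have "(LINT q|M. y q) = 0" by (simp add: LIMSEQ_const_iff)
  then have y: "y \<in> mean_zero_fns" using ymeas ybound by (auto simp: mean_zero_fns_def)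
  have "(\<lambda>n. ip (\<lambda>q. green (v (r n)) q - y q) (\<lambda>q. green (v (r n)) q - y q)) \<longlonglongrightarrow> (LINT q|M. 0)"
    unfolding ip_def
  proof (rule integral_dominated_convergence[where w = "\<lambda>_. (2 * C) * (2 * C)"])
    show "AE q in M. (\<lambda>n. (green (v (r n)) q - y q) * (green (v (r n)) q - y q)) \<longlonglongrightarrow> 0"
    proof (rule AE_I2)
      fix q assume "q \<in> space M"
      then have "(\<lambda>n. green (v (r n)) q - y q) \<longlonglongrightarrow> 0" using lim by (simp add: LIM_zero)
      from tendsto_mult[OF this this] show "(\<lambda>n. (green (v (r n)) q - y q) * (green (v (r n)) q - y q)) \<longlonglongrightarrow> 0"
        by simp
    qed
    show "AE q in M. norm ((green (v (r n)) q - y q) * (green (v (r n)) q - y q)) \<le> 2 * C * (2 * C)" for n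
    proof (rule AE_I2)
      fix q assume "q \<in> space M"
      then have "\<bar>green (v (r n)) q - y q\<bar> \<le> 2 * C" using bound[of "r n" q] ybound[of q] by simp
      then show "norm ((green (v (r n)) q - y q) * (green (v (r n)) q - y q)) \<le> 2 * C * (2 * C)"
        unfolding real_norm_def abs_mult by (intro mult_mono) (auto intro: order_trans[OF abs_ge_zero])
    qed
  qed auto
  moreover have "(\<lambda>n. ip (green (v (r n))) e) \<longlonglongrightarrow> ip y e" if e: "e \<in> mean_zero_fns" for e
  proof -
    have [measurable]: "e \<in> borel_measurable M" using e by (simp add: mean_zero_fns_def)
    show ?thesis unfolding ip_def
    proof (rule integral_dominated_convergence[where w = "\<lambda>q. C * \<bar>e q\<bar>"])
      show "integrable M (\<lambda>q. C * \<bar>e q\<bar>)" using mean_zero_fns_integrable[OF e] by auto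
      show "AE q in M. (\<lambda>n. green (v (r n)) q * e q) \<longlonglongrightarrow> y q * e q"
        using lim by (intro AE_I2 tendsto_intros) auto
      show "AE q in M. norm (green (v (r n)) q * e q) \<le> C * \<bar>e q\<bar>" for n
        using bound[of "r n"] by (intro AE_I2) (auto simp: abs_mult intro!: mult_right_mono)
    qed auto
  qed
  ultimately show ?thesis using y r(1) by auto
qed

text \<open>The operator does not see null sets. Applying it turns equations that hold almost everywhere into
  equations at every point.\<close>

lemma ip_self_zero_imp_green_zero:
  assumes "d \<in> mean_zero_fns" "ip d d = 0"
  shows "green d q = 0"
proof -
  have d: "integrable M d" by (rule mean_zero_fns_integrable[OF assms(1)])
  have "AE q in M. d q * d q = 0"
    using assms(2) mean_zero_fns_mult_integrable[OF assms(1,1)]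
    by (subst integral_nonneg_eq_0_iff_AE[symmetric]) (auto simp: ip_def)
  then have ae: "AE q in M. d q = 0" by eventually_elim simp
  have "flux d z = 0" for z
  proof -
    have "flux d z = (LINT q|M. 0)"
      unfolding flux_def
      by (rule integral_cong_AE) (use ae d incidence_measurable_snd in \<open>auto elim: eventually_mono\<close>)
    then show ?thesis by simp
  qed
  then have "path_integral (flux d) q = 0" for q by (simp add: path_integral_def)
  then show ?thesis by (simp add: green_def)
qed

text \<open>Eigenfunctions of the Green operator are produced one at a time, each in the orthogonal
  complement of those already found; the trial functions guarantee that the eigenvalue is at least
  \<open>\<kappa>\<close> as long as fewer than \<open>k\<close> linear conditions are imposed on their span.\<close>

lemma green_eigenfunctions:
  fixes w :: "nat \<Rightarrow> real \<Rightarrow> real"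
  assumes kappa: "0 < \<kappa>"
    and w: "\<And>i. w i \<in> borel_measurable M" "\<And>i q. q \<in> comb_set \<Longrightarrow> \<bar>w i q\<bar> \<le> C"
    and trial: "\<And>c. \<exists>i<k. c i \<noteq> 0 \<Longrightarrow> (\<lambda>q. \<Sum>i<k. c i * w i q) \<in> mean_zero_fns \<Longrightarrow>
      0 < ip (\<lambda>q. \<Sum>i<k. c i * w i q) (\<lambda>q. \<Sum>i<k. c i * w i q) \<and>
      \<kappa> * ip (\<lambda>q. \<Sum>i<k. c i * w i q) (\<lambda>q. \<Sum>i<k. c i * w i q)
        \<le> ip (green (\<lambda>q. \<Sum>i<k. c i * w i q)) (\<lambda>q. \<Sum>i<k. c i * w i q)"
    and "j < k"
  shows "\<exists>e \<rho>. (\<forall>i<j. e i \<in> mean_zero_fns \<and> \<kappa> \<le> \<rho> i \<and> green (e i) = (\<lambda>q. \<rho> i * e i q) \<and> 0 < ip (e i) (e i)) \<and>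
    (\<forall>i<j. \<forall>l<j. i \<noteq> l \<longrightarrow> ip (e i) (e l) = 0)"
  using \<open>j < k\<close>
proof (induction j)
  case 0
  then show ?case by simp
next
  case (Suc j)
  then have "j < k" by simp
  from Suc.IH[OF this] obtain e \<rho> where
    E: "\<forall>i<j. e i \<in> mean_zero_fns \<and> \<kappa> \<le> \<rho> i \<and> green (e i) = (\<lambda>q. \<rho> i * e i q) \<and> 0 < ip (e i) (e i)"
    and orth: "\<forall>i<j. \<forall>l<j. i \<noteq> l \<longrightarrow> ip (e i) (e l) = 0" by blast
  have e: "\<And>i. i < j \<Longrightarrow> e i \<in> mean_zero_fns" "\<And>i. i < j \<Longrightarrow> \<kappa> \<le> \<rho> i"
      "\<And>i. i < j \<Longrightarrow> green (e i) = (\<lambda>q. \<rho> i * e i q)" "\<And>i. i < j \<Longrightarrow> 0 < ip (e i) (e i)"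
    using E by blast+
  define X where "X = {v \<in> mean_zero_fns. \<forall>i<j. ip v (e i) = 0}"
  have X: "X \<subseteq> mean_zero_fns" by (auto simp: X_def)
  have green_X: "green v \<in> X" if "v \<in> X" for v
  proof -
    have v: "v \<in> mean_zero_fns" "\<And>i. i < j \<Longrightarrow> ip v (e i) = 0" using that by (auto simp: X_def)
    have "ip (green v) (e i) = 0" if i: "i < j" for i
    proof -
      have "ip (green v) (e i) = ip v (green (e i))"
        using ip_green[OF v(1) e(1)[OF i]] ip_green[OF e(1)[OF i] v(1)] by (simp add: ip_commute mult.commute)
      also have "\<dots> = ip (green (e i)) v" by (rule ip_commute)
      also have "\<dots> = \<rho> i * ip (e i) v"
        using ip_linear[OF e(1)[OF i] e(1)[OF i] v(1), of "\<rho> i" 0] by (simp add: e(3)[OF i])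
      finally show ?thesis using v(2)[OF i] by (simp add: ip_commute)
    qed
    then show ?thesis using green_mean_zero[OF v(1)] by (simp add: X_def)
  qed
  have X_linear: "(\<lambda>q. a * v q + b * u q) \<in> X" if "v \<in> X" "u \<in> X" for a b u v
    using that by (auto simp: X_def mean_zero_fns_linear ip_linear e(1))
  have w_int: "integrable M (w i)" for i by (rule bounded_integrable[OF w])
  define cond where "cond i l = (if l = j then (LINT q|M. w i q) else ip (w i) (e l))" for i l
  obtain c where c: "\<exists>i<k. c i \<noteq> 0" "\<And>l. l \<in> {..j} \<Longrightarrow> (\<Sum>i<k. c i * cond i l) = 0"
    using nontrivial_combination_vanishing[of "{..j}" k cond] Suc.prems by auto
  define W where "W q = (\<Sum>i<k. c i * w i q)" for q
  have "(LINT q|M. W q) = (\<Sum>i<k. c i * (LINT q|M. w i q))"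
    unfolding W_def using w_int by simp
  also have "\<dots> = 0" using c(2)[of j] by (simp add: cond_def)
  finally have W_mean: "(LINT q|M. W q) = 0" .
  have "\<bar>W q\<bar> \<le> (\<Sum>i<k. \<bar>c i\<bar> * C)" if "q \<in> comb_set" for q
    unfolding W_def using w(2)[OF that]
    by (intro order_trans[OF sum_abs] sum_mono) (auto simp: abs_mult intro!: mult_left_mono)
  moreover have "W \<in> borel_measurable M" unfolding W_def using w(1) by measurable
  ultimately have W0: "W \<in> mean_zero_fns" using W_mean by (auto simp: mean_zero_fns_def)
  have "ip W (e l) = 0" if l: "l < j" for l
  proof -
    obtain D where D: "\<And>q. q \<in> comb_set \<Longrightarrow> \<bar>e l q\<bar> \<le> D" and [measurable]: "e l \<in> borel_measurable M"
      using e(1)[OF l] by (auto simp: mean_zero_fns_def)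
    have int: "integrable M (\<lambda>q. w i q * e l q)" for i
    proof (rule bounded_integrable[where C = "C * D"])
      show "(\<lambda>q. w i q * e l q) \<in> borel_measurable M" using w(1) by measurable
      fix q assume "q \<in> comb_set"
      then show "\<bar>w i q * e l q\<bar> \<le> C * D"
        unfolding abs_mult using w(2)[of q i] D[of q] abs_ge_zero[of "w i q"]
        by (intro mult_mono) auto
    qed
    have "ip W (e l) = (LINT q|M. (\<Sum>i<k. c i * (w i q * e l q)))"
      by (simp add: ip_def W_def sum_distrib_right mult.assoc)
    also have "\<dots> = (\<Sum>i<k. c i * ip (w i) (e l))" using int by (simp add: ip_def)
    finally show ?thesis using c(2)[of l] l by (simp add: cond_def)
  qed
  then have WX: "W \<in> X" using W0 by (simp add: X_def)
  have tr: "0 < ip W W" "\<kappa> * ip W W \<le> ip (green W) W"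
    using trial[OF c(1)] W0 unfolding W_def[abs_def] by auto
  have "\<exists>y\<in>X. \<exists>\<rho>'\<ge>\<kappa>. 0 < ip y y \<and> (\<forall>z\<in>X. ip (green y) z = \<rho>' * ip y z)"
  proof (rule compact_symmetric_operator_eigenvector[where B = ip and K = green and w = W and C = "vol\<^sup>2"])
    show "ip (green v) u = ip v (green u)" if "v \<in> X" "u \<in> X" for u v
      using ip_green[OF subsetD[OF X that(1)] subsetD[OF X that(2)]]
        ip_green[OF subsetD[OF X that(2)] subsetD[OF X that(1)]]
      by (simp add: ip_commute mult.commute)
    show "\<exists>y\<in>X. \<exists>r. strict_mono r \<and>
        (\<lambda>n. ip (\<lambda>q. green (v (r n)) q - y q) (\<lambda>q. green (v (r n)) q - y q)) \<longlonglongrightarrow> 0"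
      if v: "\<And>n::nat. v n \<in> X" "\<And>n. ip (v n) (v n) \<le> 1" for v
    proof -
      obtain y r where y: "y \<in> mean_zero_fns" "strict_mono r"
        "(\<lambda>n. ip (\<lambda>q. green (v (r n)) q - y q) (\<lambda>q. green (v (r n)) q - y q)) \<longlonglongrightarrow> 0"
        "\<And>e. e \<in> mean_zero_fns \<Longrightarrow> (\<lambda>n. ip (green (v (r n))) e) \<longlonglongrightarrow> ip y e"
        using green_compact[of v] v X by blast
      have "ip y (e i) = 0" if "i < j" for i
      proof -
        have "ip (green (v (r n))) (e i) = 0" for n
          using green_X[OF v(1)] that by (auto simp: X_def)
        then show ?thesis using y(4)[OF e(1)[OF that]] by (simp add: LIMSEQ_const_iff)
      qed
      then have "y \<in> X" using y(1) by (simp add: X_def)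
      then show ?thesis using y by blast
    qed
    show "ip (\<lambda>q. a * u q + b * v q) z = a * ip u z + b * ip v z" if "u \<in> X" "v \<in> X" "z \<in> X" for a b u v z
      using that X by (intro ip_linear) auto
    show "green (\<lambda>q. a * u q + b * v q) = (\<lambda>q. a * green u q + b * green v q)" if "u \<in> X" "v \<in> X" for a b u v
      using that X by (intro green_linear) auto
    show "ip (green v) v \<le> vol\<^sup>2 * ip v v" if "v \<in> X" for v
      using that X by (intro green_form_bound) auto
    show "0 \<le> ip v v" for v by (simp add: ip_def)
    show "ip v z = ip z v" for v z by (rule ip_commute)
  qed (use X_linear green_X WX tr kappa in auto)
  then obtain y \<rho>' where y: "y \<in> X" "\<kappa> \<le> \<rho>'" "0 < ip y y" "\<And>z. z \<in> X \<Longrightarrow> ip (green y) z = \<rho>' * ip y z"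
    by blast
  \<comment> \<open>The eigenvalue equation for \<open>y\<close> holds only almost everywhere; applying the operator once more
    turns it into an identity of functions.\<close>
  define z where "z = green y"
  have zX: "z \<in> X" using green_X y(1) by (simp add: z_def)
  have z0: "z \<in> mean_zero_fns" and y0: "y \<in> mean_zero_fns" using zX y(1) X by auto
  define d where "d = (\<lambda>q. 1 * z q + (- \<rho>') * y q)"
  have dX: "d \<in> X" unfolding d_def by (intro X_linear zX y(1))
  have "ip d d = 1 * ip z d + (- \<rho>') * ip y d"
    unfolding d_def by (rule ip_linear[OF z0 y0 mean_zero_fns_linear[OF z0 y0]])
  also have "\<dots> = 0" using y(4)[OF dX] by (simp add: z_def)
  finally have "ip d d = 0" .
  then have "green d q = 0" for q using ip_self_zero_imp_green_zero dX X by blast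
  then have "green z q = \<rho>' * green y q" for q
    using fun_cong[OF green_linear[OF z0 y0, of 1 "- \<rho>'"], of q] by (simp add: d_def)
  then have z_eigen: "green z = (\<lambda>q. \<rho>' * z q)" by (auto simp: z_def)
  have "ip z z = \<rho>' * ip y z" using y(4)[OF zX] by (simp add: z_def)
  also have "ip y z = \<rho>' * ip y y" using y(4)[OF y(1)] by (simp add: z_def ip_commute)
  finally have z_pos: "0 < ip z z" using y kappa by simp
  define e' where "e' = e(j := z)"
  define \<rho>2 where "\<rho>2 = \<rho>(j := \<rho>')"
  have "\<forall>i<Suc j. e' i \<in> mean_zero_fns \<and> \<kappa> \<le> \<rho>2 i \<and> green (e' i) = (\<lambda>q. \<rho>2 i * e' i q) \<and> 0 < ip (e' i) (e' i)"
    using e z0 z_eigen z_pos y(2) by (auto simp: e'_def \<rho>2_def less_Suc_eq)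
  moreover have "\<forall>i<Suc j. \<forall>l<Suc j. i \<noteq> l \<longrightarrow> ip (e' i) (e' l) = 0"
    using orth zX by (auto simp: e'_def less_Suc_eq X_def ip_commute)
  ultimately show ?case by blast
qed

end

section \<open>Trial functions\<close>

lemma primitive_on_cong:
  assumes "primitive_on a b f g" "a \<le> b" "\<And>x. x \<in> {a..b} \<Longrightarrow> f' x = f x" "\<And>x. x \<in> {a..b} \<Longrightarrow> g' x = g x"
  shows "primitive_on a b f' g'"
  unfolding primitive_on_def
proof (intro conjI ballI)
  have "set_integrable lebesgue {a..b} g' \<longleftrightarrow> set_integrable lebesgue {a..b} g"
    using assms(4) by (intro set_integrable_cong) auto
  then show "set_integrable lebesgue {a..b} g'" using primitive_on_integrable[OF assms(1)] by simp
  fix x assume x: "x \<in> {a..b}"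
  have "(LINT y:{a..x}|lebesgue. g' y) = (LINT y:{a..x}|lebesgue. g y)"
    using assms(4) x by (intro set_lebesgue_integral_cong) auto
  then show "f' x = f' a + (LINT y:{a..x}|lebesgue. g' y)"
    using primitive_on_eq[OF assms(1) x] assms(2) assms(3)[of x] assms(3)[of a] x by simp
qed

lemma primitive_on_shift:
  assumes "primitive_on (t + a) (t + b) f g"
  shows "primitive_on a b (\<lambda>x. f (t + x)) (\<lambda>x. g (t + x))"
  unfolding primitive_on_def
proof (intro conjI ballI)
  note g = primitive_on_integrable[OF assms]
  show "set_integrable lebesgue {a..b} (\<lambda>x. g (t + x))" by (rule set_integral_Icc_shift(1)[OF g])
  fix x assume x: "x \<in> {a..b}"
  have "set_integrable lebesgue {t + a..t + x} g"
    by (rule set_integrable_subset[OF g]) (use x in auto)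
  then show "f (t + x) = f (t + a) + (LINT y:{a..x}|lebesgue. g (t + y))"
    using primitive_on_eq[OF assms, of "t + x"] x by (simp add: set_integral_Icc_shift(2))
qed

text \<open>Half periods of \<open>sin (pi * k * y / 2)\<close>: the interval \<open>[0, 2]\<close> carries \<open>k\<close> of them.\<close>

definition bump :: "nat \<Rightarrow> nat \<Rightarrow> real \<Rightarrow> real" where
  "bump k i y = (if 2 * real i / real k \<le> y \<and> y \<le> 2 * (real i + 1) / real k
    then sin (pi * real k / 2 * y) else 0)"

definition bump_deriv :: "nat \<Rightarrow> nat \<Rightarrow> real \<Rightarrow> real" where
  "bump_deriv k i y = (if 2 * real i / real k < y \<and> y < 2 * (real i + 1) / real k
    then pi * real k / 2 * cos (pi * real k / 2 * y) else 0)"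

lemma bump_measurable [measurable]: "bump k i \<in> borel_measurable borel" "bump_deriv k i \<in> borel_measurable borel"
  unfolding bump_def[abs_def] bump_deriv_def[abs_def] by measurable

lemma bump_bound: "\<bar>bump k i y\<bar> \<le> 1"
  by (simp add: bump_def)

lemma bump_deriv_bound: "\<bar>bump_deriv k i y\<bar> \<le> pi * real k / 2"
  by (auto simp: bump_deriv_def abs_mult intro!: mult_left_le)

lemma bump_continuous:
  assumes "1 \<le> k"
  shows "continuous_on A (bump k i)"
proof -
  define a b where "a = 2 * real i / real k" and "b = 2 * (real i + 1) / real k"
  have ab: "a \<le> b" using assms by (auto simp: a_def b_def divide_right_mono)
  have "pi * real k / 2 * a = real i * pi" "pi * real k / 2 * b = real (Suc i) * pi"
    using assms by (auto simp: a_def b_def field_simps)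
  then have zero: "sin (pi * real k / 2 * a) = 0" "sin (pi * real k / 2 * b) = 0"
    by (simp_all only: sin_npi)
  have "bump k i = (\<lambda>y. sin (pi * real k / 2 * max a (min b y)))"
  proof
    fix y
    have "bump k i y = (if a \<le> y \<and> y \<le> b then sin (pi * real k / 2 * y) else 0)"
      unfolding bump_def a_def b_def by (rule refl)
    then show "bump k i y = sin (pi * real k / 2 * max a (min b y))"
      using ab zero by (simp add: max_def min_def)
  qed
  then show ?thesis by (auto intro!: continuous_intros)
qed

lemma bump_has_deriv:
  assumes "y \<noteq> 2 * real i / real k" "y \<noteq> 2 * (real i + 1) / real k"
  shows "(bump k i has_real_derivative bump_deriv k i y) (at y)"
proof -
  define a b where "a = 2 * real i / real k" and "b = 2 * (real i + 1) / real k"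
  have bump_ab: "bump k i y = (if a \<le> y \<and> y \<le> b then sin (pi * real k / 2 * y) else 0)" for y
    unfolding bump_def a_def b_def by (rule refl)
  have deriv_ab: "bump_deriv k i y = (if a < y \<and> y < b then pi * real k / 2 * cos (pi * real k / 2 * y) else 0)" for y
    unfolding bump_deriv_def a_def b_def by (rule refl)
  have "y \<noteq> a" "y \<noteq> b" using assms unfolding a_def b_def by blast+
  then consider "y < a \<or> b < y" | "a < y" "y < b" by linarith
  then show ?thesis
  proof cases
    case 1
    have "((\<lambda>_. 0) has_real_derivative 0) (at y)" by simp
    then have "(bump k i has_real_derivative 0) (at y)"
    proof (rule has_field_derivative_transform_within_open[where S = "{..<a} \<union> {b<..}"])
      show "0 = bump k i x" if "x \<in> {..<a} \<union> {b<..}" for x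
        using that by (auto simp: bump_ab)
    qed (use 1 in auto)
    then show ?thesis using 1 by (auto simp: deriv_ab)
  next
    case 2
    have "((\<lambda>y. sin (pi * real k / 2 * y)) has_real_derivative pi * real k / 2 * cos (pi * real k / 2 * y)) (at y)"
      by (auto intro!: derivative_eq_intros)
    then have "(bump k i has_real_derivative pi * real k / 2 * cos (pi * real k / 2 * y)) (at y)"
    proof (rule has_field_derivative_transform_within_open[where S = "{a<..<b}"])
      show "sin (pi * real k / 2 * x) = bump k i x" if "x \<in> {a<..<b}" for x
        using that by (auto simp: bump_ab)
    qed (use 2 in auto)
    then show ?thesis using 2 by (auto simp: deriv_ab)
  qed
qed

lemma bump_support:
  assumes k: "1 \<le> k" and y: "0 < y" "y < 2" "\<And>i. i \<le> k \<Longrightarrow> y \<noteq> 2 * real i / real k"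
  obtains j where "j < k" "\<And>i. bump k i y = (if i = j then sin (pi * real k / 2 * y) else 0)"
    "\<And>i. bump_deriv k i y = (if i = j then pi * real k / 2 * cos (pi * real k / 2 * y) else 0)"
proof -
  define j where "j = nat \<lfloor>real k * y / 2\<rfloor>"
  have "0 \<le> \<lfloor>real k * y / 2\<rfloor>" using k y by simp
  then have rj: "real j = of_int \<lfloor>real k * y / 2\<rfloor>" by (simp add: j_def)
  have j: "real j \<le> real k * y / 2" "real k * y / 2 < real j + 1" unfolding rj by linarith+
  have "real k * y / 2 < real k" using k y by simp
  then have jk: "j < k" using j(1) by linarith
  have in_j: "2 * real i / real k < y \<longleftrightarrow> i \<le> j" if "i \<le> k" for i
  proof
    assume "2 * real i / real k < y"
    then have "real i < real j + 1" using j k by (simp add: field_simps)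
    then show "i \<le> j" by linarith
  next
    assume "i \<le> j"
    then have "real i \<le> real k * y / 2" using j(1) by linarith
    then have "2 * real i / real k \<le> y" using k by (simp add: field_simps)
    then show "2 * real i / real k < y" using y(3)[OF that] by simp
  qed
  have upper: "y < 2 * (real i + 1) / real k \<longleftrightarrow> j \<le> i" for i
  proof
    assume "y < 2 * (real i + 1) / real k"
    then have "real j < real i + 1" using j k by (simp add: field_simps)
    then show "j \<le> i" by linarith
  next
    assume "j \<le> i"
    then have "real k * y / 2 < real i + 1" using j(2) by linarith
    then show "y < 2 * (real i + 1) / real k" using k by (simp add: field_simps)
  qed
  have lower: "2 * real i / real k < y \<longleftrightarrow> i \<le> j" for i
  proof (cases "i \<le> k")
    case False
    have "real k * y / 2 < real i" using \<open>real k * y / 2 < real k\<close> False by linarith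
    then have "\<not> 2 * real i / real k < y" using k by (simp add: field_simps)
    then show ?thesis using False jk by simp
  qed (rule in_j)
  have neq: "y \<noteq> 2 * real i / real k" for i
  proof (cases "i \<le> k")
    case False
    have "real k * y / 2 < real i" using \<open>real k * y / 2 < real k\<close> False by linarith
    then show ?thesis using k by (simp add: field_simps)
  qed (rule y(3))
  have "y \<noteq> 2 * (real i + 1) / real k" for i using neq[of "Suc i"] by (simp add: add.commute)
  then have "2 * real i / real k \<le> y \<longleftrightarrow> i \<le> j" "y \<le> 2 * (real i + 1) / real k \<longleftrightarrow> j \<le> i" for i
    using lower[of i] upper[of i] neq[of i] by (auto simp: order_le_less)
  then show thesis
    using lower upper by (intro that[OF jk]) (auto simp: bump_def bump_deriv_def)
qed

text \<open>A linear combination of the bumps satisfies \<open>W'\<^sup>2 - (pi * k / 2)\<^sup>2 * W\<^sup>2 = (W * W')'\<close>, and \<open>W * W'\<close> vanishes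
  at the nodes. This is why the Rayleigh quotient is the same for all combinations.\<close>

context
  fixes k :: nat and c :: "nat \<Rightarrow> real"
  assumes k: "1 \<le> k"
begin

definition "bump_sum y = (\<Sum>i<k. c i * bump k i y)"
definition "bump_sum_deriv y = (\<Sum>i<k. c i * bump_deriv k i y)"

lemma bump_sum_measurable [measurable]:
  "bump_sum \<in> borel_measurable borel" "bump_sum_deriv \<in> borel_measurable borel"
  unfolding bump_sum_def[abs_def] bump_sum_deriv_def[abs_def] by measurable

lemma bump_sum_continuous: "continuous_on A bump_sum"
  unfolding bump_sum_def[abs_def] by (intro continuous_intros bump_continuous k)

lemma bump_sum_deriv_bound: "\<bar>bump_sum_deriv y\<bar> \<le> (\<Sum>i<k. \<bar>c i\<bar> * (pi * real k / 2))"
  unfolding bump_sum_deriv_def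
  by (intro order_trans[OF sum_abs] sum_mono, unfold abs_mult) (intro mult_left_mono bump_deriv_bound abs_ge_zero)

lemma bounded_set_integrable:
  fixes h :: "real \<Rightarrow> real"
  assumes [measurable]: "h \<in> borel_measurable borel" and "\<And>y. \<bar>h y\<bar> \<le> C"
  shows "set_integrable lebesgue {a..b} h"
proof -
  interpret finite_measure "lebesgue_on {a..b}" by (rule finite_measure_lebesgue_on) auto
  have "h \<in> borel_measurable (lebesgue_on {a..b})"
    by (rule measurable_restrict_space1) (rule measurable_completion, simp)
  then have "integrable (lebesgue_on {a..b}) h"
    using assms(2) by (intro integrable_const_bound[where B = C]) auto
  then show ?thesis by (simp add: lebesgue_on_eq_set_integral)
qed

lemma bump_sum_deriv_integrable:
  "set_integrable lebesgue {a..b} bump_sum_deriv" "set_integrable lebesgue {a..b} (\<lambda>y. (bump_sum_deriv y)\<^sup>2)"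
proof -
  show "set_integrable lebesgue {a..b} bump_sum_deriv"
    by (rule bounded_set_integrable[OF _ bump_sum_deriv_bound]) measurable
  have "\<bar>(bump_sum_deriv y)\<^sup>2\<bar> \<le> (\<Sum>i<k. \<bar>c i\<bar> * (pi * real k / 2))\<^sup>2" for y
    using power_mono[OF bump_sum_deriv_bound[of y] abs_ge_zero, of 2] by simp
  then show "set_integrable lebesgue {a..b} (\<lambda>y. (bump_sum_deriv y)\<^sup>2)"
    by (rule bounded_set_integrable[rotated]) measurable
qed

definition "nodes = (\<lambda>i. 2 * real i / real k) ` {..k}"

lemma finite_nodes: "finite nodes" by (simp add: nodes_def)

lemma bump_sum_has_deriv:
  assumes "y \<notin> nodes"
  shows "(bump_sum has_real_derivative bump_sum_deriv y) (at y)"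
  unfolding bump_sum_def[abs_def] bump_sum_deriv_def
proof (intro DERIV_sum DERIV_cmult bump_has_deriv)
  fix i assume "i \<in> {..<k}"
  then show "y \<noteq> 2 * real i / real k" "y \<noteq> 2 * (real i + 1) / real k"
    using assms imageI[of i "{..k}" "\<lambda>i. 2 * real i / real k"] imageI[of "Suc i" "{..k}" "\<lambda>i. 2 * real i / real k"]
    by (auto simp: nodes_def add.commute)
qed

lemma bump_sum_primitive:
  assumes "a \<le> b"
  shows "primitive_on a b (\<lambda>y. complex_of_real (bump_sum y)) (\<lambda>y. complex_of_real (bump_sum_deriv y))"
  unfolding primitive_on_def
proof (intro conjI ballI)
  show "set_integrable lebesgue {a..b} (\<lambda>y. complex_of_real (bump_sum_deriv y))"
    using bump_sum_deriv_integrable(1)[of a b] unfolding set_integrable_def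
    by (simp add: complex_of_real_integrable_eq scaleR_conv_of_real flip: of_real_mult)
  fix x assume x: "x \<in> {a..b}"
  have "(bump_sum_deriv has_integral bump_sum x - bump_sum a) {a..x}"
  proof (rule fundamental_theorem_of_calculus_interior_strong[OF finite_nodes])
    show "(bump_sum has_vector_derivative bump_sum_deriv y) (at y)" if "y \<in> {a<..<x} - nodes" for y
      using bump_sum_has_deriv[of y] that by (simp add: has_real_derivative_iff_has_vector_derivative)
  qed (use x bump_sum_continuous in auto)
  then have "(LINT y:{a..x}|lebesgue. bump_sum_deriv y) = bump_sum x - bump_sum a"
    using bump_sum_deriv_integrable(1)[of a x] by (simp add: set_lebesgue_integral_eq_integral(2) integral_unique)
  then show "complex_of_real (bump_sum x)
      = complex_of_real (bump_sum a) + (LINT y:{a..x}|lebesgue. complex_of_real (bump_sum_deriv y))"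
    by (simp add: set_integral_complex_of_real)
qed

lemma bump_sum_energy:
  "(LINT y:{0..2}|lebesgue. (bump_sum_deriv y)\<^sup>2) = (pi * real k / 2)\<^sup>2 * (LINT y:{0..2}|lebesgue. (bump_sum y)\<^sup>2)"
proof -
  define \<omega> where "\<omega> = pi * real k / 2"
  define A where "A y = (\<Sum>i<k. (c i)\<^sup>2 * (\<omega> * (bump k i y * cos (\<omega> * y))))" for y
  have ends: "bump k i 0 = 0" "i < k \<Longrightarrow> bump k i 2 = 0" for i
  proof -
    show "bump k i 0 = 0" by (simp add: bump_def)
    have "pi * real k / 2 * 2 = real k * pi" by simp
    then have "sin (pi * real k / 2 * 2) = 0" by (simp only: sin_npi)
    then show "bump k i 2 = 0" by (simp add: bump_def)
  qed
  have "((\<lambda>y. (bump_sum_deriv y)\<^sup>2 - \<omega>\<^sup>2 * (bump_sum y)\<^sup>2) has_integral A 2 - A 0) {0..2}"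
  proof (rule fundamental_theorem_of_calculus_interior_strong[OF finite_nodes])
    show "continuous_on {0..2} A"
      unfolding A_def[abs_def] by (intro continuous_intros bump_continuous k)
    fix y assume y: "y \<in> {0<..<2} - nodes"
    have y': "0 < y" "y < 2" "\<And>i. i \<le> k \<Longrightarrow> y \<noteq> 2 * real i / real k" using y by (auto simp: nodes_def)
    obtain j where j: "j < k" "\<And>i. bump k i y = (if i = j then sin (\<omega> * y) else 0)"
      "\<And>i. bump_deriv k i y = (if i = j then \<omega> * cos (\<omega> * y) else 0)"
      using bump_support[OF k y'] unfolding \<omega>_def by metis
    have "(A has_real_derivative (\<Sum>i<k. (c i)\<^sup>2 * (\<omega> * (bump_deriv k i y * cos (\<omega> * y) - bump k i y * (\<omega> * sin (\<omega> * y)))))) (at y)"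
      unfolding A_def[abs_def]
    proof (intro DERIV_sum DERIV_cmult)
      fix i assume "i \<in> {..<k}"
      then have "y \<noteq> 2 * real i / real k" "y \<noteq> 2 * (real i + 1) / real k"
        using y'(3)[of i] y'(3)[of "Suc i"] by (auto simp: add.commute)
      note bump_has_deriv[OF this]
      then show "((\<lambda>y. bump k i y * cos (\<omega> * y)) has_real_derivative
          bump_deriv k i y * cos (\<omega> * y) - bump k i y * (\<omega> * sin (\<omega> * y))) (at y)"
        by (auto intro!: derivative_eq_intros)
    qed
    also have "(\<Sum>i<k. (c i)\<^sup>2 * (\<omega> * (bump_deriv k i y * cos (\<omega> * y) - bump k i y * (\<omega> * sin (\<omega> * y)))))
        = (\<Sum>i<k. if i = j then (c j)\<^sup>2 * (\<omega> * (\<omega> * cos (\<omega> * y) * cos (\<omega> * y) - sin (\<omega> * y) * (\<omega> * sin (\<omega> * y)))) else 0)"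
      by (intro sum.cong) (auto simp: j)
    also have "\<dots> = (c j)\<^sup>2 * (\<omega> * (\<omega> * cos (\<omega> * y) * cos (\<omega> * y) - sin (\<omega> * y) * (\<omega> * sin (\<omega> * y))))"
      using j(1) by simp
    also have "\<dots> = (bump_sum_deriv y)\<^sup>2 - \<omega>\<^sup>2 * (bump_sum y)\<^sup>2"
    proof -
      have "bump_sum y = (\<Sum>i<k. if i = j then c j * sin (\<omega> * y) else 0)"
        unfolding bump_sum_def by (intro sum.cong) (auto simp: j)
      moreover have "bump_sum_deriv y = (\<Sum>i<k. if i = j then c j * (\<omega> * cos (\<omega> * y)) else 0)"
        unfolding bump_sum_deriv_def by (intro sum.cong) (auto simp: j)
      ultimately show ?thesis using j(1) by (simp add: power2_eq_square algebra_simps)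
    qed
    finally show "(A has_vector_derivative (bump_sum_deriv y)\<^sup>2 - \<omega>\<^sup>2 * (bump_sum y)\<^sup>2) (at y)"
      by (simp add: has_real_derivative_iff_has_vector_derivative)
  qed auto
  moreover have "A 2 = 0" "A 0 = 0" using ends by (auto simp: A_def)
  ultimately have 0: "integral {0..2} (\<lambda>y. (bump_sum_deriv y)\<^sup>2 - \<omega>\<^sup>2 * (bump_sum y)\<^sup>2) = 0"
    by (simp add: integral_unique)
  have int: "set_integrable lebesgue {0..2} (\<lambda>y. (bump_sum y)\<^sup>2)"
    by (intro absolutely_integrable_continuous_real continuous_intros bump_sum_continuous)
  have "set_integrable lebesgue {0..2} (\<lambda>y. (bump_sum_deriv y)\<^sup>2 - \<omega>\<^sup>2 * (bump_sum y)\<^sup>2)"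
    using int bump_sum_deriv_integrable(2)[of 0 2] by (intro set_integral_diff) auto
  then have "(LINT y:{0..2}|lebesgue. (bump_sum_deriv y)\<^sup>2 - \<omega>\<^sup>2 * (bump_sum y)\<^sup>2) = 0"
    using 0 by (simp add: set_lebesgue_integral_eq_integral(2))
  then show ?thesis
    using int bump_sum_deriv_integrable(2)[of 0 2] by (simp add: \<omega>_def)
qed

lemma bump_sum_pos:
  assumes i: "i < k" "c i \<noteq> 0"
  shows "0 < (LINT y:{0..2}|lebesgue. (bump_sum y)\<^sup>2)"
proof (rule ccontr)
  assume "\<not> ?thesis"
  moreover have int: "set_integrable lebesgue {0..2} (\<lambda>y. (bump_sum y)\<^sup>2)"
    by (intro absolutely_integrable_continuous_real continuous_intros bump_sum_continuous)
  moreover have "0 \<le> (LINT y:{0..2}|lebesgue. (bump_sum y)\<^sup>2)"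
    by (simp add: set_lebesgue_integral_def)
  ultimately have "integral {0..2} (\<lambda>y. (bump_sum y)\<^sup>2) = 0"
    by (simp add: set_lebesgue_integral_eq_integral(2))
  moreover have "continuous_on {0..2} (\<lambda>y. (bump_sum y)\<^sup>2)"
    by (intro continuous_intros bump_sum_continuous)
  ultimately have zero: "bump_sum y = 0" if "y \<in> {0..2}" for y
    using integral_eq_0_iff[of 0 2 "\<lambda>y. (bump_sum y)\<^sup>2"] that by simp
  \<comment> \<open>At the midpoint of its support the bump has the value \<open>1\<close> or \<open>-1\<close>.\<close>
  define m where "m = (2 * real i + 1) / real k"
  have m: "0 < m" "m < 2" using i k by (auto simp: m_def field_simps)
  have "m \<noteq> 2 * real l / real k" for l
  proof
    assume "m = 2 * real l / real k"
    then have "real (2 * i + 1) = real (2 * l)" using k by (simp add: m_def field_simps)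
    then have "2 * i + 1 = 2 * l" by (simp only: of_nat_eq_iff)
    then show False by presburger
  qed
  with m obtain j where j: "j < k" "\<And>i. bump k i m = (if i = j then sin (pi * real k / 2 * m) else 0)"
    using bump_support[OF k, of m] by metis
  have arg: "pi * real k / 2 * m = pi / 2 + real i * pi"
    using k by (simp add: m_def field_simps)
  have s: "sin (pi * real k / 2 * m) \<noteq> 0"
    unfolding arg by (simp add: sin_add)
  have "bump k i m = sin (pi * real k / 2 * m)"
    using k by (auto simp: bump_def m_def divide_right_mono)
  then have "i = j" using j(2)[of i] s by (auto split: if_splits)
  have "bump_sum m = (\<Sum>l<k. if l = j then c j * sin (pi * real k / 2 * m) else 0)"
    unfolding bump_sum_def by (intro sum.cong) (auto simp: j(2))
  then have "bump_sum m = c i * sin (pi * real k / 2 * m)" using j(1) \<open>i = j\<close> by simp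
  then show False using zero[of m] m s i by simp
qed

end

context comb_model
begin

text \<open>An upper bound for the Rayleigh quotient of the Laplacian gives a lower bound for that of its
  inverse: complete the square in \<open>flux w - g / \<omega>\<^sup>2\<close>, where the mixed term is known by Green's
  identity.\<close>

lemma green_form_trial:
  assumes w: "w \<in> mean_zero_fns"
    and fg: "sobolev_pair (\<lambda>q. complex_of_real (w q)) (\<lambda>q. complex_of_real (g q))"
    and omega: "0 < \<omega>" "(LINT z|M. (g z)\<^sup>2) \<le> \<omega>\<^sup>2 * ip w w"
  shows "1 / \<omega>\<^sup>2 * ip w w \<le> ip (green w) w"
proof -
  have w_int: "integrable M w" by (rule mean_zero_fns_integrable[OF w])
  note F = flux_real[OF w_int]
  have [measurable]: "g \<in> borel_measurable M"
    using fg measurable_compose[of "\<lambda>q. complex_of_real (g q)" M borel Re borel]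
    by (simp add: sobolev_pair_def)
  have g2: "integrable M (\<lambda>z. (g z)\<^sup>2)" using fg by (simp add: sobolev_pair_def)
  have g: "integrable M g" by (rule square_integrable_imp_integrable) (use g2 in auto)
  have flux_c: "flux (\<lambda>q. complex_of_real (w q)) z = complex_of_real (flux w z)" for z
    by (simp add: flux_def scaleR_conv_of_real flip: of_real_mult)
  have "(LINT z|M. flux (\<lambda>q. complex_of_real (w q)) z * complex_of_real (g z))
      = (LINT q|M. complex_of_real (w q) * complex_of_real (w q))"
    by (rule green_identity[OF fg]) (use w w_int in \<open>auto simp: mean_zero_fns_def\<close>)
  then have "complex_of_real (LINT z|M. flux w z * g z) = complex_of_real (ip w w)"
    by (simp add: flux_c ip_def flip: of_real_mult)
  then have Fg: "(LINT z|M. flux w z * g z) = ip w w" by (simp only: of_real_eq_iff)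
  have Fg_int: "integrable M (\<lambda>z. flux w z * g z)" by (rule integral_flux_mult(2)[OF w_int g])
  have FF_int: "integrable M (\<lambda>z. flux w z * flux w z)" by (rule integral_flux_mult(2)[OF w_int F(3)])
  define s where "s = 1 / \<omega>\<^sup>2"
  have s: "0 < s" "s * \<omega>\<^sup>2 = 1" using omega by (auto simp: s_def)
  have "0 \<le> (LINT z|M. (flux w z - s * g z)\<^sup>2)" by simp
  also have "(\<lambda>z. (flux w z - s * g z)\<^sup>2) = (\<lambda>z. flux w z * flux w z - (2 * s) * (flux w z * g z) + s\<^sup>2 * (g z)\<^sup>2)"
    by (auto simp: power2_eq_square algebra_simps)
  also have "(LINT z|M. flux w z * flux w z - (2 * s) * (flux w z * g z) + s\<^sup>2 * (g z)\<^sup>2)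
      = ip (green w) w - 2 * s * ip w w + s\<^sup>2 * (LINT z|M. (g z)\<^sup>2)"
    using FF_int Fg_int g2 ip_green[OF w w] by (simp add: Fg ip_commute)
  also have "s\<^sup>2 * (LINT z|M. (g z)\<^sup>2) \<le> s\<^sup>2 * (\<omega>\<^sup>2 * ip w w)"
    using omega by (intro mult_left_mono) auto
  also have "s\<^sup>2 * (\<omega>\<^sup>2 * ip w w) = s * ip w w"
    using s by (simp add: power2_eq_square)
  finally show ?thesis by (simp add: s_def)
qed

text \<open>The backbone followed by the first tooth is a path of length 2. A function on
  \<open>[0, 2]\<close> is transplanted to that path and extended by constants to the other teeth.\<close>

definition path_coord :: "real \<Rightarrow> real" where
  "path_coord q = (if 2 \<le> q \<and> q \<le> 3 then q - 1 else base q)"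

lemma path_coord_simps:
  "q \<in> {0..1} \<Longrightarrow> path_coord q = q"
  "q \<in> tooth 1 \<Longrightarrow> path_coord q = q - 1"
  "q \<in> tooth n \<Longrightarrow> 2 \<le> n \<Longrightarrow> path_coord q = foot n"
proof -
  show "q \<in> {0..1} \<Longrightarrow> path_coord q = q" by (simp add: path_coord_def base_def)
  show "q \<in> tooth 1 \<Longrightarrow> path_coord q = q - 1" by (simp add: path_coord_def tooth_def)
  assume q: "q \<in> tooth n" "2 \<le> n"
  then have "\<not> q \<le> 3" by (auto simp: tooth_def)
  then show "path_coord q = foot n" using base_tooth[of q n] q by (simp add: path_coord_def)
qed

lemma path_coord_measurable [measurable]: "path_coord \<in> borel_measurable borel"
  unfolding path_coord_def[abs_def] by measurable

lemma integral_M_ge_path: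
  fixes h :: "real \<Rightarrow> real"
  assumes h: "integrable M h" "\<And>z. 0 \<le> h z"
  shows "(LINT z:{0..1}|lebesgue. h z) + (LINT z:tooth 1|lebesgue. h z) \<le> (LINT z|M. h z)"
proof -
  have "(\<Sum>n<1. LINT z:tooth (Suc n)|lebesgue. h z) \<le> (\<Sum>n. LINT z:tooth (Suc n)|lebesgue. h z)"
    using integral_M_sums[OF h(1)] h(2)
    by (intro sum_le_suminf) (auto simp: sums_iff set_lebesgue_integral_def)
  then show ?thesis using integral_M_sums[OF h(1)] by (simp add: sums_iff)
qed

lemma integral_M_eq_path:
  fixes h :: "real \<Rightarrow> real"
  assumes h: "integrable M h" "\<And>n z. 2 \<le> n \<Longrightarrow> z \<in> tooth n \<Longrightarrow> h z = 0"
  shows "(LINT z|M. h z) = (LINT z:{0..1}|lebesgue. h z) + (LINT z:tooth 1|lebesgue. h z)"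
proof -
  have "(LINT z:tooth (Suc n)|lebesgue. h z) = 0" if "n \<notin> {0}" for n
  proof -
    have "(LINT z:tooth (Suc n)|lebesgue. h z) = (LINT z:tooth (Suc n)|lebesgue. 0)"
      using h(2)[of "Suc n"] that by (intro set_lebesgue_integral_cong) auto
    then show ?thesis by simp
  qed
  then have "(\<lambda>n. LINT z:tooth (Suc n)|lebesgue. h z) sums (\<Sum>n\<in>{0}. LINT z:tooth (Suc n)|lebesgue. h z)"
    by (intro sums_finite) auto
  from sums_unique2[OF integral_M_sums[OF h(1)] this] show ?thesis by simp
qed

lemma integral_path_halves:
  fixes h :: "real \<Rightarrow> real"
  assumes "set_integrable lebesgue {0..2} h"
    and "\<And>z. z \<in> {0..1} \<Longrightarrow> h' z = h z" "\<And>z. z \<in> tooth 1 \<Longrightarrow> h' z = h (z - 1)"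
  shows "(LINT z:{0..1}|lebesgue. h' z) + (LINT z:tooth 1|lebesgue. h' z) = (LINT z:{0..2}|lebesgue. h z)"
proof -
  have "(LINT z:{0..1}|lebesgue. h' z) = (LINT z:{0..1}|lebesgue. h z)"
    using assms(2) by (intro set_lebesgue_integral_cong) auto
  moreover have "(LINT z:tooth 1|lebesgue. h' z) = (LINT z:{1..2}|lebesgue. h z)"
  proof -
    have t: "tooth 1 = {2..3}" by (simp add: tooth_def)
    have "set_integrable lebesgue {-1 + 2..-1 + 3} h"
      by (rule set_integrable_subset[OF assms(1)]) auto
    from set_integral_Icc_shift(2)[OF this]
    have "(LINT z:{2..3}|lebesgue. h (-1 + z)) = (LINT z:{1..2}|lebesgue. h z)" by simp
    moreover have "(LINT z:tooth 1|lebesgue. h' z) = (LINT z:{2..3}|lebesgue. h (-1 + z))"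
      using assms(3) unfolding t by (intro set_lebesgue_integral_cong) auto
    ultimately show ?thesis by simp
  qed
  moreover have "(LINT z:{0..2}|lebesgue. h z) = (LINT z:{0..1}|lebesgue. h z) + (LINT z:{1..2}|lebesgue. h z)"
    by (rule set_integral_Icc_combine) (use assms(1) in auto)
  ultimately show ?thesis by simp
qed

lemma bump_trial:
  assumes k: "1 \<le> k" and c: "\<exists>i<k. c i \<noteq> 0"
    and mean: "(\<lambda>q. \<Sum>i<k. c i * bump k i (path_coord q)) \<in> mean_zero_fns"
  shows "0 < ip (\<lambda>q. \<Sum>i<k. c i * bump k i (path_coord q)) (\<lambda>q. \<Sum>i<k. c i * bump k i (path_coord q)) \<and>
    1 / (pi * real k / 2)\<^sup>2 * ip (\<lambda>q. \<Sum>i<k. c i * bump k i (path_coord q)) (\<lambda>q. \<Sum>i<k. c i * bump k i (path_coord q))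
      \<le> ip (green (\<lambda>q. \<Sum>i<k. c i * bump k i (path_coord q))) (\<lambda>q. \<Sum>i<k. c i * bump k i (path_coord q))"
proof -
  define W where "W = bump_sum k c"
  define W' where "W' = bump_sum_deriv k c"
  note [measurable] = bump_sum_measurable[OF k, of c, folded W_def W'_def]
  define w where "w q = W (path_coord q)" for q
  define g where "g q = (if q \<le> 1 then W' q else if q \<le> 3 then W' (q - 1) else 0)" for q
  have w_alt: "(\<lambda>q. \<Sum>i<k. c i * bump k i (path_coord q)) = w"
    by (simp add: w_def[abs_def] W_def bump_sum_def[OF k])
  have w0: "w \<in> mean_zero_fns" using mean w_alt by simp
  have g_simps: "z \<in> {0..1} \<Longrightarrow> g z = W' z" "z \<in> tooth 1 \<Longrightarrow> g z = W' (z - 1)"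
      "2 \<le> n \<Longrightarrow> z \<in> tooth n \<Longrightarrow> g z = 0" for z n
    by (auto simp: g_def tooth_def)
  define C where "C = (\<Sum>i<k. \<bar>c i\<bar> * (pi * real k / 2))"
  have C: "\<bar>W' y\<bar> \<le> C" for y unfolding W'_def C_def by (rule bump_sum_deriv_bound[OF k])
  have C0: "0 \<le> C" using C[of 0] by simp
  have gC: "\<bar>g q\<bar> \<le> C" for q using C C0 by (simp add: g_def)
  have [measurable]: "g \<in> borel_measurable borel" unfolding g_def[abs_def] by measurable
  have gM: "g \<in> borel_measurable M" by (rule borel_measurable_M) measurable
  have g2: "integrable M (\<lambda>z. (g z)\<^sup>2)"
  proof (rule bounded_integrable)
    show "(\<lambda>z. (g z)\<^sup>2) \<in> borel_measurable M" by (rule borel_measurable_M) measurable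
    show "\<bar>(g q)\<^sup>2\<bar> \<le> C\<^sup>2" for q using power_mono[OF gC[of q] abs_ge_zero, of 2] by simp
  qed
  have prim: "primitive_on a b (\<lambda>y. complex_of_real (W y)) (\<lambda>y. complex_of_real (W' y))" if "a \<le> b" for a b
    unfolding W_def W'_def by (rule bump_sum_primitive[OF k that])
  have fg: "sobolev_pair (\<lambda>q. complex_of_real (w q)) (\<lambda>q. complex_of_real (g q))"
  proof (rule sobolev_pairI)
    show "(\<lambda>q. complex_of_real (g q)) \<in> borel_measurable M" using gM by measurable
    show "integrable M (\<lambda>z. (norm (complex_of_real (g z)))\<^sup>2)" using g2 by simp
    show "primitive_on 0 1 (\<lambda>q. complex_of_real (w q)) (\<lambda>q. complex_of_real (g q))"
      by (rule primitive_on_cong[OF prim]) (auto simp: w_def path_coord_simps g_simps)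
    fix n :: nat assume n: "1 \<le> n"
    show "primitive_on (2 * real n) (2 * real n + foot n) (\<lambda>q. complex_of_real (w q)) (\<lambda>q. complex_of_real (g q))"
    proof (cases "n = 1")
      case True
      have "primitive_on (-1 + 2) (-1 + 3) (\<lambda>y. complex_of_real (W y)) (\<lambda>y. complex_of_real (W' y))"
        by (rule prim) simp
      from primitive_on_shift[OF this]
      have "primitive_on 2 3 (\<lambda>y. complex_of_real (W (-1 + y))) (\<lambda>y. complex_of_real (W' (-1 + y)))" .
      then have "primitive_on 2 3 (\<lambda>q. complex_of_real (w q)) (\<lambda>q. complex_of_real (g q))"
        by (rule primitive_on_cong) (auto simp: w_def path_coord_simps g_simps tooth_def)
      then show ?thesis using True by simp
    next
      case False
      then have n2: "2 \<le> n" using n by simp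
      have "primitive_on (2 * real n) (2 * real n + foot n) (\<lambda>_. complex_of_real (W (foot n))) (\<lambda>_. 0)"
        by (simp add: primitive_on_def set_integrable_def)
      then show ?thesis
        by (rule primitive_on_cong)
          (use foot_bounds(3)[of n] n2 path_coord_simps(3)[OF _ n2] g_simps(3)[OF n2] in \<open>auto simp: w_def tooth_def\<close>)
    qed
    have f01: "foot n \<in> {0..1}" and t: "2 * real n \<in> tooth n"
      using foot_bounds[of n] by (auto simp: tooth_def)
    show "complex_of_real (w (2 * real n)) = complex_of_real (w (foot n))"
    proof (cases "n = 1")
      case True
      then show ?thesis using path_coord_simps(1)[OF f01] path_coord_simps(2)[of 2] t by (simp add: w_def)
    next
      case False
      then have n2: "2 \<le> n" using n by simp
      show ?thesis using path_coord_simps(1)[OF f01] path_coord_simps(3)[OF t n2] by (simp add: w_def)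
    qed
  qed
  have W2_int: "set_integrable lebesgue {0..2} (\<lambda>y. (W y)\<^sup>2)" unfolding W_def
    by (intro absolutely_integrable_continuous_real continuous_intros bump_sum_continuous[OF k])
  have "(LINT z|M. (g z)\<^sup>2) = (LINT z:{0..1}|lebesgue. (g z)\<^sup>2) + (LINT z:tooth 1|lebesgue. (g z)\<^sup>2)"
    by (rule integral_M_eq_path[OF g2]) (simp add: g_simps(3))
  also have "\<dots> = (LINT y:{0..2}|lebesgue. (W' y)\<^sup>2)"
    by (rule integral_path_halves) (auto simp: g_simps W'_def bump_sum_deriv_integrable(2)[OF k])
  also have "\<dots> = (pi * real k / 2)\<^sup>2 * (LINT y:{0..2}|lebesgue. (W y)\<^sup>2)"
    unfolding W_def W'_def by (rule bump_sum_energy[OF k])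
  finally have E: "(LINT z|M. (g z)\<^sup>2) = (pi * real k / 2)\<^sup>2 * (LINT y:{0..2}|lebesgue. (W y)\<^sup>2)" .
  have "(LINT y:{0..2}|lebesgue. (W y)\<^sup>2) = (LINT z:{0..1}|lebesgue. w z * w z) + (LINT z:tooth 1|lebesgue. w z * w z)"
    by (rule integral_path_halves[OF W2_int, symmetric]) (auto simp: w_def path_coord_simps power2_eq_square)
  also have "\<dots> \<le> ip w w"
    unfolding ip_def by (rule integral_M_ge_path[OF mean_zero_fns_mult_integrable[OF w0 w0]]) simp
  finally have norm: "(LINT y:{0..2}|lebesgue. (W y)\<^sup>2) \<le> ip w w" .
  have pos: "0 < (LINT y:{0..2}|lebesgue. (W y)\<^sup>2)"
    using c bump_sum_pos[OF k] unfolding W_def by blast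
  have "1 / (pi * real k / 2)\<^sup>2 * ip w w \<le> ip (green w) w"
    by (rule green_form_trial[OF w0 fg]) (use k norm E in \<open>auto intro!: mult_left_mono\<close>)
  then show ?thesis using pos norm unfolding w_alt by simp
qed

text \<open>One of the \<open>k\<close> dimensions of the trial space is spent on the condition of mean zero; the constant
  eigenfunction makes up for it later.\<close>

lemma comb_green_eigenfunctions:
  assumes k: "1 \<le> k"
  shows "\<exists>e \<rho>. (\<forall>i<k - 1. e i \<in> mean_zero_fns \<and> 1 / (pi * real k / 2)\<^sup>2 \<le> \<rho> i \<and>
      green (e i) = (\<lambda>q. \<rho> i * e i q) \<and> 0 < ip (e i) (e i)) \<and>
    (\<forall>i<k - 1. \<forall>l<k - 1. i \<noteq> l \<longrightarrow> ip (e i) (e l) = 0)"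
proof (rule green_eigenfunctions[where k = k and w = "\<lambda>i q. bump k i (path_coord q)" and C = 1])
  show "(\<lambda>q. bump k i (path_coord q)) \<in> borel_measurable M" for i
    by (rule borel_measurable_M) measurable
qed (use k bump_bound bump_trial[OF k] in auto)

end

section \<open>From the metric graph to the real line\<close>

text \<open>A derivative in the sense of \<open>has_wderiv\<close> is unique almost everywhere, because a function
  whose integrals over all intervals \<open>[0, x]\<close> vanish has vanishing integrals over all
  measurable sets, by a Dynkin system argument.\<close>

lemma AE_zero_if_integrals_zero:
  fixes d :: "real \<Rightarrow> 'b::{banach, second_countable_topology}"
  assumes d: "integrable (lebesgue_on {0..l}) d" and l: "0 \<le> l"
    and zero: "\<And>x. x \<in> {0..l} \<Longrightarrow> (LINT y:{0..x}|lebesgue. d y) = 0"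
  shows "AE y in lebesgue_on {0..l}. d y = 0"
proof -
  interpret finite_measure "lebesgue_on {0..l}" by (rule finite_measure_lebesgue_on) auto
  define h where "h y = indicator {0..l} y *\<^sub>R d y" for y
  have h: "integrable lebesgue h"
    using d by (simp add: lebesgue_on_eq_set_integral set_integrable_def h_def[abs_def])
  have h_int: "set_integrable lebesgue A h" if "A \<in> sets lebesgue" for A
    using integrable_mult_indicator[OF that h] by (simp add: set_integrable_def)
  have total: "(LINT y|lebesgue. h y) = 0"
    using zero[of l] l by (simp add: set_lebesgue_integral_def h_def)
  have borel: "(LINT y:A|lebesgue. h y) = 0" if "A \<in> sigma_sets UNIV (range (\<lambda>a::real. {..a}))" for A
  proof -
    have gen: "Int_stable (range (\<lambda>a::real. {..a}))"
    proof (rule Int_stableI)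
      fix A B assume "A \<in> range (\<lambda>a::real. {..a})" "B \<in> range (\<lambda>a::real. {..a})"
      then obtain a b where "A = {..a}" "B = {..b}" by auto
      then have "A \<inter> B = {..min a b}" by auto
      then show "A \<inter> B \<in> range (\<lambda>a::real. {..a})" by auto
    qed
    have leb: "B \<in> sets lebesgue" if "B \<in> sigma_sets UNIV (range (\<lambda>a::real. {..a}))" for B
    proof -
      have "sets (borel :: real measure) = sigma_sets UNIV (range (\<lambda>a::real. {..a}))"
        by (subst borel_eq_atMost) (simp add: sets_measure_of)
      then show ?thesis using that by auto
    qed
    show ?thesis
      using gen subset_UNIV[of "range (\<lambda>a::real. {..a})", folded Pow_UNIV] that
    proof (induction A rule: sigma_sets_induct_disjoint)
      case (basic A)
      then obtain a where A: "A = {..a}" by auto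
      show ?case
      proof (cases "a < 0")
        case True
        have "(LINT y:A|lebesgue. h y) = integral\<^sup>L (lebesgue :: real measure) (\<lambda>_. 0)"
          unfolding set_lebesgue_integral_def
          by (rule Bochner_Integration.integral_cong) (use True in \<open>auto simp: A h_def indicator_def\<close>)
        then show ?thesis by simp
      next
        case False
        have "(LINT y:A|lebesgue. h y) = (LINT y:{0..min a l}|lebesgue. d y)"
          unfolding set_lebesgue_integral_def
          by (rule Bochner_Integration.integral_cong) (use False in \<open>auto simp: A h_def indicator_def\<close>)
        then show ?thesis using zero[of "min a l"] False l by auto
      qed
    next
      case empty
      show ?case by (simp add: set_lebesgue_integral_def)
    next
      case (compl A)
      have "(LINT y:UNIV - A|lebesgue. h y) = (LINT y|lebesgue. h y - indicator A y *\<^sub>R h y)"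
        unfolding set_lebesgue_integral_def
        by (intro Bochner_Integration.integral_cong) (auto simp: indicator_def)
      also have "\<dots> = 0"
        using h h_int[OF leb[OF compl.hyps(1)]] compl.IH total
        by (simp add: set_integrable_def set_lebesgue_integral_def)
      finally show ?case .
    next
      case (union A)
      have "(LINT y:(\<Union>i. A i)|lebesgue. h y) = (\<Sum>i. LINT y:A i|lebesgue. h y)"
        using union leb
        by (intro lebesgue_integral_countable_add h_int sets.countable_UN)
          (auto simp: disjoint_family_on_def image_subset_iff)
      then show ?case using union by simp
    qed
  qed
  show ?thesis
  proof (rule density_zero[OF d])
    fix A assume A: "A \<in> sets (lebesgue_on {0..l})"
    then have A': "A \<in> sets lebesgue" "A \<subseteq> {0..l}" by (auto simp: sets_restrict_space)
    obtain S N N' where SN: "A = S \<union> N" "N \<subseteq> N'" "N' \<in> null_sets lborel" "S \<in> sets lborel"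
      using A'(1) by (auto elim: sets_completionE)
    have S: "S \<in> sigma_sets UNIV (range (\<lambda>a::real. {..a}))"
      using SN(4) by (subst (asm) sets_lborel) (subst (asm) borel_eq_atMost, simp add: sets_measure_of)
    have S_leb: "S \<in> sets lebesgue" using SN(4) by auto
    have N: "N \<in> null_sets lebesgue" by (rule null_sets_completion_subset[OF SN(2)]) (rule null_sets_completionI[OF SN(3)])
    have "(LINT y:A|lebesgue. h y) = (LINT y:S|lebesgue. h y)"
    proof (rule set_integral_null_delta[OF h A'(1) S_leb])
      have "(A - S) \<union> (S - A) \<subseteq> N" using SN(1) by auto
      then show "(A - S) \<union> (S - A) \<in> null_sets lebesgue" by (rule null_sets_completion_subset[OF _ N])
    qed
    then have "(LINT y:A|lebesgue. h y) = 0" using borel[OF S] by simp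
    moreover have "set_lebesgue_integral (lebesgue_on {0..l}) A d = (LINT y:A|lebesgue. h y)"
      unfolding set_lebesgue_integral_def
      by (subst integral_restrict_space) (auto simp: h_def indicator_def intro!: Bochner_Integration.integral_cong)
    ultimately show "set_lebesgue_integral (lebesgue_on {0..l}) A d = 0" by simp
  qed
qed

lemma has_wderiv_integrable:
  assumes "has_wderiv l u g" "0 \<le> l"
  shows "set_integrable lebesgue {0..l} g" "g \<in> borel_measurable (lebesgue_on {0..l})"
    "set_integrable lebesgue {0..l} (\<lambda>x. (norm (g x))\<^sup>2)"
proof -
  interpret finite_measure "lebesgue_on {0..l}" by (rule finite_measure_lebesgue_on) auto
  have g: "g \<in> borel_measurable (lebesgue_on {0..l})" "integrable (lebesgue_on {0..l}) (\<lambda>x. (norm (g x))\<^sup>2)"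
    using assms by (auto simp: has_wderiv_def square_integrable_def)
  then show "g \<in> borel_measurable (lebesgue_on {0..l})" "set_integrable lebesgue {0..l} (\<lambda>x. (norm (g x))\<^sup>2)"
    by (simp_all add: lebesgue_on_eq_set_integral)
  have le: "y \<le> 1 + y\<^sup>2" for y :: real
    using sum_power2_ge_zero[of "y - 1/2" 0] by (simp add: power2_eq_square algebra_simps)
  have "integrable (lebesgue_on {0..l}) g"
    by (rule Bochner_Integration.integrable_bound[of _ "\<lambda>x. 1 + (norm (g x))\<^sup>2"])
      (use g le in \<open>auto intro!: AE_I2\<close>)
  then show "set_integrable lebesgue {0..l} g" by (simp add: lebesgue_on_eq_set_integral)
qed

lemma has_wderiv_eq:
  assumes "has_wderiv l u g" "x \<in> {0..l}"
  shows "u x = u 0 + (LINT y:{0..x}|lebesgue. g y)"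
proof -
  have "u x = u 0 + integral\<^sup>L (lebesgue_on {0..x}) g" using assms unfolding has_wderiv_def by blast
  then show ?thesis by (simp add: lebesgue_on_eq_set_integral)
qed

lemma has_wderiv_wderiv:
  assumes "u \<in> H1_interval l"
  shows "has_wderiv l u (wderiv l u)"
proof -
  obtain g where "has_wderiv l u g" using assms by (auto simp: H1_interval_def)
  then show ?thesis unfolding wderiv_def by (rule someI[of "has_wderiv l u"])
qed

lemma wderiv_unique:
  assumes u: "has_wderiv l u g" and l: "0 \<le> l"
  shows "AE y in lebesgue_on {0..l}. wderiv l u y = g y"
proof -
  have u': "has_wderiv l u (wderiv l u)" using u by (intro has_wderiv_wderiv) (auto simp: H1_interval_def)
  note int = has_wderiv_integrable(1)[OF u l] has_wderiv_integrable(1)[OF u' l]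
  have "AE y in lebesgue_on {0..l}. wderiv l u y - g y = 0"
  proof (rule AE_zero_if_integrals_zero[OF _ l])
    show "integrable (lebesgue_on {0..l}) (\<lambda>y. wderiv l u y - g y)"
      using int by (intro Bochner_Integration.integrable_diff) (auto simp: lebesgue_on_eq_set_integral)
    fix x assume x: "x \<in> {0..l}"
    have "set_integrable lebesgue {0..x} g" "set_integrable lebesgue {0..x} (wderiv l u)"
      using int x by (auto elim!: set_integrable_subset)
    then show "(LINT y:{0..x}|lebesgue. wderiv l u y - g y) = 0"
      using has_wderiv_eq[OF u x] has_wderiv_eq[OF u' x] by simp
  qed
  then show ?thesis by eventually_elim simp
qed

context comb_model
begin

abbreviation G :: "(comb_vertex, comb_edge) mgraph" where "G \<equiv> diagonal_comb \<alpha>"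

definition len :: "comb_edge \<Rightarrow> real" where "len e = glen G e"

text \<open>Backbone edges start at their left foot and teeth at their foot, as in the charts of the graph, so
  that every chart becomes the translation by \<open>off e\<close>.\<close>

definition off :: "comb_edge \<Rightarrow> real" where
  "off e = (case e of Tooth n \<Rightarrow> 2 * real n | Backbone n \<Rightarrow> foot (n + 1))"

definition edge_ivl :: "comb_edge \<Rightarrow> real set" where "edge_ivl e = {off e..off e + len e}"

lemma len_simps [simp]: "len (Tooth n) = foot n" "len (Backbone n) = foot n - foot (Suc n)"
  by (simp_all add: len_def diagonal_comb_def foot_def)

lemma off_simps [simp]: "off (Tooth n) = 2 * real n" "off (Backbone n) = foot (Suc n)"
  by (simp_all add: off_def)

lemma edges: "gedges G = Tooth ` {1..} \<union> Backbone ` {1..}"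
  by (simp add: diagonal_comb_def)

lemma edge_cases:
  assumes "e \<in> gedges G"
  obtains (Tooth) n where "1 \<le> n" "e = Tooth n" | (Backbone) n where "1 \<le> n" "e = Backbone n"
  using assms by (auto simp: edges)

lemma len_pos: "e \<in> gedges G \<Longrightarrow> 0 < len e"
  by (erule edge_cases) (auto simp: foot_bounds foot_less)

lemma edge_ivl_tooth: "edge_ivl (Tooth n) = tooth n"
  by (simp add: edge_ivl_def tooth_def)

lemma edge_ivl_backbone: "edge_ivl (Backbone n) = {foot (Suc n)..foot n}"
  by (simp add: edge_ivl_def)

lemma edge_ivl_subset:
  assumes "e \<in> gedges G"
  shows "edge_ivl e \<subseteq> comb_set"
  using assms
proof (cases rule: edge_cases)
  case (Tooth n)
  then show ?thesis using tooth_subset by (simp add: edge_ivl_tooth)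
next
  case (Backbone n)
  then have "edge_ivl e \<subseteq> {0..1}"
    using foot_bounds[of n] foot_bounds(3)[of "Suc n"] by (auto simp: edge_ivl_backbone)
  then show ?thesis using backbone_subset by auto
qed

lemma edge_ivl_sets [measurable]: "edge_ivl e \<in> sets lebesgue"
  by (simp add: edge_ivl_def)

lemma foot_antimono: "1 \<le> m \<Longrightarrow> m \<le> n \<Longrightarrow> foot n \<le> foot m"
  using foot_less[of m n] by (cases "m = n") auto

lemma backbone_piece_unique:
  assumes "1 \<le> m" "1 \<le> n" "foot (Suc m) < z" "z \<le> foot m" "foot (Suc n) < z" "z \<le> foot n"
  shows "m = n"
proof (rule ccontr)
  assume "m \<noteq> n"
  then consider "Suc m \<le> n" | "Suc n \<le> m" by linarith
  then show False
    using foot_antimono[of "Suc m" n] foot_antimono[of "Suc n" m] assms by cases auto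
qed

lemma backbone_piece_ex:
  assumes "0 < z" "z \<le> 1"
  shows "\<exists>n\<ge>1. foot (Suc n) < z \<and> z \<le> foot n"
proof -
  have "eventually (\<lambda>n. foot n < z) sequentially"
    using foot_tendsto_0 assms(1) by (rule order_tendstoD(2))
  then have ex: "\<exists>n. foot (Suc n) < z" by (auto simp: eventually_sequentially intro: le_SucI)
  define m where "m = (LEAST n. foot (Suc n) < z)"
  have m: "foot (Suc m) < z" unfolding m_def using ex by (rule LeastI_ex)
  then have "m \<noteq> 0" using assms(2) by (intro notI) simp
  then obtain m' where m': "m = Suc m'" by (cases m) auto
  have "\<not> foot (Suc m') < z" using not_less_Least[of m' "\<lambda>n. foot (Suc n) < z"] m' by (simp add: m_def)
  then show ?thesis using m m' by (intro exI[of _ m]) auto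
qed

text \<open>Leaving out the left foot of every backbone edge makes the edges disjoint and does not change
  integrals.\<close>

lemma backbone_pieces:
  "(\<Union>n. {foot (Suc (Suc n))<..foot (Suc n)}) = {0<..1}"
  "m \<noteq> n \<Longrightarrow> {foot (Suc (Suc m))<..foot (Suc m)} \<inter> {foot (Suc (Suc n))<..foot (Suc n)} = {}"
proof -
  show "(\<Union>n. {foot (Suc (Suc n))<..foot (Suc n)}) = {0<..1}"
  proof (intro set_eqI iffI)
    fix z assume "z \<in> (\<Union>n. {foot (Suc (Suc n))<..foot (Suc n)})"
    then obtain n where "foot (Suc (Suc n)) < z" "z \<le> foot (Suc n)" by auto
    then show "z \<in> {0<..1}"
      using foot_bounds(3)[of "Suc (Suc n)"] foot_bounds(2)[of "Suc n"] by auto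
  next
    fix z :: real assume "z \<in> {0<..1}"
    then obtain n where n: "1 \<le> n" "foot (Suc n) < z" "z \<le> foot n" using backbone_piece_ex[of z] by auto
    then show "z \<in> (\<Union>n. {foot (Suc (Suc n))<..foot (Suc n)})"
      by (intro UN_I[of "n - 1"]) auto
  qed
  show "{foot (Suc (Suc m))<..foot (Suc m)} \<inter> {foot (Suc (Suc n))<..foot (Suc n)} = {}" if "m \<noteq> n"
    using backbone_piece_unique[of "Suc m" "Suc n"] that by fastforce
qed

lemma has_sum_edges:
  fixes F :: "comb_edge \<Rightarrow> 'b::topological_comm_monoid_add"
  assumes "((\<lambda>n. F (Tooth (Suc n))) has_sum a) UNIV" "((\<lambda>n. F (Backbone (Suc n))) has_sum b) UNIV"
  shows "(F has_sum (a + b)) (gedges G)"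
proof -
  have range: "Tooth ` {1..} = range (\<lambda>n. Tooth (Suc n))" "Backbone ` {1..} = range (\<lambda>n. Backbone (Suc n))"
    by (auto simp: image_iff) (metis Suc_pred' One_nat_def Suc_le_eq)+
  have "(F has_sum a) (range (\<lambda>n. Tooth (Suc n)))" "(F has_sum b) (range (\<lambda>n. Backbone (Suc n)))"
    using assms by (subst has_sum_reindex; auto simp: inj_on_def o_def)+
  then show ?thesis unfolding edges range by (rule has_sum_Un_disjoint) auto
qed

lemma has_sum_edge_integrals:
  fixes h :: "real \<Rightarrow> 'b::{banach, second_countable_topology}"
  assumes h: "integrable M h"
  shows "((\<lambda>e. LINT z:edge_ivl e|lebesgue. h z) has_sum (LINT z|M. h z)) (gedges G)"
proof -
  let ?U = "\<Union>n. tooth (Suc n)"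
  have U: "?U \<subseteq> comb_set" by (auto simp: comb_set_def)
  have "((\<lambda>n. LINT z:tooth (Suc n)|lebesgue. h z) has_sum (LINT z:?U|lebesgue. h z)) UNIV"
    by (rule has_sum_set_integral_disjoint_union(1))
      (use tooth_disjoint U in \<open>auto intro!: integrable_M_subset[OF h]\<close>)
  moreover have "((\<lambda>n. LINT z:{foot (Suc (Suc n))<..foot (Suc n)}|lebesgue. h z) has_sum
      (LINT z:(\<Union>n. {foot (Suc (Suc n))<..foot (Suc n)})|lebesgue. h z)) UNIV"
  proof (rule has_sum_set_integral_disjoint_union(1))
    show "set_integrable lebesgue (\<Union>n. {foot (Suc (Suc n))<..foot (Suc n)}) h"
      unfolding backbone_pieces(1) using backbone_subset by (intro integrable_M_subset[OF h]) auto
  qed (use backbone_pieces(2) in auto)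
  then have "((\<lambda>n. LINT z:edge_ivl (Backbone (Suc n))|lebesgue. h z) has_sum (LINT z:{0..1}|lebesgue. h z)) UNIV"
    unfolding backbone_pieces(1) set_integral_Ioc edge_ivl_backbone .
  ultimately have "((\<lambda>e. LINT z:edge_ivl e|lebesgue. h z) has_sum
      ((LINT z:?U|lebesgue. h z) + (LINT z:{0..1}|lebesgue. h z))) (gedges G)"
    by (intro has_sum_edges) (simp_all add: edge_ivl_tooth)
  moreover have "(LINT z|M. h z) = (LINT z:?U|lebesgue. h z) + (LINT z:{0..1}|lebesgue. h z)"
    using sums_unique2[OF integral_M_sums[OF h] has_sum_imp_sums[OF
      \<open>((\<lambda>n. LINT z:tooth (Suc n)|lebesgue. h z) has_sum (LINT z:?U|lebesgue. h z)) UNIV\<close>]]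
    by (simp add: algebra_simps)
  ultimately show ?thesis by simp
qed

definition edge_at :: "real \<Rightarrow> comb_edge" where
  "edge_at q = (if 1 < q then Tooth (nat \<lfloor>q / 2\<rfloor>)
    else Backbone (THE n. 1 \<le> n \<and> foot (Suc n) < q \<and> q \<le> foot n))"

lemma edge_at_eq:
  assumes e: "e \<in> gedges G" and y: "0 < y" "y \<le> len e"
  shows "edge_at (off e + y) = e"
  using e
proof (cases rule: edge_cases)
  case (Tooth n)
  then have "off e + y \<in> tooth n" using y by (auto simp: tooth_def)
  then show ?thesis using Tooth tooth_floor tooth_gt_1 by (simp add: edge_at_def)
next
  case (Backbone n)
  let ?q = "off e + y"
  have q: "foot (Suc n) < ?q" "?q \<le> foot n" using Backbone y by auto
  then have "\<not> 1 < ?q" using foot_bounds(2)[of n] by linarith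
  moreover have "(THE n. 1 \<le> n \<and> foot (Suc n) < ?q \<and> ?q \<le> foot n) = n"
    using q Backbone by (intro the_equality) (auto intro: backbone_piece_unique)
  ultimately show ?thesis using Backbone by (simp add: edge_at_def)
qed

text \<open>Functions given edge by edge define a function on the line. An interior foot of the backbone is
  assigned to the edge on its left; for derivatives, values at single points do not matter.\<close>

definition glue :: "(comb_edge \<Rightarrow> real \<Rightarrow> 'b) \<Rightarrow> real \<Rightarrow> 'b" where
  "glue w q = w (edge_at q) (q - off (edge_at q))"

lemma glue_edge: "e \<in> gedges G \<Longrightarrow> 0 < y \<Longrightarrow> y \<le> len e \<Longrightarrow> glue w (off e + y) = w e y"
  by (simp add: glue_def edge_at_eq)

lemma set_integral_glue:
  fixes w :: "comb_edge \<Rightarrow> real \<Rightarrow> 'b::{banach, second_countable_topology}"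
  assumes e: "e \<in> gedges G" and int: "set_integrable lebesgue {0..a} (w e)" and a: "a \<le> len e"
  shows "set_integrable lebesgue {off e..off e + a} (glue w)"
    and "(LINT z:{off e..off e + a}|lebesgue. glue w z) = (LINT y:{0..a}|lebesgue. w e y)"
proof -
  have eq: "glue w z = w e (- off e + 1 * z)" if "z \<in> {off e<..off e + a}" for z
    using glue_edge[OF e, of "z - off e" w] that a by simp
  have mem: "x \<in> {off e..off e + a} \<longleftrightarrow> - off e + 1 * x \<in> {0..a}" for x by auto
  note aff = set_integral_unit_affine[OF _ int mem]
  have "set_integrable lebesgue {off e<..off e + a} (glue w) \<longleftrightarrow>
      set_integrable lebesgue {off e<..off e + a} (\<lambda>z. w e (- off e + 1 * z))"
    by (intro set_integrable_cong) (auto simp: eq[simplified])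
  then show "set_integrable lebesgue {off e..off e + a} (glue w)"
    using aff(1) by (simp only: set_integral_Ioc abs_one simp_thms)
  have "(LINT z:{off e<..off e + a}|lebesgue. glue w z) = (LINT z:{off e<..off e + a}|lebesgue. w e (- off e + 1 * z))"
    by (intro set_lebesgue_integral_cong) (auto simp: eq[simplified])
  then show "(LINT z:{off e..off e + a}|lebesgue. glue w z) = (LINT y:{0..a}|lebesgue. w e y)"
    using aff(2) by (simp only: set_integral_Ioc abs_one simp_thms)
qed

lemma integrable_glue_nonneg:
  fixes w :: "comb_edge \<Rightarrow> real \<Rightarrow> real"
  assumes int: "\<And>e. e \<in> gedges G \<Longrightarrow> set_integrable lebesgue {0..len e} (w e)"
    and nonneg: "\<And>e y. 0 \<le> w e y"
    and summ: "(\<lambda>e. LINT y:{0..len e}|lebesgue. w e y) summable_on gedges G"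
  shows "integrable M (glue w)"
proof -
  have nn: "0 \<le> glue w z" for z by (simp add: glue_def nonneg)
  have summ_nat: "summable (\<lambda>n. LINT z:edge_ivl (E (Suc n))|lebesgue. glue w z)"
    if E: "inj E" "\<And>n. 1 \<le> n \<Longrightarrow> E n \<in> gedges G" for E
  proof -
    have "(\<lambda>e. LINT y:{0..len e}|lebesgue. w e y) summable_on (range (\<lambda>n. E (Suc n)))"
      by (rule summable_on_subset_banach[OF summ]) (use E in auto)
    then have "(\<lambda>n. LINT y:{0..len (E (Suc n))}|lebesgue. w (E (Suc n)) y) summable_on UNIV"
      by (subst (asm) summable_on_reindex) (use E in \<open>auto simp: inj_on_def inj_def o_def\<close>)
    then have "summable (\<lambda>n. LINT y:{0..len (E (Suc n))}|lebesgue. w (E (Suc n)) y)"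
      by (rule summable_on_imp_summable)
    moreover have "(LINT z:edge_ivl (E (Suc n))|lebesgue. glue w z) = (LINT y:{0..len (E (Suc n))}|lebesgue. w (E (Suc n)) y)" for n
    proof -
      have e: "E (Suc n) \<in> gedges G" by (rule E(2)) simp
      show ?thesis unfolding edge_ivl_def by (rule set_integral_glue(2)[where w = w, OF e int[OF e]]) simp
    qed
    ultimately show ?thesis by simp
  qed
  have int_edge: "set_integrable lebesgue (edge_ivl e) (glue w)" if "e \<in> gedges G" for e
    unfolding edge_ivl_def by (rule set_integral_glue(1)[where w = w, OF that int[OF that]]) simp
  have 1: "set_integrable lebesgue (\<Union>n. tooth (Suc n)) (glue w)"
  proof (rule set_integrable_disjoint_union_nonneg)
    show "summable (\<lambda>n. LINT z:tooth (Suc n)|lebesgue. glue w z)"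
      using summ_nat[of Tooth] by (simp add: inj_def edges edge_ivl_tooth)
    show "set_integrable lebesgue (tooth (Suc n)) (glue w)" for n
      using int_edge[of "Tooth (Suc n)"] by (simp add: edges edge_ivl_tooth)
  qed (use tooth_disjoint nn in auto)
  have 2: "set_integrable lebesgue (\<Union>n. {foot (Suc (Suc n))<..foot (Suc n)}) (glue w)"
  proof (rule set_integrable_disjoint_union_nonneg)
    show "summable (\<lambda>n. LINT z:{foot (Suc (Suc n))<..foot (Suc n)}|lebesgue. glue w z)"
      using summ_nat[of Backbone] by (simp add: inj_def edges edge_ivl_backbone set_integral_Ioc)
    show "set_integrable lebesgue {foot (Suc (Suc n))<..foot (Suc n)} (glue w)" for n
      using int_edge[of "Backbone (Suc n)"] by (simp add: edges edge_ivl_backbone set_integral_Ioc)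
  qed (use backbone_pieces(2) nn in auto)
  have "set_integrable lebesgue {0..1} (glue w)"
    using 2 unfolding backbone_pieces(1) set_integral_Ioc .
  then have "set_integrable lebesgue comb_set (glue w)"
    unfolding comb_set_def using 1 by (rule set_integrable_Un) auto
  then show ?thesis by (simp add: integrable_M_iff)
qed

lemma glue_measurable:
  fixes w :: "comb_edge \<Rightarrow> real \<Rightarrow> 'b::topological_space"
  assumes w: "\<And>e. e \<in> gedges G \<Longrightarrow> w e \<in> borel_measurable (lebesgue_on {0..len e})"
  shows "glue w \<in> borel_measurable M"
proof -
  define J where "J e = {off e<..off e + len e}" for e
  define Z where "Z = {0} \<union> range (\<lambda>n. 2 * real n)"
  have J_sub: "J e \<subseteq> comb_set" if "e \<in> gedges G" for e
    using edge_ivl_subset[OF that] by (auto simp: J_def edge_ivl_def)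
  have countable_edges: "countable (gedges G)" by (simp add: edges)
  let ?C = "J ` gedges G \<union> (\<lambda>z. {z}) ` (Z \<inter> comb_set)"
  show ?thesis
  proof (rule measurable_piecewise_restrict[of ?C])
    show "countable ?C" using countable_edges by (auto simp: Z_def)
    show "space M \<subseteq> \<Union> ?C"
    proof
      fix z assume "z \<in> space M"
      then have z: "z \<in> comb_set" by simp
      then show "z \<in> \<Union> ?C"
      proof (cases rule: comb_set_cases)
        case backbone
        show ?thesis
        proof (cases "z = 0")
          case True
          then show ?thesis using z by (auto simp: Z_def)
        next
          case False
          then obtain n where "1 \<le> n" "foot (Suc n) < z" "z \<le> foot n"
            using backbone_piece_ex[of z] backbone by auto
          then have "z \<in> J (Backbone n)" "Backbone n \<in> gedges G" by (auto simp: J_def edges)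
          then show ?thesis by blast
        qed
      next
        case (tooth n)
        show ?thesis
        proof (cases "z = 2 * real n")
          case True
          then show ?thesis using z by (auto simp: Z_def)
        next
          case False
          then have "z \<in> J (Tooth n)" "Tooth n \<in> gedges G" using tooth by (auto simp: J_def edges tooth_def)
          then show ?thesis by blast
        qed
      qed
    qed
    fix \<Omega> assume "\<Omega> \<in> ?C"
    then consider e where "e \<in> gedges G" "\<Omega> = J e" | z where "z \<in> comb_set" "\<Omega> = {z}" by auto
    then have "\<Omega> \<in> sets lebesgue \<and> \<Omega> \<subseteq> comb_set \<and> glue w \<in> borel_measurable (lebesgue_on \<Omega>)"
    proof cases
      case 1
      have "(\<lambda>z. - off e + 1 * z) \<in> lebesgue_on (J e) \<rightarrow>\<^sub>M lebesgue_on {0..len e}"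
        by (rule measurable_restrict_space3[OF measurable_lebesgue_affine]) (auto simp: J_def)
      from measurable_compose[OF this w[OF 1(1)]]
      have "(\<lambda>z. w e (- off e + 1 * z)) \<in> borel_measurable (lebesgue_on (J e))" .
      moreover have "glue w z = w e (- off e + 1 * z)" if "z \<in> J e" for z
        using glue_edge[OF 1(1), of "z - off e" w] that by (simp add: J_def)
      ultimately have "glue w \<in> borel_measurable (lebesgue_on (J e))"
        using measurable_cong[of "lebesgue_on (J e)" "glue w" "\<lambda>z. w e (- off e + 1 * z)" borel] by simp
      then show ?thesis using 1 J_sub by (auto simp: J_def)
    next
      case 2
      have "glue w \<in> borel_measurable (lebesgue_on {z})"
        using measurable_cong[of "lebesgue_on {z}" "glue w" "\<lambda>_. glue w z" borel] by simp
      then show ?thesis using 2 by auto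
    qed
    then show "\<Omega> \<inter> space M \<in> sets M" "glue w \<in> borel_measurable (restrict_space M \<Omega>)"
      by (auto simp: sets_restrict_space_iff Int_absorb1 Int_absorb2 restrict_restrict_space)
  qed
qed

text \<open>A Sobolev function on the graph is carried to the line by integrating its derivative from the foot
  at 1. This also gives it a value at \<open>0\<close>, which is not a point of the graph.\<close>

definition line_deriv :: "((comb_vertex, comb_edge) gpoint \<Rightarrow> complex) \<Rightarrow> real \<Rightarrow> complex" where
  "line_deriv \<phi> = glue (\<lambda>e. wderiv (len e) (grestr G \<phi> e))"

definition line_fn :: "((comb_vertex, comb_edge) gpoint \<Rightarrow> complex) \<Rightarrow> real \<Rightarrow> complex" where
  "line_fn \<phi> q = \<phi> (Vertex (Foot 1)) + path_integral (line_deriv \<phi>) q"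

lemma grestr_ends:
  assumes "e \<in> gedges G"
  shows "grestr G \<phi> e 0 = \<phi> (Vertex (gtail G e))" "grestr G \<phi> e (len e) = \<phi> (Vertex (ghead G e))"
  using len_pos[OF assms] by (auto simp: grestr_def gchart_def len_def)

lemma gtail_ghead [simp]:
  "gtail G (Tooth n) = Foot n" "gtail G (Backbone n) = Foot (Suc n)" "ghead G (Backbone n) = Foot n"
  "ghead G (Tooth n) = Tip n"
  by (simp_all add: diagonal_comb_def)

lemma H1_graph_has_wderiv:
  assumes "\<phi> \<in> H1_graph G" "e \<in> gedges G"
  shows "has_wderiv (len e) (grestr G \<phi> e) (wderiv (len e) (grestr G \<phi> e))"
  using assms by (intro has_wderiv_wderiv) (simp add: H1_graph_def len_def)

lemma H1_graph_sobolev_pair: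
  assumes phi: "\<phi> \<in> H1_graph G"
  shows "sobolev_pair (line_fn \<phi>) (line_deriv \<phi>)"
proof (rule sobolev_pair_path_integral)
  let ?w = "\<lambda>e. wderiv (len e) (grestr G \<phi> e)"
  note hw = has_wderiv_integrable[OF H1_graph_has_wderiv[OF phi] less_imp_le[OF len_pos]]
  show "line_deriv \<phi> \<in> borel_measurable M"
    unfolding line_deriv_def by (rule glue_measurable) (rule hw(2))
  have "integrable M (glue (\<lambda>e y. (norm (?w e y))\<^sup>2))"
  proof (rule integrable_glue_nonneg)
    show "(\<lambda>e. LINT y:{0..len e}|lebesgue. (norm (?w e y))\<^sup>2) summable_on gedges G"
    proof (rule summable_on_comparison_test)
      show "(\<lambda>e. H1_norm_sq (glen G e) (grestr G \<phi> e)) summable_on gedges G"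
        using phi by (simp add: H1_graph_def)
      show "(LINT y:{0..len e}|lebesgue. (norm (?w e y))\<^sup>2) \<le> H1_norm_sq (glen G e) (grestr G \<phi> e)" for e
      proof -
        have "(LINT y:{0..len e}|lebesgue. (norm (?w e y))\<^sup>2) = (LINT y|lebesgue_on {0..len e}. (norm (?w e y))\<^sup>2)"
          by (simp add: lebesgue_on_eq_set_integral)
        moreover have "0 \<le> (LINT y|lebesgue_on {0..len e}. (norm (grestr G \<phi> e y))\<^sup>2)" by simp
        ultimately show ?thesis unfolding H1_norm_sq_def len_def by linarith
      qed
      show "0 \<le> (LINT y:{0..len e}|lebesgue. (norm (?w e y))\<^sup>2)" for e
        by (simp add: set_lebesgue_integral_def)
    qed
  qed (use hw(3) in auto)
  then show "integrable M (\<lambda>z. (norm (line_deriv \<phi> z))\<^sup>2)"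
    by (simp add: line_deriv_def glue_def[abs_def])
qed (simp add: line_fn_def)

text \<open>Both sides have the same derivative on every edge. They agree at the foot of the first tooth, and
  from there the agreement spreads along the backbone and into the teeth.\<close>

lemma line_fn_edge:
  assumes phi: "\<phi> \<in> H1_graph G" and e: "e \<in> gedges G" and y: "y \<in> {0..len e}"
  shows "grestr G \<phi> e y = line_fn \<phi> (off e + y)"
proof -
  note pair = H1_graph_sobolev_pair[OF phi]
  have diff: "line_fn \<phi> (off e + y) - line_fn \<phi> (off e) = grestr G \<phi> e y - grestr G \<phi> e 0"
    if e: "e \<in> gedges G" and y: "y \<in> {0..len e}" for e y
  proof -
    have "line_fn \<phi> (off e + y) = line_fn \<phi> (off e) + (LINT z:{off e..off e + y}|lebesgue. line_deriv \<phi> z)"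
      using e
    proof (cases rule: edge_cases)
      case (Tooth n)
      show ?thesis
        by (rule primitive_onD[OF sobolev_pair_tooth[OF pair Tooth(1)]]) (use Tooth y in auto)
    next
      case (Backbone n)
      show ?thesis
        by (rule primitive_onD[OF sobolev_pair_backbone[OF pair]])
          (use Backbone y foot_bounds(2)[of n] foot_bounds(3)[of "Suc n"] in auto)
    qed
    moreover have "(LINT z:{off e..off e + y}|lebesgue. line_deriv \<phi> z) = (LINT z:{0..y}|lebesgue. wderiv (len e) (grestr G \<phi> e) z)"
      unfolding line_deriv_def
    proof (rule set_integral_glue(2)[OF e])
      show "set_integrable lebesgue {0..y} (wderiv (len e) (grestr G \<phi> e))"
        by (rule set_integrable_subset[OF has_wderiv_integrable(1)[OF H1_graph_has_wderiv[OF phi e]]])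
          (use len_pos[OF e] y in auto)
    qed (use y in auto)
    moreover note has_wderiv_eq[OF H1_graph_has_wderiv[OF phi e] y]
    ultimately show ?thesis by simp
  qed
  have foot_val: "\<phi> (Vertex (Foot n)) = line_fn \<phi> (foot n)" if "1 \<le> n" for n
    using that
  proof (induction n rule: dec_induct)
    case base
    have "path_integral (line_deriv \<phi>) 1 = 0"
      using path_integral_backbone[of 1 "line_deriv \<phi>"] set_integral_Icc_degenerate[of 1 "line_deriv \<phi>"] by simp
    then show ?case by (simp add: line_fn_def)
  next
    case (step n)
    have b: "Backbone n \<in> gedges G" using step by (auto simp: edges)
    have "line_fn \<phi> (foot n) - line_fn \<phi> (foot (Suc n)) = \<phi> (Vertex (Foot n)) - \<phi> (Vertex (Foot (Suc n)))"
      using diff[OF b, of "len (Backbone n)"] len_pos[OF b] grestr_ends[OF b, of \<phi>] by simp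
    then show ?case using step.IH by simp
  qed
  have "grestr G \<phi> e 0 = line_fn \<phi> (off e)"
    using e
  proof (cases rule: edge_cases)
    case (Tooth n)
    then show ?thesis using grestr_ends(1)[OF e, of \<phi>] foot_val[of n] sobolev_pair_glue[OF pair Tooth(1)] by simp
  next
    case (Backbone n)
    then show ?thesis using grestr_ends(1)[OF e, of \<phi>] foot_val[of "Suc n"] by simp
  qed
  then show ?thesis using diff[OF e y] by simp
qed

lemma integral_edge_eq:
  fixes h :: "real \<Rightarrow> 'b::{banach, second_countable_topology}"
  assumes h: "integrable M h" and e: "e \<in> gedges G"
  shows "(LINT y|lebesgue_on {0..glen G e}. h (off e + y)) = (LINT z:edge_ivl e|lebesgue. h z)"
    and "integrable (lebesgue_on {0..glen G e}) (\<lambda>y. h (off e + y))"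
proof -
  have "set_integrable lebesgue {off e + 0..off e + len e} h"
    using integrable_M_subset[OF h edge_ivl_subset[OF e]] by (simp add: edge_ivl_def)
  from set_integral_Icc_shift[OF this]
  show "(LINT y|lebesgue_on {0..glen G e}. h (off e + y)) = (LINT z:edge_ivl e|lebesgue. h z)"
    "integrable (lebesgue_on {0..glen G e}) (\<lambda>y. h (off e + y))"
    by (simp_all add: lebesgue_on_eq_set_integral edge_ivl_def len_def)
qed

lemma L2_inner_eq:
  assumes phi: "\<And>e y. e \<in> gedges G \<Longrightarrow> y \<in> {0..len e} \<Longrightarrow> grestr G \<phi> e y = f (off e + y)"
    and psi: "\<And>e y. e \<in> gedges G \<Longrightarrow> y \<in> {0..len e} \<Longrightarrow> grestr G \<psi> e y = h (off e + y)"
    and int: "integrable M (\<lambda>z. f z * cnj (h z))"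
  shows "L2_inner G \<phi> \<psi> = (LINT z|M. f z * cnj (h z))"
proof -
  have "((\<lambda>e. LINT y|lebesgue_on {0..glen G e}. grestr G \<phi> e y * cnj (grestr G \<psi> e y)) has_sum
      (LINT z|M. f z * cnj (h z))) (gedges G)"
  proof (rule has_sum_cong[THEN iffD1, OF _ has_sum_edge_integrals[OF int]])
    fix e assume e: "e \<in> gedges G"
    have "(LINT y|lebesgue_on {0..glen G e}. grestr G \<phi> e y * cnj (grestr G \<psi> e y))
        = (LINT y|lebesgue_on {0..glen G e}. f (off e + y) * cnj (h (off e + y)))"
      using phi[OF e] psi[OF e] by (intro Bochner_Integration.integral_cong) (auto simp: len_def)
    then show "(LINT z:edge_ivl e|lebesgue. f z * cnj (h z))
        = (LINT y|lebesgue_on {0..glen G e}. grestr G \<phi> e y * cnj (grestr G \<psi> e y))"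
      using integral_edge_eq(1)[OF int e] by simp
  qed
  then show ?thesis unfolding L2_inner_def by (rule infsumI)
qed

lemma L2_mult_integrable:
  fixes g g' :: "real \<Rightarrow> complex"
  assumes [measurable]: "g \<in> borel_measurable M" "g' \<in> borel_measurable M"
    and "integrable M (\<lambda>z. (norm (g z))\<^sup>2)" "integrable M (\<lambda>z. (norm (g' z))\<^sup>2)"
  shows "integrable M (\<lambda>z. g z * cnj (g' z))"
proof (rule Bochner_Integration.integrable_bound)
  show "integrable M (\<lambda>z. (norm (g z))\<^sup>2 + (norm (g' z))\<^sup>2)" using assms by auto
  have [measurable]: "cnj \<in> borel_measurable borel"
    by (intro borel_measurable_continuous_onI continuous_intros)
  show "(\<lambda>z. g z * cnj (g' z)) \<in> borel_measurable M" by measurable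
  have "a * b \<le> a\<^sup>2 + b\<^sup>2" if "0 \<le> a" "0 \<le> b" for a b :: real
  proof -
    have "0 \<le> (a - b)\<^sup>2 + a * b" using that by simp
    then show ?thesis by (simp add: power2_eq_square algebra_simps)
  qed
  then show "AE z in M. norm (g z * cnj (g' z)) \<le> norm ((norm (g z))\<^sup>2 + (norm (g' z))\<^sup>2)"
    by (intro AE_I2) (simp add: norm_mult)
qed

lemma sobolev_pair_deriv_mult_integrable:
  "sobolev_pair f g \<Longrightarrow> sobolev_pair f' g' \<Longrightarrow> integrable M (\<lambda>z. g z * cnj (g' z))"
  by (intro L2_mult_integrable) (auto simp: sobolev_pair_def)

lemma energy_form_eq:
  assumes phi: "\<phi> \<in> H1_graph G" and psi: "\<psi> \<in> H1_graph G"
  shows "energy_form G \<phi> \<psi> = (LINT z|M. line_deriv \<phi> z * cnj (line_deriv \<psi> z))"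
proof -
  let ?w = "\<lambda>e y. wderiv (len e) (grestr G \<phi> e) y * cnj (wderiv (len e) (grestr G \<psi> e) y)"
  have int: "integrable M (\<lambda>z. line_deriv \<phi> z * cnj (line_deriv \<psi> z))"
    by (rule sobolev_pair_deriv_mult_integrable[OF H1_graph_sobolev_pair[OF phi] H1_graph_sobolev_pair[OF psi]])
  have glue: "(\<lambda>z. line_deriv \<phi> z * cnj (line_deriv \<psi> z)) = glue ?w"
    by (simp add: line_deriv_def glue_def[abs_def])
  have "((\<lambda>e. LINT y|lebesgue_on {0..glen G e}. ?w e y) has_sum
      (LINT z|M. line_deriv \<phi> z * cnj (line_deriv \<psi> z))) (gedges G)"
  proof (rule has_sum_cong[THEN iffD1, OF _ has_sum_edge_integrals[OF int]])
    fix e assume e: "e \<in> gedges G"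
    have "(LINT y|lebesgue_on {0..glen G e}. glue ?w (off e + y)) = (LINT y|lebesgue_on {0..glen G e}. ?w e y)"
    proof (rule integral_cong_AE)
      show "(\<lambda>y. glue ?w (off e + y)) \<in> borel_measurable (lebesgue_on {0..glen G e})"
        using integral_edge_eq(2)[OF int[unfolded glue] e] by (rule borel_measurable_integrable)
      have [measurable]: "cnj \<in> borel_measurable borel"
        by (intro borel_measurable_continuous_onI continuous_intros)
      have [measurable]: "wderiv (len e) (grestr G \<phi> e) \<in> borel_measurable (lebesgue_on {0..len e})"
        "wderiv (len e) (grestr G \<psi> e) \<in> borel_measurable (lebesgue_on {0..len e})"
        using has_wderiv_integrable(2)[OF H1_graph_has_wderiv[OF phi e]]
          has_wderiv_integrable(2)[OF H1_graph_has_wderiv[OF psi e]] len_pos[OF e] by auto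
      show "?w e \<in> borel_measurable (lebesgue_on {0..glen G e})"
        unfolding len_def[symmetric] by measurable
      have "AE y in lebesgue. y \<noteq> 0"
        by (rule AE_I'[of "{0}"]) (auto simp: negligible_sing simp flip: negligible_iff_null_sets)
      then have "AE y in lebesgue_on {0..glen G e}. y \<noteq> 0"
        by (subst AE_restrict_space_iff) auto
      then show "AE y in lebesgue_on {0..glen G e}. glue ?w (off e + y) = ?w e y"
      proof (rule AE_mp, intro AE_I2 impI)
        fix y assume "y \<in> space (lebesgue_on {0..glen G e})" "y \<noteq> 0"
        then show "glue ?w (off e + y) = ?w e y" using glue_edge[OF e, of y ?w] by (simp add: len_def)
      qed
    qed
    then show "(LINT z:edge_ivl e|lebesgue. line_deriv \<phi> z * cnj (line_deriv \<psi> z))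
        = (LINT y|lebesgue_on {0..glen G e}. ?w e y)"
      using integral_edge_eq(1)[OF int[unfolded glue] e] fun_cong[OF glue] by simp
  qed
  then show ?thesis unfolding energy_form_def len_def by (rule infsumI)
qed

lemma gvolume_eq: "gvolume G = vol"
proof -
  have "((\<lambda>e. LINT z:edge_ivl e|lebesgue. (1::real)) has_sum vol) (gedges G)"
    using has_sum_edge_integrals[of "\<lambda>_. 1::real"] by simp
  moreover have "(LINT z:edge_ivl e|lebesgue. (1::real)) = glen G e" if "e \<in> gedges G" for e
    using len_pos[OF that] unfolding edge_ivl_def by (subst set_integral_Icc_const) (auto simp: len_def)
  ultimately have "(glen G has_sum vol) (gedges G)" by (simp cong: has_sum_cong)
  then show ?thesis unfolding gvolume_def by (rule infsumI)
qed

end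

section \<open>Eigenfunctions of the Neumann Laplacian\<close>

context comb_model
begin

text \<open>The foot \<open>n\<close> of the graph is represented twice on the line, by \<open>foot n\<close> and by \<open>2 n\<close>. Functions in
  Sobolev pairs take the same value at both points, so that either choice will do.\<close>

fun pos :: "(comb_vertex, comb_edge) gpoint \<Rightarrow> real" where
  "pos (Vertex (Foot n)) = foot n"
| "pos (Vertex (Tip n)) = 2 * real n + foot n"
| "pos (Inner e y) = off e + y"

lemma grestr_pos:
  assumes pair: "sobolev_pair f g" and e: "e \<in> gedges G" and y: "y \<in> {0..len e}"
  shows "grestr G (\<lambda>p. f (pos p)) e y = f (off e + y)"
  using e
proof (cases rule: edge_cases)
  case (Tooth n)
  then show ?thesis
    using sobolev_pair_glue[OF pair, of n] by (simp add: grestr_def gchart_def flip: len_def)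
next
  case (Backbone n)
  then show ?thesis by (simp add: grestr_def gchart_def flip: len_def)
qed

lemma sobolev_pair_lipschitz_edge:
  assumes pair: "sobolev_pair f g" and C: "\<And>z. z \<in> comb_set \<Longrightarrow> norm (g z) \<le> C"
    and e: "e \<in> gedges G" and s: "s \<in> {0..len e}" "t \<in> {0..len e}"
  shows "norm (f (off e + s) - f (off e + t)) \<le> C * \<bar>s - t\<bar>"
proof -
  have g: "g \<in> borel_measurable M" using pair by (simp add: sobolev_pair_def)
  have in_e: "off e + s \<in> edge_ivl e" "off e + t \<in> edge_ivl e" using s by (auto simp: edge_ivl_def)
  have in_S: "off e + s \<in> comb_set" "off e + t \<in> comb_set" using in_e edge_ivl_subset[OF e] by auto
  have "\<exists>n. off e + s \<in> {0..1} \<and> off e + t \<in> {0..1} \<or> (1 \<le> n \<and> off e + s \<in> tooth n \<and> off e + t \<in> tooth n)"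
    using e
  proof (cases rule: edge_cases)
    case (Tooth n)
    then show ?thesis using in_e by (auto simp: edge_ivl_tooth)
  next
    case (Backbone n)
    then show ?thesis using in_e foot_bounds(2)[of n] foot_bounds(3)[of "Suc n"] by (auto simp: edge_ivl_backbone)
  qed
  then obtain n where "off e + s \<in> {0..1} \<and> off e + t \<in> {0..1} \<or> (1 \<le> n \<and> off e + s \<in> tooth n \<and> off e + t \<in> tooth n)"
    by blast
  from path_integral_lipschitz[OF g C this] show ?thesis
    using sobolev_pair_eq[OF pair in_S(1)] sobolev_pair_eq[OF pair in_S(2)] by simp
qed

lemma has_wderiv_pos:
  assumes pair: "sobolev_pair f g" and e: "e \<in> gedges G"
  shows "has_wderiv (len e) (grestr G (\<lambda>p. f (pos p)) e) (\<lambda>y. g (off e + y))"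
  unfolding has_wderiv_def
proof (intro conjI ballI)
  have g: "integrable M g" "integrable M (\<lambda>z. (norm (g z))\<^sup>2)"
    using sobolev_pair_integrable[OF pair] pair by (auto simp: sobolev_pair_def)
  show "square_integrable (lebesgue_on {0..len e}) (\<lambda>y. g (off e + y))"
    using integral_edge_eq(2)[OF g(1) e] integral_edge_eq(2)[OF g(2) e]
    by (auto simp: square_integrable_def len_def)
  fix x assume x: "x \<in> {0..len e}"
  have "f (off e + x) = f (off e) + (LINT z:{off e..off e + x}|lebesgue. g z)"
    using e
  proof (cases rule: edge_cases)
    case (Tooth n)
    show ?thesis
      by (rule primitive_onD[OF sobolev_pair_tooth[OF pair Tooth(1)]]) (use Tooth x in auto)
  next
    case (Backbone n)
    show ?thesis
      by (rule primitive_onD[OF sobolev_pair_backbone[OF pair]])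
        (use Backbone x foot_bounds(2)[of n] foot_bounds(3)[of "Suc n"] in auto)
  qed
  moreover have "set_integrable lebesgue {off e + 0..off e + x} g"
    by (rule integrable_M_subset[OF g(1)]) (use x edge_ivl_subset[OF e] in \<open>auto simp: edge_ivl_def\<close>)
  from set_integral_Icc_shift(2)[OF this]
  have "(LINT z:{off e..off e + x}|lebesgue. g z) = integral\<^sup>L (lebesgue_on {0..x}) (\<lambda>y. g (off e + y))"
    by (simp add: lebesgue_on_eq_set_integral)
  ultimately show "grestr G (\<lambda>p. f (pos p)) e x = grestr G (\<lambda>p. f (pos p)) e 0
      + integral\<^sup>L (lebesgue_on {0..x}) (\<lambda>y. g (off e + y))"
    using grestr_pos[OF pair e x] grestr_pos[OF pair e, of 0] x by simp
qed

text \<open>A pair with bounded derivative is Lipschitz along paths, hence continuous for the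
  shortest-path metric.\<close>

lemma gcontinuous_pos:
  assumes pair: "sobolev_pair f g" and C: "\<And>z. z \<in> comb_set \<Longrightarrow> norm (g z) \<le> C"
  shows "gcontinuous G (\<lambda>p. f (pos p))"
  unfolding gcontinuous_def
proof (intro ballI allI impI)
  have path: "gpath G p q l \<Longrightarrow> norm (f (pos q) - f (pos p)) \<le> C * l \<and> 0 \<le> l" for p q l
  proof (induction rule: gpath.induct)
    case start
    then show ?case by simp
  next
    case (segment e s l t)
    have st: "s \<in> {0..len e}" "t \<in> {0..len e}" using segment by (auto simp: len_def)
    have "norm (f (off e + t) - f (off e + s)) \<le> C * \<bar>t - s\<bar>"
      by (rule sobolev_pair_lipschitz_edge[OF pair C segment(2) st(2,1)])
    moreover have "f (pos (gchart G e s)) = f (off e + s)" "f (pos (gchart G e t)) = f (off e + t)"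
      using grestr_pos[OF pair segment(2) st(1)] grestr_pos[OF pair segment(2) st(2)] by (simp_all add: grestr_def)
    moreover have "norm (f (pos (gchart G e s)) - f (pos p)) \<le> C * l" "0 \<le> l" using segment.IH by auto
    moreover note norm_triangle_ineq[of "f (off e + t) - f (off e + s)" "f (off e + s) - f (pos p)"]
    ultimately show ?case by (simp add: distrib_left abs_minus_commute)
  qed
  fix p and \<epsilon> :: real assume p: "p \<in> gpoints G" and eps: "0 < \<epsilon>"
  have "1 \<in> comb_set" using subsetD[OF backbone_subset, of 1] by simp
  then have C0: "0 \<le> C" using C[of 1] norm_ge_zero[of "g 1"] by linarith
  define \<delta> where "\<delta> = \<epsilon> / (C + 1)"
  have delta: "0 < \<delta>" "C * \<delta> < \<epsilon>" using eps C0 by (auto simp: \<delta>_def field_simps)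
  have "dist (f (pos q)) (f (pos p)) < \<epsilon>" if "gdist G p q < ennreal \<delta>" for q
  proof -
    from that have "\<exists>l. gpath G p q l \<and> ennreal l < ennreal \<delta>"
      unfolding gdist_def Inf_less_iff by auto
    then obtain l where l: "gpath G p q l" "ennreal l < ennreal \<delta>" by blast
    have "norm (f (pos q) - f (pos p)) \<le> C * l" "0 \<le> l" using path[OF l(1)] by auto
    moreover have "l < \<delta>" using l(2) delta(1) by (simp add: ennreal_less_iff[OF \<open>0 \<le> l\<close>])
    then have "C * l \<le> C * \<delta>" using C0 by (intro mult_left_mono) auto
    ultimately show ?thesis using delta(2) by (simp add: dist_norm)
  qed
  then show "\<exists>\<delta>>0. \<forall>q\<in>gpoints G. gdist G p q < ennreal \<delta> \<longrightarrow> dist (f (pos q)) (f (pos p)) < \<epsilon>"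
    using delta(1) by blast
qed

lemma H1_graph_pos:
  assumes pair: "sobolev_pair f g" and C: "\<And>z. z \<in> comb_set \<Longrightarrow> norm (g z) \<le> C"
  shows "(\<lambda>p. f (pos p)) \<in> H1_graph G"
  unfolding H1_graph_def
proof (intro CollectI conjI ballI)
  show "gcontinuous G (\<lambda>p. f (pos p))" by (rule gcontinuous_pos[OF pair C])
  show "grestr G (\<lambda>p. f (pos p)) e \<in> H1_interval (glen G e)" if "e \<in> gedges G" for e
    using has_wderiv_pos[OF pair that] by (auto simp: H1_interval_def len_def)
  have f2: "integrable M (\<lambda>z. (norm (f z))\<^sup>2)" by (rule sobolev_pair_norm_sq_integrable[OF pair])
  have g2: "integrable M (\<lambda>z. (norm (g z))\<^sup>2)" using pair by (simp add: sobolev_pair_def)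
  have "((\<lambda>e. sq_integral (edge_ivl e) f + sq_integral (edge_ivl e) g)
      has_sum ((LINT z|M. (norm (f z))\<^sup>2) + (LINT z|M. (norm (g z))\<^sup>2))) (gedges G)"
    by (intro has_sum_add has_sum_edge_integrals f2 g2)
  moreover have "H1_norm_sq (glen G e) (grestr G (\<lambda>p. f (pos p)) e)
      = sq_integral (edge_ivl e) f + sq_integral (edge_ivl e) g"
    if e: "e \<in> gedges G" for e
  proof -
    have len0: "0 \<le> len e" using len_pos[OF e] by simp
    have "(LINT y|lebesgue_on {0..glen G e}. (norm (grestr G (\<lambda>p. f (pos p)) e y))\<^sup>2)
        = (LINT y|lebesgue_on {0..glen G e}. (norm (f (off e + y)))\<^sup>2)"
      using grestr_pos[OF pair e] by (intro Bochner_Integration.integral_cong) (auto simp: len_def)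
    moreover have "(LINT y|lebesgue_on {0..glen G e}. (norm (wderiv (glen G e) (grestr G (\<lambda>p. f (pos p)) e) y))\<^sup>2)
        = (LINT y|lebesgue_on {0..glen G e}. (norm (g (off e + y)))\<^sup>2)"
    proof (rule integral_cong_AE)
      note w = has_wderiv_pos[OF pair e]
      have w': "has_wderiv (len e) (grestr G (\<lambda>p. f (pos p)) e) (wderiv (len e) (grestr G (\<lambda>p. f (pos p)) e))"
        using w by (intro has_wderiv_wderiv) (auto simp: H1_interval_def)
      show "(\<lambda>y. (norm (wderiv (glen G e) (grestr G (\<lambda>p. f (pos p)) e) y))\<^sup>2) \<in> borel_measurable (lebesgue_on {0..glen G e})"
        using has_wderiv_integrable(2)[OF w' len0] unfolding len_def by measurable
      show "(\<lambda>y. (norm (g (off e + y)))\<^sup>2) \<in> borel_measurable (lebesgue_on {0..glen G e})"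
        using has_wderiv_integrable(2)[OF w len0] unfolding len_def by measurable
      show "AE y in lebesgue_on {0..glen G e}. (norm (wderiv (glen G e) (grestr G (\<lambda>p. f (pos p)) e) y))\<^sup>2 = (norm (g (off e + y)))\<^sup>2"
        using wderiv_unique[OF w len0] unfolding len_def by eventually_elim simp
    qed
    ultimately show ?thesis
      unfolding H1_norm_sq_def using integral_edge_eq(1)[OF f2 e] integral_edge_eq(1)[OF g2 e] by simp
  qed
  ultimately have "((\<lambda>e. H1_norm_sq (glen G e) (grestr G (\<lambda>p. f (pos p)) e)) has_sum
      ((LINT z|M. (norm (f z))\<^sup>2) + (LINT z|M. (norm (g z))\<^sup>2))) (gedges G)"
    by (simp cong: has_sum_cong)
  then show "(\<lambda>e. H1_norm_sq (glen G e) (grestr G (\<lambda>p. f (pos p)) e)) summable_on gedges G"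
    by (rule has_sum_imp_summable)
qed

lemma L2_graph_pos:
  assumes pair: "sobolev_pair f g"
  shows "(\<lambda>p. c * f (pos p)) \<in> L2_graph G"
  unfolding L2_graph_def
proof (intro CollectI conjI ballI)
  have cf2: "integrable M (\<lambda>z. (norm (c * f z))\<^sup>2)"
    using sobolev_pair_norm_sq_integrable[OF pair] by (simp add: norm_mult power_mult_distrib)
  have f: "integrable M (\<lambda>z. c * f z)"
    using square_integrable_imp_integrable[OF sobolev_pair_measurable[OF pair] sobolev_pair_norm_sq_integrable[OF pair]] by simp
  have restr: "grestr G (\<lambda>p. c * f (pos p)) e y = c * f (off e + y)" if "e \<in> gedges G" "y \<in> {0..len e}" for e y
    using grestr_pos[OF pair that] by (simp add: grestr_def)
  have eq: "(norm (grestr G (\<lambda>p. c * f (pos p)) e y))\<^sup>2 = (norm (c * f (off e + y)))\<^sup>2"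
    if "e \<in> gedges G" "y \<in> space (lebesgue_on {0..glen G e})" for e y
    using restr[OF that(1), of y] that(2) by (simp add: len_def)
  show "square_integrable (lebesgue_on {0..glen G e}) (grestr G (\<lambda>p. c * f (pos p)) e)" if e: "e \<in> gedges G" for e
    unfolding square_integrable_def
  proof
    have "(\<lambda>y. c * f (off e + y)) \<in> borel_measurable (lebesgue_on {0..glen G e})"
      using integral_edge_eq(2)[OF f e] by (rule borel_measurable_integrable)
    then show "grestr G (\<lambda>p. c * f (pos p)) e \<in> borel_measurable (lebesgue_on {0..glen G e})"
      by (rule measurable_cong[THEN iffD2, rotated]) (use restr[OF e] in \<open>auto simp: len_def\<close>)
    show "integrable (lebesgue_on {0..glen G e}) (\<lambda>y. (norm (grestr G (\<lambda>p. c * f (pos p)) e y))\<^sup>2)"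
      using integral_edge_eq(2)[OF cf2 e]
      by (rule Bochner_Integration.integrable_cong[THEN iffD1, rotated 2]) (use eq[OF e] in auto)
  qed
  have "(LINT z:edge_ivl e|lebesgue. (norm (c * f z))\<^sup>2)
      = (LINT y|lebesgue_on {0..glen G e}. (norm (grestr G (\<lambda>p. c * f (pos p)) e y))\<^sup>2)" if e: "e \<in> gedges G" for e
  proof -
    have "(LINT y|lebesgue_on {0..glen G e}. (norm (grestr G (\<lambda>p. c * f (pos p)) e y))\<^sup>2)
        = (LINT y|lebesgue_on {0..glen G e}. (norm (c * f (off e + y)))\<^sup>2)"
      by (rule Bochner_Integration.integral_cong[OF refl eq[OF e]])
    then show ?thesis using integral_edge_eq(1)[OF cf2 e] by simp
  qed
  then have "((\<lambda>e. LINT y|lebesgue_on {0..glen G e}. (norm (grestr G (\<lambda>p. c * f (pos p)) e y))\<^sup>2) has_sum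
      (LINT z|M. (norm (c * f z))\<^sup>2)) (gedges G)"
    using has_sum_edge_integrals[OF cf2] by (simp cong: has_sum_cong)
  then show "(\<lambda>e. LINT y|lebesgue_on {0..glen G e}. (norm (grestr G (\<lambda>p. c * f (pos p)) e y))\<^sup>2) summable_on gedges G"
    by (rule has_sum_imp_summable)
qed

text \<open>The derivative chosen by \<open>wderiv\<close> may be replaced by the given one, edge by edge.\<close>

lemma energy_form_pos:
  assumes pair: "sobolev_pair f g" and C: "\<And>z. z \<in> comb_set \<Longrightarrow> norm (g z) \<le> C" and psi: "\<psi> \<in> H1_graph G"
  shows "energy_form G (\<lambda>p. f (pos p)) \<psi> = (LINT z|M. g z * cnj (line_deriv \<psi> z))"
proof -
  let ?\<phi> = "\<lambda>p. f (pos p)"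
  note pair' = H1_graph_sobolev_pair[OF psi]
  have phi: "?\<phi> \<in> H1_graph G" by (rule H1_graph_pos[OF pair C])
  have int: "integrable M (\<lambda>z. g z * cnj (line_deriv \<psi> z))"
    by (rule sobolev_pair_deriv_mult_integrable[OF pair pair'])
  have "((\<lambda>e. LINT y|lebesgue_on {0..glen G e}. wderiv (glen G e) (grestr G ?\<phi> e) y * cnj (wderiv (glen G e) (grestr G \<psi> e) y))
      has_sum (LINT z|M. g z * cnj (line_deriv \<psi> z))) (gedges G)"
  proof (rule has_sum_cong[THEN iffD1, OF _ has_sum_edge_integrals[OF int]])
    fix e assume e: "e \<in> gedges G"
    have len0: "0 \<le> len e" using len_pos[OF e] by simp
    note w = has_wderiv_pos[OF pair e]
    have [measurable]: "cnj \<in> borel_measurable borel"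
      by (intro borel_measurable_continuous_onI continuous_intros)
    have [measurable]: "wderiv (glen G e) (grestr G ?\<phi> e) \<in> borel_measurable (lebesgue_on {0..glen G e})"
      "wderiv (glen G e) (grestr G \<psi> e) \<in> borel_measurable (lebesgue_on {0..glen G e})"
      using has_wderiv_integrable(2)[OF H1_graph_has_wderiv[OF phi e] len0]
        has_wderiv_integrable(2)[OF H1_graph_has_wderiv[OF psi e] len0] by (simp_all add: len_def)
    have "(LINT y|lebesgue_on {0..glen G e}. wderiv (glen G e) (grestr G ?\<phi> e) y * cnj (wderiv (glen G e) (grestr G \<psi> e) y))
        = (LINT y|lebesgue_on {0..glen G e}. g (off e + y) * cnj (line_deriv \<psi> (off e + y)))"
    proof (rule integral_cong_AE)
      show "(\<lambda>y. g (off e + y) * cnj (line_deriv \<psi> (off e + y))) \<in> borel_measurable (lebesgue_on {0..glen G e})"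
        using integral_edge_eq(2)[OF int e] by (rule borel_measurable_integrable)
      have "AE y in lebesgue. y \<noteq> 0"
        by (rule AE_I'[of "{0}"]) (auto simp: negligible_sing simp flip: negligible_iff_null_sets)
      then have "AE y in lebesgue_on {0..glen G e}. y \<noteq> 0"
        by (subst AE_restrict_space_iff) auto
      moreover have "AE y in lebesgue_on {0..glen G e}. y \<in> {0..glen G e}"
        by (intro AE_I2) simp
      moreover note wderiv_unique[OF w len0, unfolded len_def]
      ultimately show "AE y in lebesgue_on {0..glen G e}. wderiv (glen G e) (grestr G ?\<phi> e) y * cnj (wderiv (glen G e) (grestr G \<psi> e) y)
          = g (off e + y) * cnj (line_deriv \<psi> (off e + y))"
      proof eventually_elim
        case (elim y)
        have "line_deriv \<psi> (off e + y) = wderiv (len e) (grestr G \<psi> e) y"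
          unfolding line_deriv_def by (rule glue_edge[OF e]) (use elim in \<open>auto simp: len_def\<close>)
        then show ?case using elim by (simp add: len_def)
      qed
    qed measurable
    then show "(LINT z:edge_ivl e|lebesgue. g z * cnj (line_deriv \<psi> z))
        = (LINT y|lebesgue_on {0..glen G e}. wderiv (glen G e) (grestr G ?\<phi> e) y * cnj (wderiv (glen G e) (grestr G \<psi> e) y))"
      using integral_edge_eq(1)[OF int e] by simp
  qed
  then show ?thesis unfolding energy_form_def by (rule infsumI)
qed

text \<open>It suffices to check the weak eigenvalue equation against Sobolev pairs on the line.\<close>

lemma neumann_eigenfunctionI:
  assumes pair: "sobolev_pair f g" and C: "\<And>z. z \<in> comb_set \<Longrightarrow> norm (g z) \<le> C"
    and weak: "\<And>f' g'. sobolev_pair f' g' \<Longrightarrow> (LINT z|M. g z * cnj (g' z)) = of_real \<mu> * (LINT z|M. f z * cnj (f' z))"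
  shows "((\<lambda>p. f (pos p)), (\<lambda>p. of_real \<mu> * f (pos p))) \<in> neumann_laplacian G"
  unfolding neumann_laplacian_def
proof (intro CollectI case_prodI conjI ballI)
  show "(\<lambda>p. f (pos p)) \<in> H1_graph G" by (rule H1_graph_pos[OF pair C])
  show "(\<lambda>p. of_real \<mu> * f (pos p)) \<in> L2_graph G" by (rule L2_graph_pos[OF pair])
  fix \<psi> assume psi: "\<psi> \<in> H1_graph G"
  note pair' = H1_graph_sobolev_pair[OF psi]
  have "L2_inner G (\<lambda>p. of_real \<mu> * f (pos p)) \<psi> = (LINT z|M. (of_real \<mu> * f z) * cnj (line_fn \<psi> z))"
  proof (rule L2_inner_eq)
    show "grestr G (\<lambda>p. of_real \<mu> * f (pos p)) e y = of_real \<mu> * f (off e + y)"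
      if "e \<in> gedges G" "y \<in> {0..len e}" for e y
      using grestr_pos[OF pair that] by (simp add: grestr_def)
    show "integrable M (\<lambda>z. (of_real \<mu> * f z) * cnj (line_fn \<psi> z))"
      using sobolev_pair_mult_integrable[OF pair pair'] by (simp add: mult.assoc)
  qed (rule line_fn_edge[OF psi])
  also have "\<dots> = of_real \<mu> * (LINT z|M. f z * cnj (line_fn \<psi> z))"
    by (simp add: mult.assoc)
  also have "\<dots> = energy_form G (\<lambda>p. f (pos p)) \<psi>"
    using weak[OF pair'] energy_form_pos[OF pair C psi] by simp
  finally show "energy_form G (\<lambda>p. f (pos p)) \<psi> = L2_inner G (\<lambda>p. of_real \<mu> * f (pos p)) \<psi>" by simp
qed

lemma sobolev_pair_cnj:
  assumes "sobolev_pair f g"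
  shows "sobolev_pair (\<lambda>z. cnj (f z)) (\<lambda>z. cnj (g z))"
proof (rule sobolev_pair_path_integral[where c = "cnj (f 1)"])
  have [measurable]: "cnj \<in> borel_measurable borel"
    by (intro borel_measurable_continuous_onI continuous_intros)
  have [measurable]: "g \<in> borel_measurable M" using assms by (simp add: sobolev_pair_def)
  show "(\<lambda>z. cnj (g z)) \<in> borel_measurable M" by measurable
  show "integrable M (\<lambda>z. (norm (cnj (g z)))\<^sup>2)" using assms by (simp add: sobolev_pair_def)
  fix q assume "q \<in> comb_set"
  from sobolev_pair_eq[OF assms this] have "cnj (f q) = cnj (f 1) + cnj (path_integral g q)"
    by (simp only: complex_cnj_add)
  moreover have "path_integral (\<lambda>z. cnj (g z)) q = cnj (path_integral g q)"
    by (simp add: path_integral_def flip: complex_cnj_scaleR Bochner_Integration.integral_cnj)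
  ultimately show "cnj (f q) = cnj (f 1) + path_integral (\<lambda>z. cnj (g z)) q" by simp
qed

text \<open>An eigenfunction of \<open>green\<close> is, up to a constant and the factor \<open>1 / \<rho>\<close>, the path integral of its own
  flux. So its derivative is \<open>flux v / \<rho>\<close>, and Green's identity is the weak eigenvalue equation.\<close>

lemma green_eigenfunction_neumann:
  assumes v: "v \<in> mean_zero_fns" and rho: "0 < \<rho>" and eigen: "green v = (\<lambda>q. \<rho> * v q)"
  shows "((\<lambda>p. complex_of_real (v (pos p))), (\<lambda>p. of_real (1 / \<rho>) * complex_of_real (v (pos p)))) \<in> neumann_laplacian G"
proof -
  have v_int: "integrable M v" by (rule mean_zero_fns_integrable[OF v])
  note F = flux_real[OF v_int]
  define f where "f q = complex_of_real (v q)" for q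
  define g where "g z = complex_of_real (flux v z / \<rho>)" for z
  define B where "B = (LINT q|M. \<bar>v q\<bar>) / \<rho>"
  have gB: "norm (g z) \<le> B" for z
    unfolding g_def B_def norm_of_real abs_divide using F(2)[of z] rho by (simp add: divide_right_mono)
  have [measurable]: "flux v \<in> borel_measurable M" by (rule F(1))
  have g_meas: "g \<in> borel_measurable M" unfolding g_def[abs_def] by measurable
  define m where "m = (LINT p|M. path_integral (flux v) p) / vol"
  have "sobolev_pair f g"
  proof (rule sobolev_pair_path_integral[OF g_meas])
    show "integrable M (\<lambda>z. (norm (g z))\<^sup>2)"
    proof (rule integrable_const_bound[where B = "B\<^sup>2"])
      show "AE z in M. norm ((norm (g z))\<^sup>2) \<le> B\<^sup>2"
        using gB by (intro AE_I2) (auto intro!: power_mono)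
    qed (use g_meas in measurable)
    fix q
    have "path_integral g q = complex_of_real (path_integral (flux v) q / \<rho>)"
      unfolding path_integral_def g_def
      by (simp add: scaleR_conv_of_real flip: of_real_mult of_real_divide)
    moreover have "\<rho> * v q = path_integral (flux v) q - m"
      using fun_cong[OF eigen, of q] by (simp add: green_def m_def)
    then have "v q = - (m / \<rho>) + path_integral (flux v) q / \<rho>"
      using rho by (simp add: field_simps)
    ultimately show "f q = complex_of_real (- (m / \<rho>)) + path_integral g q"
      by (simp only: f_def of_real_add)
  qed
  moreover have "(LINT z|M. g z * cnj (g' z)) = of_real (1 / \<rho>) * (LINT z|M. f z * cnj (f' z))"
    if "sobolev_pair f' g'" for f' g'
  proof -
    have "flux f z = complex_of_real (flux v z)" for z
      by (simp add: flux_def f_def[abs_def] scaleR_conv_of_real flip: of_real_mult)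
    then have g_eq: "g z = of_real (1 / \<rho>) * flux f z" for z by (simp add: g_def)
    have "(LINT z|M. flux f z * cnj (g' z)) = (LINT z|M. f z * cnj (f' z))"
      by (rule green_identity[OF sobolev_pair_cnj[OF that]])
        (use v v_int in \<open>auto simp: f_def[abs_def] mean_zero_fns_def\<close>)
    then show ?thesis unfolding g_eq by (simp add: mult.assoc)
  qed
  ultimately show ?thesis
    using neumann_eigenfunctionI[of f g B "1 / \<rho>"] gB by (simp add: f_def[abs_def])
qed

lemma constant_eigenfunction_neumann:
  "((\<lambda>p. 1), (\<lambda>p. of_real 0 * 1)) \<in> neumann_laplacian G"
proof -
  have "sobolev_pair (\<lambda>_. 1) (\<lambda>_. 0)"
    by (rule sobolev_pair_path_integral[where c = 1]) (auto simp: path_integral_def)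
  then show ?thesis
    using neumann_eigenfunctionI[of "\<lambda>_. 1" "\<lambda>_. 0" 0 0] by simp
qed

lemma comb_set_point_ex:
  assumes "z \<in> comb_set" "z \<noteq> 0"
  shows "\<exists>e y. e \<in> gedges G \<and> y \<in> {0..len e} \<and> z = off e + y"
  using assms(1)
proof (cases rule: comb_set_cases)
  case backbone
  then obtain n where "1 \<le> n" "foot (Suc n) < z" "z \<le> foot n" using backbone_piece_ex[of z] assms(2) by auto
  then show ?thesis by (intro exI[of _ "Backbone n"] exI[of _ "z - foot (Suc n)"]) (auto simp: edges)
next
  case (tooth n)
  then show ?thesis by (intro exI[of _ "Tooth n"] exI[of _ "z - 2 * real n"]) (auto simp: edges tooth_def)
qed

lemma gchart_gpoints: "e \<in> gedges G \<Longrightarrow> y \<in> {0..len e} \<Longrightarrow> gchart G e y \<in> gpoints G"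
  unfolding gpoints_def len_def by blast

section \<open>The upper bound\<close>

text \<open>The constant function together with \<open>k - 1\<close> orthogonal eigenfunctions of mean zero. Independence is
  required at the points of the graph, which miss \<open>0\<close>; orthogonality only sees almost every point.\<close>

lemma eigenvalue_count_upper:
  assumes k: "1 \<le> k"
  shows "eigenvalue_count_ge G ((pi * real k / 2)\<^sup>2) k"
proof -
  define t where "t = (pi * real k / 2)\<^sup>2"
  have t: "0 < t" using k by (simp add: t_def)
  from comb_green_eigenfunctions[OF k] obtain e \<rho> where
    E: "\<forall>i<k - 1. e i \<in> mean_zero_fns \<and> 1 / t \<le> \<rho> i \<and> green (e i) = (\<lambda>q. \<rho> i * e i q) \<and> 0 < ip (e i) (e i)"
    and orth: "\<forall>i<k - 1. \<forall>l<k - 1. i \<noteq> l \<longrightarrow> ip (e i) (e l) = 0"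
    unfolding t_def[symmetric] by blast
  have e: "\<And>i. i < k - 1 \<Longrightarrow> e i \<in> mean_zero_fns" "\<And>i. i < k - 1 \<Longrightarrow> 1 / t \<le> \<rho> i"
      "\<And>i. i < k - 1 \<Longrightarrow> green (e i) = (\<lambda>q. \<rho> i * e i q)" "\<And>i. i < k - 1 \<Longrightarrow> 0 < ip (e i) (e i)"
    using E by blast+
  define F where "F i = (case i of 0 \<Rightarrow> \<lambda>_. 1 | Suc j \<Rightarrow> e j)" for i
  define \<mu> where "\<mu> i = (case i of 0 \<Rightarrow> 0 | Suc j \<Rightarrow> 1 / \<rho> j)" for i
  have F_meas: "F i \<in> borel_measurable M" and F_bdd: "\<exists>C. \<forall>q\<in>comb_set. \<bar>F i q\<bar> \<le> C" if "i < k" for i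
    using e(1)[of "i - 1"] that by (cases i; auto simp: F_def mean_zero_fns_def)+
  have F_int: "integrable M (\<lambda>q. F i q * F l q)" if "i < k" "l < k" for i l
  proof -
    from F_bdd[OF that(1)] F_bdd[OF that(2)]
    obtain C D where C: "\<And>q. q \<in> comb_set \<Longrightarrow> \<bar>F i q\<bar> \<le> C" "\<And>q. q \<in> comb_set \<Longrightarrow> \<bar>F l q\<bar> \<le> D"
      by blast
    have "\<bar>F i q * F l q\<bar> \<le> C * D" if "q \<in> comb_set" for q
      unfolding abs_mult using C that abs_ge_zero[of "F i q"]
      by (intro mult_mono) (auto intro: order_trans[OF abs_ge_zero])
    then show ?thesis using F_meas that by (intro bounded_integrable) auto
  qed
  have F_orth: "ip (F i) (F l) = 0" if "i < k" "l < k" "i \<noteq> l" for i l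
    using that e(1)[of "i - 1"] e(1)[of "l - 1"] orth
    by (cases i; cases l) (auto simp: F_def ip_def mean_zero_fns_def)
  have F_pos: "0 < ip (F i) (F i)" if "i < k" for i
    using that e(4)[of "i - 1"] vol_pos by (cases i) (auto simp: F_def ip_def)
  have "lin_indep_on (gpoints G) k (\<lambda>i p. complex_of_real (F i (pos p)))"
    unfolding lin_indep_on_def
  proof (intro allI impI)
    fix c :: "nat \<Rightarrow> complex" and l
    assume c: "\<forall>p\<in>gpoints G. (\<Sum>i<k. c i * complex_of_real (F i (pos p))) = 0" and l: "l < k"
    have zero: "(\<Sum>i<k. c i * complex_of_real (F i z)) = 0" if z: "z \<in> comb_set" "z \<noteq> 0" for z
    proof -
      obtain ed y where ey: "ed \<in> gedges G" "y \<in> {0..len ed}" "z = off ed + y"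
        using comb_set_point_ex[OF z] by blast
      have "F i (pos (gchart G ed y)) = F i z" if i: "i < k" for i
      proof -
        have glue: "F i (2 * real n) = F i (foot n)" if n: "1 \<le> n" for n
        proof (cases i)
          case (Suc j)
          then have j: "j < k - 1" using i by simp
          have rho: "\<rho> j \<noteq> 0" using e(2)[OF j] t by (smt (verit) divide_pos_pos)
          have "2 * real n \<in> tooth n" "foot n \<in> {0..1}" using foot_bounds[of n] by (auto simp: tooth_def)
          then have "path_integral (flux (e j)) (2 * real n) = path_integral (flux (e j)) (foot n)"
            using path_integral_tooth[of "2 * real n" n] flux_real(3)[OF mean_zero_fns_integrable[OF e(1)[OF j]]] n
            by (simp add: path_integral_backbone set_integral_Icc_degenerate[simplified])
          then have "green (e j) (2 * real n) = green (e j) (foot n)" by (simp add: green_def)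
          then show ?thesis using rho unfolding e(3)[OF j] by (simp add: F_def Suc)
        qed (simp add: F_def)
        from ey(1) show ?thesis
        proof (cases rule: edge_cases)
          case (Tooth n)
          then show ?thesis using glue[of n] ey by (auto simp: gchart_def simp flip: len_def)
        next
          case (Backbone n)
          then show ?thesis using ey by (auto simp: gchart_def simp flip: len_def)
        qed
      qed
      then show ?thesis using bspec[OF c gchart_gpoints[OF ey(1,2)]] by simp
    qed
    have ae: "AE z in M. (\<Sum>i<k. c i * complex_of_real (F i z)) * complex_of_real (F l z) = 0"
    proof -
      have "AE z in lebesgue. z \<noteq> 0"
        by (rule AE_I'[of "{0}"]) (auto simp: negligible_sing simp flip: negligible_iff_null_sets)
      then have "AE z in M. z \<noteq> 0" by (subst AE_restrict_space_iff) auto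
      moreover have "AE z in M. z \<in> comb_set" by (intro AE_I2) simp
      ultimately show ?thesis by eventually_elim (simp add: zero)
    qed
    have "0 = (LINT z|M. (\<Sum>i<k. c i * complex_of_real (F i z)) * complex_of_real (F l z))"
      using integral_eq_zero_AE[OF ae] by simp
    also have "\<dots> = (LINT z|M. (\<Sum>i<k. c i * complex_of_real (F i z * F l z)))"
      by (simp add: sum_distrib_right mult.assoc)
    also have "\<dots> = (\<Sum>i<k. c i * complex_of_real (ip (F i) (F l)))"
      using F_int l by (subst Bochner_Integration.integral_sum) (auto simp: ip_def simp flip: of_real_mult)
    also have "\<dots> = (\<Sum>i<k. if i = l then c l * complex_of_real (ip (F l) (F l)) else 0)"
      using F_orth l by (intro sum.cong) auto
    also have "\<dots> = c l * complex_of_real (ip (F l) (F l))" using l by simp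
    finally show "c l = 0" using F_pos[OF l] by simp
  qed
  moreover have "\<mu> i \<le> t \<and> ((\<lambda>p. complex_of_real (F i (pos p))), \<lambda>p. of_real (\<mu> i) * complex_of_real (F i (pos p))) \<in> neumann_laplacian G"
    if i: "i < k" for i
  proof (cases i)
    case 0
    then show ?thesis using constant_eigenfunction_neumann t by (simp add: F_def \<mu>_def)
  next
    case (Suc j)
    then have j: "j < k - 1" using i by simp
    have rho: "0 < \<rho> j" using e(2)[OF j] t by (smt (verit) divide_pos_pos)
    have "1 / \<rho> j \<le> t" using e(2)[OF j] rho t by (simp add: field_simps)
    then show ?thesis using green_eigenfunction_neumann[OF e(1)[OF j] rho e(3)[OF j]] Suc
      by (simp add: F_def \<mu>_def)
  qed
  ultimately show ?thesis unfolding eigenvalue_count_ge_def t_def[symmetric]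
    by (intro exI[of _ \<mu>] exI[of _ "\<lambda>i p. complex_of_real (F i (pos p))"]) auto
qed

section \<open>The lower bound\<close>

lemma sobolev_pair_sum:
  assumes "\<And>i. i < k \<Longrightarrow> sobolev_pair (f i) (g i)"
  shows "sobolev_pair (\<lambda>z. \<Sum>i<(k::nat). c i * f i z) (\<lambda>z. \<Sum>i<k. c i * g i z)"
proof (rule sobolev_pair_path_integral[where c = "\<Sum>i<k. c i * f i 1"])
  have g: "g i \<in> borel_measurable M" "integrable M (\<lambda>z. (norm (g i z))\<^sup>2)" if "i < k" for i
    using assms[OF that] by (auto simp: sobolev_pair_def)
  show "(\<lambda>z. \<Sum>i<k. c i * g i z) \<in> borel_measurable M" using g by (intro borel_measurable_sum) auto
  have int: "integrable M (\<lambda>z. g i z * cnj (g j z))" if "i < k" "j < k" for i j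
    using sobolev_pair_deriv_mult_integrable assms that by blast
  have "integrable M (\<lambda>z. \<Sum>i<k. \<Sum>j<k. (c i * cnj (c j)) * (g i z * cnj (g j z)))"
    using int by (intro Bochner_Integration.integrable_sum integrable_mult_right) auto
  also have "(\<lambda>z. \<Sum>i<k. \<Sum>j<k. (c i * cnj (c j)) * (g i z * cnj (g j z)))
      = (\<lambda>z. complex_of_real ((norm (\<Sum>i<k. c i * g i z))\<^sup>2))"
    unfolding complex_norm_square by (simp add: sum_product cnj_sum mult_ac)
  finally show "integrable M (\<lambda>z. (norm (\<Sum>i<k. c i * g i z))\<^sup>2)"
    by (simp only: complex_of_real_integrable_eq)
  fix q assume q: "q \<in> comb_set"
  have "path_integral (\<lambda>z. \<Sum>i<k. c i * g i z) q = (\<Sum>i<k. c i * path_integral (g i) q)"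
  proof -
    have int: "integrable M (\<lambda>z. incidence z q *\<^sub>R g i z)" if "i < k" for i
      by (rule kernel_integral_bound(2)[OF sobolev_pair_integrable[OF assms[OF that]] incidence_measurable_fst incidence_bound])
    have "path_integral (\<lambda>z. \<Sum>i<k. c i * g i z) q = (LINT z|M. (\<Sum>i<k. c i * (incidence z q *\<^sub>R g i z)))"
      unfolding path_integral_def by (simp add: scaleR_sum_right)
    also have "\<dots> = (\<Sum>i<k. LINT z|M. c i * (incidence z q *\<^sub>R g i z))"
      by (intro Bochner_Integration.integral_sum integrable_mult_right int) auto
    also have "\<dots> = (\<Sum>i<k. c i * path_integral (g i) q)"
      unfolding path_integral_def by (intro sum.cong refl integral_mult_right_zero)
    finally show ?thesis .
  qed
  moreover have "(\<Sum>i<k. c i * f i q) = (\<Sum>i<k. c i * f i 1 + c i * path_integral (g i) q)"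
  proof (intro sum.cong refl)
    fix i assume "i \<in> {..<k}"
    then have "f i q = f i 1 + path_integral (g i) q" using sobolev_pair_eq[OF assms q] by simp
    then show "c i * f i q = c i * f i 1 + c i * path_integral (g i) q" by (simp only: distrib_left)
  qed
  ultimately show "(\<Sum>i<k. c i * f i q) = (\<Sum>i<k. c i * f i 1) + path_integral (\<lambda>z. \<Sum>i<k. c i * g i z) q"
    by (simp add: sum.distrib)
qed

lemma integral_norm_sq_sum:
  fixes h :: "nat \<Rightarrow> real \<Rightarrow> complex"
  assumes "\<And>i j. i < k \<Longrightarrow> j < k \<Longrightarrow> integrable M (\<lambda>z. h i z * cnj (h j z))"
  shows "complex_of_real (LINT z|M. (norm (\<Sum>i<k. c i * h i z))\<^sup>2)
    = (\<Sum>i<k. \<Sum>j<k. c i * cnj (c j) * (LINT z|M. h i z * cnj (h j z)))"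
proof -
  have int: "integrable M (\<lambda>z. (c i * cnj (c j)) * (h i z * cnj (h j z)))" if "i < k" "j < k" for i j
    by (intro integrable_mult_right assms that)
  have "complex_of_real (LINT z|M. (norm (\<Sum>i<k. c i * h i z))\<^sup>2)
      = (LINT z|M. complex_of_real ((norm (\<Sum>i<k. c i * h i z))\<^sup>2))"
    by (rule integral_complex_of_real[symmetric])
  also have "(\<lambda>z. complex_of_real ((norm (\<Sum>i<k. c i * h i z))\<^sup>2))
      = (\<lambda>z. \<Sum>i<k. \<Sum>j<k. (c i * cnj (c j)) * (h i z * cnj (h j z)))"
    unfolding complex_norm_square by (simp add: sum_product cnj_sum mult_ac)
  also have "(LINT z|M. (\<Sum>i<k. \<Sum>j<k. (c i * cnj (c j)) * (h i z * cnj (h j z))))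
      = (\<Sum>i<k. LINT z|M. (\<Sum>j<k. (c i * cnj (c j)) * (h i z * cnj (h j z))))"
    by (intro Bochner_Integration.integral_sum Bochner_Integration.integrable_sum int) auto
  also have "\<dots> = (\<Sum>i<k. \<Sum>j<k. LINT z|M. (c i * cnj (c j)) * (h i z * cnj (h j z)))"
    by (intro sum.cong refl Bochner_Integration.integral_sum int) auto
  also have "\<dots> = (\<Sum>i<k. \<Sum>j<k. c i * cnj (c j) * (LINT z|M. h i z * cnj (h j z)))"
    by (intro sum.cong refl integral_mult_right_zero)
  finally show ?thesis .
qed

lemma neumann_eigenpair_gram:
  assumes "(\<phi>, \<lambda>p. of_real \<mu> * \<phi> p) \<in> neumann_laplacian G" "\<psi> \<in> H1_graph G"
  shows "(LINT z|M. line_deriv \<phi> z * cnj (line_deriv \<psi> z)) = of_real \<mu> * (LINT z|M. line_fn \<phi> z * cnj (line_fn \<psi> z))"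
proof -
  have phi: "\<phi> \<in> H1_graph G" using assms(1) by (simp add: neumann_laplacian_def)
  note pairs = H1_graph_sobolev_pair[OF phi] H1_graph_sobolev_pair[OF assms(2)]
  have "(LINT z|M. line_deriv \<phi> z * cnj (line_deriv \<psi> z)) = energy_form G \<phi> \<psi>"
    by (rule energy_form_eq[OF phi assms(2), symmetric])
  also have "\<dots> = L2_inner G (\<lambda>p. of_real \<mu> * \<phi> p) \<psi>"
    using assms by (simp add: neumann_laplacian_def)
  also have "\<dots> = (LINT z|M. (of_real \<mu> * line_fn \<phi> z) * cnj (line_fn \<psi> z))"
  proof (rule L2_inner_eq)
    show "grestr G (\<lambda>p. of_real \<mu> * \<phi> p) e y = of_real \<mu> * line_fn \<phi> (off e + y)"
      if "e \<in> gedges G" "y \<in> {0..len e}" for e y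
      using line_fn_edge[OF phi that] by (simp add: grestr_def)
    show "integrable M (\<lambda>z. (of_real \<mu> * line_fn \<phi> z) * cnj (line_fn \<psi> z))"
      using sobolev_pair_mult_integrable[OF pairs] by (simp add: mult.assoc)
  qed (rule line_fn_edge[OF assms(2)])
  finally show ?thesis by (simp add: mult.assoc)
qed

lemma sobolev_pair_norm_pos:
  assumes pair: "sobolev_pair f g" and e: "e \<in> gedges G" and y: "y \<in> {0..len e}" "f (off e + y) \<noteq> 0"
  shows "0 < (LINT z|M. (norm (f z))\<^sup>2)"
proof -
  have f2: "integrable M (\<lambda>z. (norm (f z))\<^sup>2)" by (rule sobolev_pair_norm_sq_integrable[OF pair])
  have prim: "primitive_on (off e) (off e + len e) f g"
    using e
  proof (cases rule: edge_cases)
    case (Tooth n)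
    then show ?thesis using sobolev_pair_tooth[OF pair, of n] by simp
  next
    case (Backbone n)
    show ?thesis
      by (rule primitive_on_subinterval[OF sobolev_pair_backbone[OF pair]])
        (use Backbone foot_bounds(2)[of n] foot_bounds(3)[of "Suc n"] in auto)
  qed
  have cont: "continuous_on {off e..off e + len e} (\<lambda>z. (norm (f z))\<^sup>2)"
    by (intro continuous_intros primitive_on_continuous[OF prim])
  have "integral {off e..off e + len e} (\<lambda>z. (norm (f z))\<^sup>2) \<noteq> 0"
    using integral_eq_0_iff[OF cont] len_pos[OF e] y by (auto intro!: bexI[of _ "off e + y"])
  moreover have int_e: "set_integrable lebesgue (edge_ivl e) (\<lambda>z. (norm (f z))\<^sup>2)"
    by (rule integrable_M_subset[OF f2 edge_ivl_subset[OF e] edge_ivl_sets])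
  ultimately have "sq_integral (edge_ivl e) f \<noteq> 0"
    by (simp add: edge_ivl_def set_lebesgue_integral_eq_integral(2))
  moreover have "0 \<le> sq_integral (edge_ivl e) f" by (simp add: set_lebesgue_integral_def)
  moreover have "sq_integral (edge_ivl e) f \<le> sq_integral (comb_set) f"
    using int_e f2 edge_ivl_subset[OF e] unfolding integrable_M_iff set_integrable_def set_lebesgue_integral_def
    by (intro integral_mono) (auto simp: indicator_def)
  ultimately show ?thesis by (simp add: integral_M_eq)
qed

text \<open>The Rayleigh quotient is at most \<open>t\<close> on the span of eigenfunctions with eigenvalues up to \<open>t\<close>. The
  bounds follow by evaluating it at any nonzero combination, and at one that vanishes at the points of
  \<open>comb_poincare_with_zeros\<close>; the frequency \<open>\<pi> k / (2 vol)\<close> itself is reached as a limit.\<close>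

lemma eigenvalue_count_lower:
  assumes count: "eigenvalue_count_ge G t k" and k: "1 \<le> k"
  shows "0 \<le> t" "2 \<le> k \<Longrightarrow> (pi * real k / (2 * vol))\<^sup>2 \<le> t"
proof -
  obtain \<mu> :: "nat \<Rightarrow> real" and \<phi> where indep: "lin_indep_on (gpoints G) k \<phi>"
    and mu: "\<And>i. i < k \<Longrightarrow> \<mu> i \<le> t"
    and eigen: "\<And>i. i < k \<Longrightarrow> (\<phi> i, \<lambda>p. of_real (\<mu> i) * \<phi> i p) \<in> neumann_laplacian G"
    using count unfolding eigenvalue_count_ge_def by blast
  have H1: "\<phi> i \<in> H1_graph G" if "i < k" for i using eigen[OF that] by (simp add: neumann_laplacian_def)
  define f where "f i = line_fn (\<phi> i)" for i
  define g where "g i = line_deriv (\<phi> i)" for i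
  have pair: "sobolev_pair (f i) (g i)" if "i < k" for i
    unfolding f_def g_def by (rule H1_graph_sobolev_pair[OF H1[OF that]])
  define N where "N i j = (LINT z|M. f i z * cnj (f j z))" for i j
  have gram: "(LINT z|M. g i z * cnj (g j z)) = of_real (\<mu> i) * N i j" if "i < k" "j < k" for i j
    unfolding f_def g_def N_def by (rule neumann_eigenpair_gram[OF eigen H1]) (use that in auto)
  have N_cnj: "N i j = cnj (N j i)" for i j
    by (simp add: N_def mult.commute flip: Bochner_Integration.integral_cnj)
  have N_orth: "N i j = 0" if "i < k" "j < k" "\<mu> i \<noteq> \<mu> j" for i j
  proof -
    have "(LINT z|M. g i z * cnj (g j z)) = cnj (LINT z|M. g j z * cnj (g i z))"
      by (simp add: mult.commute flip: Bochner_Integration.integral_cnj)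
    then have "of_real (\<mu> i) * N i j = cnj (LINT z|M. g j z * cnj (g i z))"
      by (simp only: gram[OF that(1,2)])
    also have "\<dots> = of_real (\<mu> j) * N i j"
      using N_cnj[of i j] by (simp add: gram[OF that(2,1)])
    finally have "(of_real (\<mu> i) - of_real (\<mu> j)) * N i j = 0" by (simp add: algebra_simps)
    then show ?thesis using that(3) by simp
  qed
  have f_int: "integrable M (\<lambda>z. f i z * cnj (f j z))" if "i < k" "j < k" for i j
    by (rule sobolev_pair_mult_integrable[OF pair pair]) (use that in auto)
  have g_int: "integrable M (\<lambda>z. g i z * cnj (g j z))" if "i < k" "j < k" for i j
    by (rule sobolev_pair_deriv_mult_integrable[OF pair pair]) (use that in auto)
  have norm_pos: "0 < (LINT z|M. (norm (\<Sum>i<k. c i * f i z))\<^sup>2)" if c: "\<exists>i<k. c i \<noteq> 0" for c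
  proof -
    obtain p where p: "p \<in> gpoints G" "(\<Sum>i<k. c i * \<phi> i p) \<noteq> 0"
      using indep c unfolding lin_indep_on_def by blast
    then obtain e y where e: "e \<in> gedges G" and y: "y \<in> {0..len e}" and py: "p = gchart G e y"
      by (auto simp: gpoints_def len_def)
    have "f i (off e + y) = \<phi> i p" if "i < k" for i
      using line_fn_edge[OF H1[OF that] e y] by (simp add: f_def grestr_def py)
    then have "(\<Sum>i<k. c i * f i (off e + y)) \<noteq> 0" using p(2) by simp
    from sobolev_pair_norm_pos[OF sobolev_pair_sum[OF pair] e y this] show ?thesis .
  qed
  \<comment> \<open>Eigenfunctions for different eigenvalues are orthogonal, so that \<open>t - \<mu> i\<close> may be replaced by
    the product of its square root for \<open>i\<close> and for \<open>j\<close> in the quadratic form.\<close>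
  have energy_le: "(LINT z|M. (norm (\<Sum>i<k. c i * g i z))\<^sup>2) \<le> t * (LINT z|M. (norm (\<Sum>i<k. c i * f i z))\<^sup>2)" for c
  proof -
    define s where "s i = sqrt (t - \<mu> i)" for i
    have s: "of_real (t - \<mu> i) * N i j = of_real (s i * s j) * N i j" if "i < k" "j < k" for i j
      using mu[OF that(1)] N_orth[OF that] by (cases "\<mu> i = \<mu> j") (auto simp: s_def)
    have "complex_of_real (t * (LINT z|M. (norm (\<Sum>i<k. c i * f i z))\<^sup>2) - (LINT z|M. (norm (\<Sum>i<k. c i * g i z))\<^sup>2))
        = (\<Sum>i<k. \<Sum>j<k. c i * cnj (c j) * (of_real (t - \<mu> i) * N i j))"
      using integral_norm_sq_sum[OF f_int, where c = c] integral_norm_sq_sum[OF g_int, where c = c] gram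
      by (simp add: N_def[symmetric] sum_distrib_left algebra_simps flip: sum_subtractf)
    also have "\<dots> = (\<Sum>i<k. \<Sum>j<k. (c i * of_real (s i)) * cnj (c j * of_real (s j)) * N i j)"
      by (intro sum.cong refl) (use s in \<open>simp add: mult_ac\<close>)
    also have "\<dots> = complex_of_real (LINT z|M. (norm (\<Sum>i<k. (c i * of_real (s i)) * f i z))\<^sup>2)"
      using integral_norm_sq_sum[OF f_int, where c = "\<lambda>i. c i * of_real (s i)"] by (simp add: N_def)
    finally have "t * (LINT z|M. (norm (\<Sum>i<k. c i * f i z))\<^sup>2) - (LINT z|M. (norm (\<Sum>i<k. c i * g i z))\<^sup>2)
        = (LINT z|M. (norm (\<Sum>i<k. (c i * of_real (s i)) * f i z))\<^sup>2)"
      by (simp only: of_real_eq_iff)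
    then show ?thesis by (smt (verit) integral_nonneg_AE AE_I2 zero_le_power2)
  qed
  show "0 \<le> t"
  proof -
    have pos: "0 < (LINT z|M. (norm (\<Sum>i<k. 1 * f i z))\<^sup>2)" using k by (intro norm_pos exI[of _ 0]) auto
    have "0 \<le> (LINT z|M. (norm (\<Sum>i<k. 1 * g i z))\<^sup>2)" by simp
    then have "0 \<le> t * (LINT z|M. (norm (\<Sum>i<k. 1 * f i z))\<^sup>2)" using energy_le[of "\<lambda>_. 1"] by linarith
    then show ?thesis using pos by (simp add: zero_le_mult_iff)
  qed
  assume k2: "2 \<le> k"
  have below: "\<omega>\<^sup>2 \<le> t" if omega: "0 < \<omega>" "\<omega> < pi * real k / (2 * vol)" for \<omega>
  proof -
    have "\<omega> * (vol / real k) < pi / 2"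
      using omega vol_pos k2 by (simp add: field_simps)
    from comb_poincare_with_zeros[OF k2 omega(1) this]
    obtain Z where Z: "finite Z" "card Z < k" "Z \<subseteq> comb_set"
      "\<And>f g. sobolev_pair f g \<Longrightarrow> (\<And>z. z \<in> Z \<Longrightarrow> f z = 0) \<Longrightarrow>
        \<omega>\<^sup>2 * (LINT z|M. (norm (f z))\<^sup>2) \<le> (LINT z|M. (norm (g z))\<^sup>2)" by blast
    obtain c where c: "\<exists>i<k. c i \<noteq> 0" "\<And>z. z \<in> Z \<Longrightarrow> (\<Sum>i<k. c i * f i z) = 0"
      using nontrivial_combination_vanishing[OF Z(1,2), of f] by blast
    have "\<omega>\<^sup>2 * (LINT z|M. (norm (\<Sum>i<k. c i * f i z))\<^sup>2) \<le> (LINT z|M. (norm (\<Sum>i<k. c i * g i z))\<^sup>2)"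
      by (rule Z(4)[OF sobolev_pair_sum[OF pair] c(2)])
    also have "\<dots> \<le> t * (LINT z|M. (norm (\<Sum>i<k. c i * f i z))\<^sup>2)" by (rule energy_le)
    finally show ?thesis using norm_pos[OF c(1)] by (simp only: mult_le_cancel_right_pos)
  qed
  define \<omega>0 where "\<omega>0 = pi * real k / (2 * vol)"
  have "0 < \<omega>0" using k2 vol_pos by (simp add: \<omega>0_def)
  have "\<forall>\<^sub>F \<omega> in at_left \<omega>0. \<omega>\<^sup>2 \<le> t"
    using eventually_at_left_real[OF \<open>0 < \<omega>0\<close>] by eventually_elim (use below in \<open>auto simp: \<omega>0_def\<close>)
  then show "(pi * real k / (2 * vol))\<^sup>2 \<le> t"
    unfolding \<omega>0_def[symmetric]
    by (intro tendsto_upperbound[of "\<lambda>\<omega>. \<omega>\<^sup>2" _ "at_left \<omega>0"]) (auto intro!: tendsto_intros)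
qed

end

theorem theorem2p10:
  fixes \<alpha> :: real and k :: nat
  assumes "1 < \<alpha>" and "1 \<le> k"
  shows "(2 \<le> k \<longrightarrow>
           pi\<^sup>2 * (real k)\<^sup>2 / (4 * (gvolume (diagonal_comb \<alpha>))\<^sup>2)
             \<le> neumann_eigenvalue (diagonal_comb \<alpha>) k)
       \<and> neumann_eigenvalue (diagonal_comb \<alpha>) k \<le> pi\<^sup>2 * (real k)\<^sup>2 / 4"
proof -
  interpret comb_model \<alpha> by unfold_locales (rule assms(1))
  let ?T = "{t. eigenvalue_count_ge (diagonal_comb \<alpha>) t k}"
  have upper: "pi\<^sup>2 * (real k)\<^sup>2 / 4 \<in> ?T"
    using eigenvalue_count_upper[OF assms(2)] by (simp add: power_divide power_mult_distrib)
  have "bdd_below ?T"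
    by (rule bdd_belowI[of _ 0]) (use eigenvalue_count_lower(1) assms(2) in auto)
  then have "neumann_eigenvalue (diagonal_comb \<alpha>) k \<le> pi\<^sup>2 * (real k)\<^sup>2 / 4"
    unfolding neumann_eigenvalue_def by (intro cInf_lower upper)
  moreover have "pi\<^sup>2 * (real k)\<^sup>2 / (4 * (gvolume (diagonal_comb \<alpha>))\<^sup>2) \<le> neumann_eigenvalue (diagonal_comb \<alpha>) k"
    if "2 \<le> k"
    unfolding neumann_eigenvalue_def
  proof (rule cInf_greatest)
    show "?T \<noteq> {}" using upper by blast
    fix t assume "t \<in> ?T"
    then have "(pi * real k / (2 * vol))\<^sup>2 \<le> t"
      using eigenvalue_count_lower(2)[of t k] assms(2) that by simp
    then show "pi\<^sup>2 * (real k)\<^sup>2 / (4 * (gvolume (diagonal_comb \<alpha>))\<^sup>2) \<le> t"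
      by (simp add: gvolume_eq power_divide power_mult_distrib)
  qed
  ultimately show ?thesis by blast
qed

end
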